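(* Let $\Omega\subset\mathbb{R}^N$ be open, bounded and connected with $C^2$ boundary, and let $\gamma$ be a constant with $0\le N\gamma<1$. Equip $\Omega$ with the Riemannian metric $ds^2=\sigma^{-2\gamma}(x)(dx_1^2+\dots+dx_N^2)$, where $\sigma(x)$ is the Euclidean distance from $x$ to $\partial\Omega$. Then the weak Hardy inequality holds on $\Omega$ with a constant $c$ satisfying \[ c\le\frac{2(1-\gamma)}{1+(N-2)\gamma}; \] that is, there exist such a $c>0$ and a constant $a<\infty$ with \[ \int_\Omega\frac{|f|^2}{d^2}\,\mathrm{d}vol\le c^2\left(Q(f)+a\|f\|_2^2\right)\qquad\text{for all } f\in W^{1,2}_0(\Omega). \]
   Context: The Riemannian volume element is $\mathrm{d}vol=\sigma^{-N\gamma}(x)\,\mathrm{d}^Nx$ and $\|f\|_2^2=\int_\Omega|f|^2\,\mathrm{d}vol$. The quadratic form is $Q(f)=\int_\Omega|\nabla f|^2\,\mathrm{d}vol=\int_\Omega|\nabla_E f|_E^2\,\sigma^{(2-N)\gamma}\,\mathrm{d}^Nx$ (subscript $E$ denotes Euclidean quantities). $W^{1,2}(\Omega)$ is the space of weakly differentiable functions with $Q(f)+\|f\|_2^2<\infty$, and $W^{1,2}_0(\Omega)$ is the closure of $C_c^\infty(\Omega)$ in $W^{1,2}(\Omega)$. $d(x)$ is the Riemannian distance from $x$ to $\partial\Omega$, i.e. the infimum of the Riemannian lengths of paths connecting $x$ to $\partial\Omega$. *)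

theory Defs
  imports "HOL-Analysis.Analysis"
begin

section \<open>Smooth functions, test functions and domains with smooth boundary\<close>

text \<open>Partial derivative in the \<open>i\<close>-th coordinate direction; meaningful where \<open>f\<close> is
  (Frechet) differentiable.\<close>

definition pderivative :: "'n \<Rightarrow> (real ^ 'n \<Rightarrow> 'b) \<Rightarrow> real ^ 'n \<Rightarrow> 'b :: real_normed_vector"
  where "pderivative i f x = frechet_derivative f (at x) (axis i 1)"

text \<open>To be used for open \<open>S\<close>.\<close>

primrec Ck_on :: "nat \<Rightarrow> (real ^ 'n \<Rightarrow> 'b :: real_normed_vector) \<Rightarrow> (real ^ 'n) set \<Rightarrow> bool" where
  "Ck_on 0 f S \<longleftrightarrow> continuous_on S f"
| "Ck_on (Suc k) f S \<longleftrightarrow>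
     (\<forall>x\<in>S. f differentiable (at x)) \<and> (\<forall>i. Ck_on k (pderivative i f) S)"

definition Cc_infinity :: "(real ^ 'n) set \<Rightarrow> (real ^ 'n \<Rightarrow> complex) set" where
  "Cc_infinity \<Omega> = {\<phi>. (\<forall>k. Ck_on k \<phi> UNIV) \<and>
     compact (closure {x. \<phi> x \<noteq> 0}) \<and> closure {x. \<phi> x \<noteq> 0} \<subseteq> \<Omega>}"

text \<open>Near each boundary point, \<open>\<Omega>\<close> is the strict sublevel set of a \<open>C\<^sup>2\<close> function without
  critical points, whose zero set is the boundary. This agrees with the local-graph definition,
  and it also makes sense in dimension one.\<close>

definition C2_boundary :: "(real ^ 'n) set \<Rightarrow> bool" where
  "C2_boundary \<Omega> \<longleftrightarrow>
     (\<forall>p \<in> frontier \<Omega>. \<exists>U (\<rho> :: real ^ 'n \<Rightarrow> real).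
        open U \<and> p \<in> U \<and> Ck_on 2 \<rho> U \<and>
        (\<forall>x\<in>U. \<exists>i. pderivative i \<rho> x \<noteq> 0) \<and>
        \<Omega> \<inter> U = {x \<in> U. \<rho> x < 0} \<and> frontier \<Omega> \<inter> U = {x \<in> U. \<rho> x = 0})"


section \<open>Weak gradients\<close>

definition locally_integrable_on ::
    "(real ^ 'n) set \<Rightarrow> (real ^ 'n \<Rightarrow> 'b :: {banach, second_countable_topology}) \<Rightarrow> bool" where
  "locally_integrable_on \<Omega> f \<longleftrightarrow>
     (\<forall>K. compact K \<and> K \<subseteq> \<Omega> \<longrightarrow> integrable (lebesgue_on K) f)"

definition has_weak_gradient ::
    "(real ^ 'n) set \<Rightarrow> (real ^ 'n \<Rightarrow> complex) \<Rightarrow> (real ^ 'n \<Rightarrow> complex ^ 'n) \<Rightarrow> bool" where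
  "has_weak_gradient \<Omega> f g \<longleftrightarrow>
     locally_integrable_on \<Omega> f \<and> locally_integrable_on \<Omega> g \<and>
     (\<forall>\<phi> \<in> Cc_infinity \<Omega>. \<forall>i.
        (\<integral>x. f x * pderivative i \<phi> x \<partial>lebesgue_on \<Omega>) =
        - (\<integral>x. (g x $ i) * \<phi> x \<partial>lebesgue_on \<Omega>))"

definition weakly_differentiable_on :: "(real ^ 'n) set \<Rightarrow> (real ^ 'n \<Rightarrow> complex) \<Rightarrow> bool" where
  "weakly_differentiable_on \<Omega> f \<longleftrightarrow> (\<exists>g. has_weak_gradient \<Omega> f g)"

text \<open>The weak gradient is unique up to null sets, so integrals over \<open>\<Omega>\<close> do not depend on the
  choice.\<close>

definition weak_gradient ::
    "(real ^ 'n) set \<Rightarrow> (real ^ 'n \<Rightarrow> complex) \<Rightarrow> real ^ 'n \<Rightarrow> complex ^ 'n" where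
  "weak_gradient \<Omega> f = (SOME g. has_weak_gradient \<Omega> f g)"


section \<open>The metric \<open>ds\<^sup>2 = \<sigma>\<^bsup>-2\<gamma>\<^esup> (dx\<^sub>1\<^sup>2 + \<dots> + dx\<^sub>N\<^sup>2)\<close>\<close>

definition bdist :: "(real ^ 'n) set \<Rightarrow> real ^ 'n \<Rightarrow> real" where
  "bdist \<Omega> x = infdist x (frontier \<Omega>)"

definition dvol :: "(real ^ 'n) set \<Rightarrow> real \<Rightarrow> (real ^ 'n) measure" where
  "dvol \<Omega> \<gamma> = density (lebesgue_on \<Omega>) (\<lambda>x. ennreal (bdist \<Omega> x powr (- (real CARD('n) * \<gamma>))))"

text \<open>A tangent vector \<open>v\<close> at \<open>x\<close> has Riemannian length \<open>\<sigma>\<^bsup>-\<gamma>\<^esup> |v|\<close>. The length of a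
  path may be infinite.\<close>

definition riem_length :: "(real ^ 'n) set \<Rightarrow> real \<Rightarrow> (real \<Rightarrow> real ^ 'n) \<Rightarrow> ennreal" where
  "riem_length \<Omega> \<gamma> p =
     (\<integral>\<^sup>+t\<in>{0..1}. ennreal (bdist \<Omega> (p t) powr (- \<gamma>) * norm (vector_derivative p (at t))) \<partial>lborel)"

text \<open>Paths are piecewise \<open>C\<^sup>1\<close> and lie in \<open>\<Omega>\<close>, where the metric is defined, up to their
  endpoint on the boundary.\<close>

definition riem_bdist :: "(real ^ 'n) set \<Rightarrow> real \<Rightarrow> real ^ 'n \<Rightarrow> ennreal" where
  "riem_bdist \<Omega> \<gamma> x =
     (INF p \<in> {p. valid_path p \<and> pathstart p = x \<and> pathfinish p \<in> frontier \<Omega> \<and>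
                  p ` {0..<1} \<subseteq> \<Omega>}. riem_length \<Omega> \<gamma> p)"


section \<open>Quadratic form and Sobolev spaces\<close>

definition L2_normsq :: "(real ^ 'n) set \<Rightarrow> real \<Rightarrow> (real ^ 'n \<Rightarrow> complex) \<Rightarrow> ennreal" where
  "L2_normsq \<Omega> \<gamma> f = (\<integral>\<^sup>+x. ennreal ((cmod (f x))\<^sup>2) \<partial>dvol \<Omega> \<gamma>)"

text \<open>\<open>|\<nabla>f|\<^sup>2 dvol = |\<nabla>\<^sub>E f|\<^sub>E\<^sup>2 \<sigma>\<^bsup>2\<gamma>\<^esup> \<sigma>\<^bsup>-N\<gamma>\<^esup> d\<^sup>Nx\<close>, since the metric
  induced on covectors is \<open>\<sigma>\<^bsup>2\<gamma>\<^esup>\<close> times the Euclidean one.\<close>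

definition Qform :: "(real ^ 'n) set \<Rightarrow> real \<Rightarrow> (real ^ 'n \<Rightarrow> complex) \<Rightarrow> ennreal" where
  "Qform \<Omega> \<gamma> f =
     (\<integral>\<^sup>+x. ennreal ((norm (weak_gradient \<Omega> f x))\<^sup>2 * bdist \<Omega> x powr ((2 - real CARD('n)) * \<gamma>))
        \<partial>lebesgue_on \<Omega>)"

definition W12 :: "(real ^ 'n) set \<Rightarrow> real \<Rightarrow> (real ^ 'n \<Rightarrow> complex) set" where
  "W12 \<Omega> \<gamma> = {f. weakly_differentiable_on \<Omega> f \<and> Qform \<Omega> \<gamma> f + L2_normsq \<Omega> \<gamma> f < \<infinity>}"

definition W12_0 :: "(real ^ 'n) set \<Rightarrow> real \<Rightarrow> (real ^ 'n \<Rightarrow> complex) set" where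
  "W12_0 \<Omega> \<gamma> = {f \<in> W12 \<Omega> \<gamma>. \<exists>\<phi>. (\<forall>n::nat. \<phi> n \<in> Cc_infinity \<Omega>) \<and>
     (\<lambda>n. Qform \<Omega> \<gamma> (\<lambda>x. f x - \<phi> n x) + L2_normsq \<Omega> \<gamma> (\<lambda>x. f x - \<phi> n x)) \<longlonglongrightarrow> 0}"


section \<open>Weak Hardy inequality\<close>

definition weak_Hardy :: "(real ^ 'n) set \<Rightarrow> real \<Rightarrow> real \<Rightarrow> bool" where
  "weak_Hardy \<Omega> \<gamma> c \<longleftrightarrow> c > 0 \<and>
     (\<exists>a::real. a \<ge> 0 \<and>
       (\<forall>f \<in> W12_0 \<Omega> \<gamma>.
          (\<integral>\<^sup>+x. ennreal ((cmod (f x))\<^sup>2) / (riem_bdist \<Omega> \<gamma> x)\<^sup>2 \<partial>dvol \<Omega> \<gamma>)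
            \<le> ennreal (c\<^sup>2) * (Qform \<Omega> \<gamma> f + ennreal a * L2_normsq \<Omega> \<gamma> f)))"

end

theory Submission
  imports Defs
begin

text \<open>Let \<open>\<sigma>\<close> be the distance to the boundary, \<open>\<beta> = (2 - N)\<gamma>\<close> and \<open>s = (1 - \<beta>)/2\<close>. Since \<open>\<sigma>\<close> is 1-Lipschitz, every
  path from \<open>x\<close> to the boundary has Riemannian length at least \<open>\<sigma>(x)\<^bsup>1-\<gamma>\<^esup>/(1 - \<gamma>)\<close>, so it suffices to prove
  the weighted Euclidean inequality \<open>s\<^sup>2 \<integral> |f|\<^sup>2 \<sigma>\<^bsup>\<beta>-2\<^esup> \<le> \<integral> |\<nabla>f|\<^sup>2 \<sigma>\<^bsup>\<beta>\<^esup> + a \<integral> |f|\<^sup>2 \<sigma>\<^bsup>-N\<gamma>\<^esup>\<close>. For test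
  functions it follows from the ground state substitution with \<open>u = \<sigma>\<^bsup>s\<^esup> - k \<sigma>\<^bsup>s+1/2\<^esup>\<close>. Only an upper bound
  for the Laplacian of \<open>\<sigma>\<close> is needed. A \<open>C\<^sup>2\<close> boundary has a uniform exterior ball property, and
  an exterior ball touching at a nearest boundary point makes \<open>\<sigma>\<close> semiconcave; working with finite
  differences, this one-sided bound can be used directly, so that the regularity of \<open>\<sigma>\<close> near the
  boundary plays no role. The passage to the closure of the test functions rests on the uniqueness
  of weak gradients.\<close>

section \<open>Semiconcavity of the distance to the boundary\<close>

text \<open>With \<beta> = 1 - 2s, the equation
  \<open>(t^\<beta> u')' = - s^2 t^(\<beta>-2) u\<close> has the double indicial root s. This fixes
  s, and the factor 1 - \<gamma> from the comparison of distances then gives the constant (1 -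
  \<gamma>)/s, which is the stated bound for c. The double root leaves no slack: t^s solves the
  equation exactly, while the boundary curvature adds an error of order t^(-s), and the term with a,
  of order t^(s - N\<gamma>), does not in general dominate it near t = 0. This forces the correction
  term. An exponent s + \<delta> yields the surplus \<open>k \<delta>^2 t^(\<delta>-s-1)\<close>, so
  every 0 < \<delta> < 1 would serve and 1/2 is a convenient choice. One-sided control of \<sigma>
  suffices because g is increasing: an upper bound for \<sigma> near x is also one for g(\<sigma>).
  The exterior balls give this bound at every point of \<Omega>, not only near the boundary, so no
  cut-off functions enter.\<close>

lemma frechet_derivative_pderivative:
  fixes f :: "real ^ 'n \<Rightarrow> 'b :: real_normed_vector"
  assumes "f differentiable (at x)"
  shows "frechet_derivative f (at x) h = (\<Sum>i\<in>UNIV. (h $ i) *\<^sub>R pderivative i f x)"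
proof -
  interpret linear "frechet_derivative f (at x)"
    using assms by (simp add: linear_frechet_derivative)
  have "h = (\<Sum>i\<in>UNIV. (h $ i) *\<^sub>R axis i 1)"
    using basis_expansion[of h] by (simp add: scalar_mult_eq_scaleR)
  then have "frechet_derivative f (at x) h
      = frechet_derivative f (at x) (\<Sum>i\<in>UNIV. (h $ i) *\<^sub>R axis i 1)" by simp
  also have "\<dots> = (\<Sum>i\<in>UNIV. (h $ i) *\<^sub>R pderivative i f x)"
    by (simp add: sum scale pderivative_def)
  finally show ?thesis .
qed

lemma pderivative_eqI:
  assumes "(f has_derivative f') (at x)"
  shows "pderivative i f x = f' (axis i 1)"
  using frechet_derivative_at[OF assms] by (simp add: pderivative_def)

lemma pderivative_lipschitz:
  fixes f :: "real ^ 'n \<Rightarrow> 'b :: real_normed_vector"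
  assumes "convex S" and d: "\<And>x. x \<in> S \<Longrightarrow> f differentiable (at x)"
    and b: "\<And>x j. x \<in> S \<Longrightarrow> norm (pderivative j f x) \<le> M"
    and "x \<in> S" "y \<in> S"
  shows "norm (f x - f y) \<le> real CARD('n) * M * norm (x - y)"
proof (rule differentiable_bound[OF \<open>convex S\<close> _ _ \<open>x \<in> S\<close> \<open>y \<in> S\<close>])
  fix u assume u: "u \<in> S"
  show "(f has_derivative frechet_derivative f (at u)) (at u within S)"
    using d[OF u] by (simp add: frechet_derivative_works has_derivative_at_withinI)
  show "onorm (frechet_derivative f (at u)) \<le> real CARD('n) * M"
  proof (rule onorm_le)
    fix h :: "real ^ 'n"
    have "norm (frechet_derivative f (at u) h) \<le> (\<Sum>i\<in>UNIV. norm ((h $ i) *\<^sub>R pderivative i f u))"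
      unfolding frechet_derivative_pderivative[OF d[OF u]] by (rule norm_sum)
    also have "\<dots> \<le> (\<Sum>i\<in>(UNIV :: 'n set). norm h * M)"
      using b[OF u] by (intro sum_mono) (auto intro!: mult_mono component_le_norm_cart)
    finally show "norm (frechet_derivative f (at u) h) \<le> real CARD('n) * M * norm h"
      by (simp add: mult_ac)
  qed
qed

text \<open>Removing the linear part at x leaves a function whose partial derivatives on the segment
  are the differences \<open>pderivative j f u - pderivative j f x\<close>. The mean value bound is
  applied once to these differences and once to the remainder; each application costs a factor
  \<open>CARD('n)\<close>.\<close>

lemma pderivative_taylor:
  fixes f :: "real ^ 'n \<Rightarrow> real"
  assumes S: "convex S" and d: "\<And>x. x \<in> S \<Longrightarrow> f differentiable (at x)"
    and d2: "\<And>x i. x \<in> S \<Longrightarrow> pderivative i f differentiable (at x)"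
    and b: "\<And>x i j. x \<in> S \<Longrightarrow> norm (pderivative j (pderivative i f) x) \<le> M"
    and x: "x \<in> S" and y: "y \<in> S"
  shows "\<bar>f y - f x - (\<Sum>i\<in>UNIV. (y - x) $ i * pderivative i f x)\<bar>
     \<le> (real CARD('n))\<^sup>2 * M * (norm (y - x))\<^sup>2"
proof -
  let ?k = "\<lambda>u. f u - (\<Sum>i\<in>UNIV. u $ i * pderivative i f x)"
  let ?T = "closed_segment x y"
  have T: "u \<in> S" if "u \<in> ?T" for u
    using that S x y closed_segment_subset by blast
  have M: "M \<ge> 0" using b[OF x] norm_ge_zero order_trans by blast
  have der: "(?k has_derivative (\<lambda>h. frechet_derivative f (at u) h
      - (\<Sum>i\<in>UNIV. h $ i * pderivative i f x))) (at u)" if "u \<in> ?T" for u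
    by (intro has_derivative_diff has_derivative_sum has_derivative_mult_left
          bounded_linear_imp_has_derivative bounded_linear_vec_nth)
       (use d[OF T[OF that]] frechet_derivative_works in blast)
  have pd: "pderivative j ?k u = pderivative j f u - pderivative j f x" if "u \<in> ?T" for u j
    using pderivative_eqI[OF der[OF that], of j]
    by (simp add: pderivative_def axis_def if_distrib[of "\<lambda>a. a * _"] cong: if_cong)
  have "norm (?k y - ?k x) \<le> real CARD('n) * (real CARD('n) * M * norm (y - x)) * norm (y - x)"
  proof (rule pderivative_lipschitz[where S = ?T])
    fix u assume u: "u \<in> ?T"
    show "?k differentiable at u" using der[OF u] by (auto simp: differentiable_def)
    fix j
    have "norm (pderivative j f u - pderivative j f x) \<le> real CARD('n) * M * norm (u - x)"
      by (rule pderivative_lipschitz[OF S _ _ T[OF u] x]) (use d2 b in auto)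
    also have "\<dots> \<le> real CARD('n) * M * norm (y - x)"
      using u M by (intro mult_left_mono) (auto simp: norm_minus_commute dest: segment_bound1)
    finally show "norm (pderivative j ?k u) \<le> real CARD('n) * M * norm (y - x)"
      using pd[OF u] by simp
  qed auto
  moreover have "?k y - ?k x = f y - f x - (\<Sum>i\<in>UNIV. (y - x) $ i * pderivative i f x)"
    by (simp add: left_diff_distrib sum_subtractf)
  ultimately show ?thesis by (simp add: power2_eq_square mult_ac)
qed

section \<open>Exterior balls at a twice differentiable boundary\<close>

text \<open>The centre slides along the radius towards y, so the smaller ball is internally tangent
  there. This lets all boundary points share one radius.\<close>

lemma exterior_ball_shrink:
  fixes z :: "'a :: euclidean_space"
  assumes "dist y z = R" "0 < r" "r \<le> R"
  shows "\<exists>z'. dist y z' = r \<and> ball z' r \<subseteq> ball z R"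
proof (intro exI conjI)
  let ?z = "y + (r / R) *\<^sub>R (z - y)"
  have R: "R > 0" using assms by simp
  have n: "norm (z - y) = R" using assms(1) by (simp add: dist_norm norm_minus_commute)
  show "dist y ?z = r" using R assms n by (simp add: dist_norm)
  have "z - ?z = (1 - r / R) *\<^sub>R (z - y)" by (simp add: algebra_simps)
  then have "dist z ?z = \<bar>1 - r / R\<bar> * R"
    using n by (simp only: dist_norm norm_scaleR)
  also have "\<dots> = R - r"
    using R assms by (simp add: field_simps)
  finally have "dist z ?z = R - r" .
  then show "ball ?z r \<subseteq> ball z R"
    by (smt (verit) dist_commute dist_triangle mem_ball subsetI)
qed

text \<open>The ball is centred at y + R \<nu>, with \<nu> the unit vector along the gradient of
  \<rho>. A displacement h from y into the ball satisfies |h|^2 < 2R (h . \<nu>), whereas \<rho> < 0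
  and Taylor's formula force |grad \<rho>| (h . \<nu>) \<le> A |h|^2. For small R the two are
  incompatible.\<close>

lemma local_exterior_ball:
  fixes \<Omega> :: "(real ^ 'n) set"
  assumes "C2_boundary \<Omega>" "p \<in> frontier \<Omega>"
  shows "\<exists>r>0. \<exists>R>0. \<forall>y\<in>frontier \<Omega> \<inter> ball p r. \<exists>z. dist y z = R \<and> ball z R \<inter> \<Omega> = {}"
proof -
  obtain U and \<rho> :: "real ^ 'n \<Rightarrow> real" where U: "open U" "p \<in> U" and C: "Ck_on 2 \<rho> U"
    and nz: "\<forall>x\<in>U. \<exists>i. pderivative i \<rho> x \<noteq> 0"
    and O: "\<Omega> \<inter> U = {x \<in> U. \<rho> x < 0}" and F: "frontier \<Omega> \<inter> U = {x \<in> U. \<rho> x = 0}"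
    using bspec[OF assms(1)[unfolded C2_boundary_def] assms(2)]
    by (elim exE conjE) (rule that; assumption)
  have d1: "\<rho> differentiable (at x)" if "x \<in> U" for x
    using C that by (simp add: numeral_2_eq_2)
  have d2: "pderivative i \<rho> differentiable (at x)" if "x \<in> U" for x i
    using C that by (simp add: numeral_2_eq_2)
  have c2: "continuous_on U (pderivative j (pderivative i \<rho>))" for i j
    using C by (simp add: numeral_2_eq_2)
  have c1: "continuous_on U (pderivative i \<rho>)" for i
    using d2 by (meson continuous_at_imp_continuous_on differentiable_imp_continuous_within)
  obtain e where e: "e > 0" "cball p e \<subseteq> U"
    using U open_contains_cball by blast
  let ?B = "cball p e"
  define M where "M = (\<Sum>i\<in>UNIV. \<Sum>j\<in>UNIV. SUP x\<in>?B. norm (pderivative j (pderivative i \<rho>) x))"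
  have bdd: "bdd_above ((\<lambda>x. norm (pderivative j (pderivative i \<rho>) x)) ` ?B)" for i j
    by (intro bounded_imp_bdd_above compact_imp_bounded compact_continuous_image
        continuous_on_norm continuous_on_subset[OF c2 e(2)]) auto
  have up: "norm (pderivative j (pderivative i \<rho>) x) \<le> (SUP x\<in>?B. norm (pderivative j (pderivative i \<rho>) x))"
    if "x \<in> ?B" for x i j
    using bdd that by (rule cSUP_upper2) auto
  have up0: "0 \<le> (SUP x\<in>?B. norm (pderivative j (pderivative i \<rho>) x))" for i j
    using up[of p j i] e(1) norm_ge_zero[of "pderivative j (pderivative i \<rho>) p"] by simp
  have M: "norm (pderivative j (pderivative i \<rho>) x) \<le> M" if "x \<in> ?B" for x i j
  proof -
    have "norm (pderivative j (pderivative i \<rho>) x) \<le> (SUP x\<in>?B. norm (pderivative j (pderivative i \<rho>) x))"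
      by (rule up[OF that])
    also have "\<dots> \<le> (\<Sum>j\<in>UNIV. SUP x\<in>?B. norm (pderivative j (pderivative i \<rho>) x))"
      by (rule member_le_sum) (rule up0 | simp)+
    also have "\<dots> \<le> M" unfolding M_def
      by (rule member_le_sum[of i UNIV "\<lambda>i. \<Sum>j\<in>UNIV. SUP x\<in>?B. norm (pderivative j (pderivative i \<rho>) x)"])
         (rule sum_nonneg up0 | simp)+
    finally show ?thesis .
  qed
  define q where "q x = (\<chi> i. pderivative i \<rho> x)" for x
  have cq: "continuous_on ?B (\<lambda>x. norm (q x))"
    unfolding q_def by (intro continuous_on_norm continuous_on_vec_lambda continuous_on_subset[OF c1 e(2)])
  obtain x0 where x0: "x0 \<in> ?B" "\<And>x. x \<in> ?B \<Longrightarrow> norm (q x0) \<le> norm (q x)"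
    using continuous_attains_inf[OF _ _ cq] e(1) by auto
  have m: "norm (q x0) > 0"
    using bspec[OF nz, of x0] x0(1) e(2) by (auto simp: q_def vec_eq_iff)
  define A where "A = (real CARD('n))\<^sup>2 * M"
  have A: "A \<ge> 0" using M[of p] e(1) norm_ge_zero order_trans unfolding A_def
    by (metis centre_in_cball less_imp_le mult_nonneg_nonneg zero_le_power2)
  \<comment> \<open>The ball stays within 2R \<le> e/2 of y, hence in \<open>cball p e\<close> when
    y is within e/2 of p. The second bound gives 2(A + 1)R \<le> |q x0| \<le> |q y|; A + 1 replaces
    A because A may be 0.\<close>
  define R where "R = min (e / 4) (norm (q x0) / (2 * (A + 1)))"
  have R: "R > 0" using e m A by (simp add: R_def)
  have "\<exists>z. dist y z = R \<and> ball z R \<inter> \<Omega> = {}" if y: "y \<in> frontier \<Omega> \<inter> ball p (e/2)" for y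
  proof -
    have yB: "y \<in> ?B" using y e by auto
    have y0: "\<rho> y = 0" using y F e(2) yB by auto
    have qy: "norm (q x0) \<le> norm (q y)" using x0 yB by blast
    define \<nu> where "\<nu> = (1 / norm (q y)) *\<^sub>R q y"
    have "norm (q y) \<noteq> 0" using qy m by linarith
    then have n1: "norm \<nu> = 1" and q\<nu>: "q y = norm (q y) *\<^sub>R \<nu>"
      by (simp_all add: \<nu>_def)
    have "x \<notin> \<Omega>" if x: "x \<in> ball (y + R *\<^sub>R \<nu>) R" for x
    proof
      assume xO: "x \<in> \<Omega>"
      define h where "h = x - y"
      have 1: "norm (h - R *\<^sub>R \<nu>) < R"
        using x by (simp add: h_def dist_norm norm_minus_commute algebra_simps)
      have "(norm (h - R *\<^sub>R \<nu>))\<^sup>2 < R\<^sup>2" using 1 R by (intro power_strict_mono) auto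
      moreover have "(norm (h - R *\<^sub>R \<nu>))\<^sup>2 = (norm h)\<^sup>2 - 2 * R * (h \<bullet> \<nu>) + R\<^sup>2"
        using n1 unfolding power2_norm_eq_inner
        by (simp add: inner_diff_left inner_diff_right inner_commute power2_eq_square norm_eq_1)
      ultimately have hn: "(norm h)\<^sup>2 < 2 * R * (h \<bullet> \<nu>)" by simp
      have "norm h < 2 * R"
        using norm_triangle_ineq[of "h - R *\<^sub>R \<nu>" "R *\<^sub>R \<nu>"] 1 n1 R by simp
      then have "norm h < e / 2" by (simp add: R_def)
      then have "dist y x < e / 2" by (simp add: h_def dist_norm norm_minus_commute)
      then have xB: "x \<in> ?B" using y dist_triangle[of p x y] by simp
      then have rx: "\<rho> x < 0" using O xO e(2) by auto
      have "\<bar>\<rho> x - \<rho> y - (\<Sum>i\<in>UNIV. (x - y) $ i * pderivative i \<rho> y)\<bar> \<le> (real CARD('n))\<^sup>2 * M * (norm (x - y))\<^sup>2"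
        by (rule pderivative_taylor[where S = ?B]) (use d1 d2 M e(2) xB yB in auto)
      moreover have "(\<Sum>i\<in>UNIV. (x - y) $ i * pderivative i \<rho> y) = h \<bullet> q y"
        by (simp add: inner_vec_def q_def h_def)
      ultimately have "h \<bullet> q y \<le> A * (norm h)\<^sup>2" using rx y0 by (simp add: A_def h_def abs_if split: if_splits)
      moreover have "h \<bullet> q y = norm (q y) * (h \<bullet> \<nu>)"
        by (subst q\<nu>) simp
      ultimately have 2: "norm (q y) * (h \<bullet> \<nu>) \<le> A * (norm h)\<^sup>2" by simp
      have h\<nu>: "h \<bullet> \<nu> > 0" using hn R
        by (smt (verit, best) mult_nonneg_nonneg zero_le_power2 mult_nonneg_nonpos)
      have "norm (q x0) * (h \<bullet> \<nu>) \<le> norm (q y) * (h \<bullet> \<nu>)" using qy h\<nu> by simp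
      also have "\<dots> \<le> (A + 1) * (norm h)\<^sup>2"         using 2 zero_le_power2[of "norm h"] unfolding distrib_right by linarith
      also have "\<dots> < (A + 1) * (2 * R * (h \<bullet> \<nu>))" using hn A by simp
      also have "\<dots> = (2 * (A + 1) * R) * (h \<bullet> \<nu>)" by simp
      also have "\<dots> \<le> norm (q x0) * (h \<bullet> \<nu>)"
      proof (rule mult_right_mono)
        have "R \<le> norm (q x0) / (2 * (A + 1))" by (simp add: R_def)
        then show "2 * (A + 1) * R \<le> norm (q x0)" using A by (simp add: field_simps)
      qed (use h\<nu> in simp)
      finally show False by simp
    qed
    then have "ball (y + R *\<^sub>R \<nu>) R \<inter> \<Omega> = {}" by blast
    moreover have "dist y (y + R *\<^sub>R \<nu>) = R" using n1 R by (simp add: dist_norm)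
    ultimately show ?thesis by blast
  qed
  then show ?thesis using R e(1) by (meson half_gt_zero)
qed

lemma uniform_exterior_ball:
  fixes \<Omega> :: "(real ^ 'n) set"
  assumes "bounded \<Omega>" "C2_boundary \<Omega>"
  shows "\<exists>R>0. \<forall>y\<in>frontier \<Omega>. \<exists>z. dist y z = R \<and> ball z R \<inter> \<Omega> = {}"
proof -
  have c: "compact (frontier \<Omega>)" using assms(1) by (rule compact_frontier_bounded)
  have "\<forall>p\<in>frontier \<Omega>. \<exists>r R. r > 0 \<and> R > 0 \<and>
    (\<forall>y\<in>frontier \<Omega> \<inter> ball p r. \<exists>z. dist y z = R \<and> ball z R \<inter> \<Omega> = {})"
    using local_exterior_ball[OF assms(2)] by meson
  from bchoice[OF this] obtain r where "\<forall>p\<in>frontier \<Omega>. \<exists>R. r p > 0 \<and> R > 0 \<and>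
    (\<forall>y\<in>frontier \<Omega> \<inter> ball p (r p). \<exists>z. dist y z = R \<and> ball z R \<inter> \<Omega> = {})" by (rule exE)
  from bchoice[OF this] obtain R where *: "\<forall>p\<in>frontier \<Omega>. r p > 0 \<and> R p > 0 \<and>
    (\<forall>y\<in>frontier \<Omega> \<inter> ball p (r p). \<exists>z. dist y z = R p \<and> ball z (R p) \<inter> \<Omega> = {})" by (rule exE)
  have r: "r p > 0" and R: "R p > 0"
    and b: "y \<in> ball p (r p) \<Longrightarrow> y \<in> frontier \<Omega> \<Longrightarrow> \<exists>z. dist y z = R p \<and> ball z (R p) \<inter> \<Omega> = {}"
    if "p \<in> frontier \<Omega>" for p y
    using bspec[OF * that] by simp_all
  obtain T where T: "T \<subseteq> frontier \<Omega>" "finite T" "frontier \<Omega> \<subseteq> (\<Union>p\<in>T. ball p (r p))"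
  proof (rule compactE_image[OF c, of "frontier \<Omega>" "\<lambda>p. ball p (r p)"])
    show "frontier \<Omega> \<subseteq> (\<Union>p\<in>frontier \<Omega>. ball p (r p))" using r by fastforce
  qed (auto intro: that)
  \<comment> \<open>The 1 keeps \<open>Min\<close> meaningful when the frontier, and with it the
    cover, is empty.\<close>
  define R0 where "R0 = Min (insert 1 (R ` T))"
  have R0: "R0 > 0" using T R unfolding R0_def by (subst Min_gr_iff) auto
  have R0le: "R0 \<le> R p" if "p \<in> T" for p using that T(2) by (auto simp: R0_def)
  have "\<exists>z. dist y z = R0 \<and> ball z R0 \<inter> \<Omega> = {}" if y: "y \<in> frontier \<Omega>" for y
  proof -
    obtain p where p: "p \<in> T" "y \<in> ball p (r p)" using T y by auto
    then obtain z where z: "dist y z = R p" "ball z (R p) \<inter> \<Omega> = {}" using b[OF subsetD[OF T(1) p(1)] p(2) y] by auto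
    obtain z' where "dist y z' = R0" "ball z' R0 \<subseteq> ball z (R p)"
      using exterior_ball_shrink[OF z(1) R0 R0le[OF p(1)]] by blast
    then show ?thesis using z(2) by blast
  qed
  then show ?thesis using R0 by blast
qed

section \<open>Comparison of the boundary distance with exterior balls\<close>

text \<open>The segment from x to the point of the sphere facing x ends outside \<Omega>, so it
  meets the frontier on the way, and its length is \<open>dist x z - R\<close>.\<close>

lemma bdist_le_exterior:
  fixes \<Omega> :: "(real ^ 'n) set"
  assumes "open \<Omega>" "ball z R \<inter> \<Omega> = {}" "R > 0" "x \<in> \<Omega>"
  shows "bdist \<Omega> x \<le> dist x z - R"
proof -
  have xz: "R \<le> dist x z" using assms by (metis disjoint_iff dist_commute mem_ball not_le)
  define q where "q = z + (R / dist x z) *\<^sub>R (x - z)"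

  have "dist x z > 0" using xz assms(3) by linarith
  then have "dist q z = R" using assms(3) by (simp add: q_def dist_norm)
  \<comment> \<open>q lies on the sphere and not in the open ball; it is excluded because an open
    set disjoint from the ball is disjoint from its closure.\<close>
  have "q \<notin> \<Omega>"
  proof
    assume "q \<in> \<Omega>"
    have "q \<in> closure (ball z R)" using \<open>dist q z = R\<close> assms(3) by (simp add: dist_commute)
    moreover have "\<Omega> \<inter> closure (ball z R) = {}"
      using open_Int_closure_eq_empty[OF assms(1)] assms(2) by blast
    ultimately show False using \<open>q \<in> \<Omega>\<close> by blast
  qed
  then obtain p where p: "p \<in> closed_segment x q" "p \<in> frontier \<Omega>"
    using connected_Int_frontier[of "closed_segment x q" \<Omega>] assms(4) by auto
  have "x - q = (1 - R / dist x z) *\<^sub>R (x - z)" by (simp add: q_def algebra_simps)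
  then have "dist x q = \<bar>1 - R / dist x z\<bar> * dist x z"
    by (simp only: dist_norm norm_scaleR)
  also have "\<dots> = dist x z - R"
    using xz \<open>dist x z > 0\<close> by (simp add: field_simps)
  finally have "dist x q = dist x z - R" .
  moreover have "dist x p \<le> dist x q" using dist_in_closed_segment[OF p(1)] by (simp add: dist_commute)
  moreover have "bdist \<Omega> x \<le> dist x p" unfolding bdist_def using p(2) by (rule infdist_le)
  ultimately show ?thesis by simp
qed

text \<open>\<open>infdist\<close> to the empty set is 0 by convention, hence the condition on the
  frontier.\<close>

lemma bdist_pos:
  assumes "open \<Omega>" "frontier \<Omega> \<noteq> {}" "x \<in> \<Omega>"
  shows "bdist \<Omega> x > 0"
proof -
  have "x \<notin> frontier \<Omega>" using assms by (simp add: frontier_def interior_open)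
  then show ?thesis unfolding bdist_def
    using assms(2) frontier_closed in_closed_iff_infdist_zero infdist_nonneg less_eq_real_def by metis
qed

lemma ball_bdist_subset:
  fixes \<Omega> :: "(real ^ 'n) set"
  assumes "x \<in> \<Omega>" shows "ball x (bdist \<Omega> x) \<subseteq> \<Omega>"
proof (rule ccontr)
  assume "\<not> ?thesis"
  then obtain y where y: "y \<in> ball x (bdist \<Omega> x)" "y \<notin> \<Omega>" by blast
  then obtain p where p: "p \<in> closed_segment x y" "p \<in> frontier \<Omega>"
    using connected_Int_frontier[of "closed_segment x y" \<Omega>] assms(1) by auto
  have "bdist \<Omega> x \<le> dist x p" unfolding bdist_def using p(2) by (rule infdist_le)
  moreover have "dist x p \<le> dist x y" using dist_in_closed_segment[OF p(1)] by (simp add: dist_commute)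
  ultimately show False using y by simp
qed

text \<open>At \<open>x\<close> the distance to an exterior ball touching the boundary at a nearest point
  bounds \<open>bdist\<close> from above, with equality at \<open>x\<close> itself.\<close>

lemma bdist_semiconcave:
  fixes \<Omega> :: "(real ^ 'n) set"
  assumes "open \<Omega>" "R > 0" and ext: "\<forall>y\<in>frontier \<Omega>. \<exists>z. dist y z = R \<and> ball z R \<inter> \<Omega> = {}"
    and "x \<in> \<Omega>" "frontier \<Omega> \<noteq> {}"
  shows "\<exists>n. norm n = 1 \<and> (\<forall>v. x + v \<in> \<Omega> \<longrightarrow>
    bdist \<Omega> (x + v) \<le> bdist \<Omega> x + n \<bullet> v + (norm v)\<^sup>2 / (2 * R))"
proof -
  obtain y where y: "y \<in> frontier \<Omega>" "bdist \<Omega> x = dist x y"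
    unfolding bdist_def using infdist_attains_inf[OF frontier_closed assms(5)] by metis
  obtain z where z: "dist y z = R" "ball z R \<inter> \<Omega> = {}" using ext y by blast
  have dz: "dist x z = R + bdist \<Omega> x"
    using bdist_le_exterior[OF assms(1) z(2) assms(2,4)] dist_triangle[of x z y] y z by simp
  define n where "n = (1 / dist x z) *\<^sub>R (x - z)"
  have b0: "bdist \<Omega> x \<ge> 0" by (simp add: bdist_def infdist_nonneg)
  have pos: "dist x z > 0" using dz b0 assms(2) by simp
  have "norm n = 1" using pos by (simp add: n_def dist_norm)
  moreover have "bdist \<Omega> (x + v) \<le> bdist \<Omega> x + n \<bullet> v + (norm v)\<^sup>2 / (2 * R)" if "x + v \<in> \<Omega>" for v
  proof -
    have 1: "bdist \<Omega> (x + v) \<le> dist (x + v) z - R"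
      by (rule bdist_le_exterior[OF assms(1) z(2) assms(2) that])
    let ?r = "dist x z"
    let ?b = "?r + n \<bullet> v + (norm v)\<^sup>2 / (2 * ?r)"
    have xz: "x - z = ?r *\<^sub>R n" using pos by (simp add: n_def)
    have "(dist (x + v) z)\<^sup>2 = (norm (?r *\<^sub>R n + v))\<^sup>2"
      using xz by (metis add_diff_eq add.commute dist_norm diff_add_eq)
    also have "\<dots> = ?r\<^sup>2 + 2 * ?r * (n \<bullet> v) + (norm v)\<^sup>2"
      using \<open>norm n = 1\<close> unfolding power2_norm_eq_inner
      by (simp add: inner_add_left inner_add_right inner_commute power2_eq_square norm_eq_1)
    finally have sq: "(dist (x + v) z)\<^sup>2 = ?r\<^sup>2 + 2 * ?r * (n \<bullet> v) + (norm v)\<^sup>2" .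
    \<comment> \<open>The arithmetic-geometric mean inequality replaces an expansion of the square
      root: it bounds the distance by the tangent of the square root at \<open>?r\<close>
      squared.\<close>
    have "2 * ?r * dist (x + v) z \<le> ?r\<^sup>2 + (dist (x + v) z)\<^sup>2"
      using sum_squares_bound[of ?r "dist (x + v) z"] by simp
    also have "\<dots> = 2 * ?r * ?b" unfolding sq using pos by (simp add: field_simps power2_eq_square)
    finally have 2: "dist (x + v) z \<le> ?b" using pos by simp
    have "(norm v)\<^sup>2 / (2 * ?r) \<le> (norm v)\<^sup>2 / (2 * R)"
      using dz b0 assms(2) by (intro divide_left_mono) auto
    then show ?thesis using 1 2 dz by linarith
  qed
  ultimately show ?thesis by blast
qed

section \<open>Lower bound for the Riemannian distance to the boundary\<close>

text \<open>The slope \<open>t powr (- \<gamma>)\<close> of the primitive is decreasing, so for y <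
  x its value at y is the largest in between; for x \<le> y the left side is not positive.\<close>

lemma powr_primitive_diff_le:
  fixes \<gamma> :: real
  assumes "0 \<le> \<gamma>" "\<gamma> < 1" "x > 0" "y > 0" "x powr (- \<gamma>) \<le> C" "y powr (- \<gamma>) \<le> C"
  shows "x powr (1 - \<gamma>) / (1 - \<gamma>) - y powr (1 - \<gamma>) / (1 - \<gamma>) \<le> C * \<bar>x - y\<bar>"
proof (cases "x \<le> y")
  case True
  then have "x powr (1 - \<gamma>) \<le> y powr (1 - \<gamma>)" using assms by (intro powr_mono2) auto
  then have "x powr (1 - \<gamma>) / (1 - \<gamma>) - y powr (1 - \<gamma>) / (1 - \<gamma>) \<le> 0"
    using assms(2) by (simp add: divide_right_mono)
  also have "0 \<le> C * \<bar>x - y\<bar>" using order_trans[OF powr_ge_zero assms(5)] by simp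
  finally show ?thesis .
next
  case False
  then have "y < x" by simp
  have der: "((\<lambda>t. t powr (1 - \<gamma>) / (1 - \<gamma>)) has_real_derivative t powr (- \<gamma>)) (at t)" if "y \<le> t" for t
  proof -
    have "((\<lambda>t. t powr (1 - \<gamma>) / (1 - \<gamma>)) has_real_derivative ((1 - \<gamma>) * t powr (1 - \<gamma> - 1)) / (1 - \<gamma>)) (at t)"
      using that assms(4) by (intro DERIV_cdivide has_real_derivative_powr) auto
    then show ?thesis using assms(2) by simp
  qed
  obtain z where z: "y < z" "z < x" "x powr (1 - \<gamma>) / (1 - \<gamma>) - y powr (1 - \<gamma>) / (1 - \<gamma>) = (x - y) * z powr (- \<gamma>)"
    using MVT2[OF \<open>y < x\<close>, of "\<lambda>t. t powr (1 - \<gamma>) / (1 - \<gamma>)" "\<lambda>t. t powr (- \<gamma>)"] der by auto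
  have "z powr (- \<gamma>) \<le> y powr (- \<gamma>)" using z assms by (intro powr_mono2') auto
  then have "(x - y) * z powr (- \<gamma>) \<le> (x - y) * C" using assms(6) \<open>y < x\<close> by (intro mult_left_mono) auto
  then show ?thesis using z(3) \<open>y < x\<close> by (simp add: mult.commute)
qed

lemma weighted_length_C1:
  fixes p :: "real \<Rightarrow> 'a :: euclidean_space" and d :: "'a \<Rightarrow> real"
  assumes \<gamma>: "0 \<le> \<gamma>" "\<gamma> < 1" and ab: "a \<le> b"
    and lip: "\<And>x y. \<bar>d x - d y\<bar> \<le> dist x y"
    and der: "\<And>t. t \<in> {a..b} \<Longrightarrow> (p has_vector_derivative p' t) (at t)"
    and cont: "continuous_on {a..b} p'"
    and pos: "\<And>t. t \<in> {a..b} \<Longrightarrow> d (p t) > 0"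
  shows "d (p a) powr (1 - \<gamma>) / (1 - \<gamma>) - d (p b) powr (1 - \<gamma>) / (1 - \<gamma>)
    \<le> integral {a..b} (\<lambda>t. d (p t) powr (- \<gamma>) * norm (p' t))"
proof -
  define H where "H t = d (p t) powr (1 - \<gamma>) / (1 - \<gamma>)" for t
  define g where "g t = d (p t) powr (- \<gamma>)" for t
  define w where "w t = g t * norm (p' t)" for t
  have cp: "continuous_on {a..b} p"
    using der by (meson continuous_at_imp_continuous_on has_vector_derivative_continuous)
  have cd: "continuous_on UNIV d"
    unfolding continuous_on_iff using lip by (metis dist_real_def order_le_less_trans)
  have cdp: "continuous_on {a..b} (\<lambda>t. d (p t))"
    by (rule continuous_on_compose2[OF cd cp]) auto
  have cg: "continuous_on {a..b} g" unfolding g_def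
    using pos by (intro continuous_on_powr cdp continuous_intros) (metis less_irrefl)
  have gpos: "g t > 0" if "t \<in> {a..b}" for t using pos[OF that] by (simp add: g_def)
  have cw: "continuous_on {a..b} w" unfolding w_def by (intro continuous_intros cg cont)
  have wint: "w integrable_on {s..t}" if "a \<le> s" "t \<le> b" for s t
    by (rule integrable_continuous_interval) (use that in \<open>auto intro: continuous_on_subset[OF cw]\<close>)
  have J0: "integral {a..b} w \<ge> 0"
    by (rule integral_nonneg[OF wint]) (auto simp: w_def g_def)
  have eps: "H a - H b \<le> (1 + \<epsilon>) * integral {a..b} w" if e: "\<epsilon> > 0" for \<epsilon>
  proof -
    define P where "P s t \<longleftrightarrow> (a \<le> s \<and> t \<le> b \<longrightarrow> H s - H t \<le> (1 + \<epsilon>) * integral {s..t} w)" for s t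
    have "P a b" using ab
    proof (induction rule: Bolzano)
      case (trans s u t)
      show ?case unfolding P_def
      proof
        assume st: "a \<le> s \<and> t \<le> b"
        have "integral {s..t} w = integral {s..u} w + integral {u..t} w"
          using trans st by (intro Henstock_Kurzweil_Integration.integral_combine[symmetric] wint) auto
        then show "H s - H t \<le> (1 + \<epsilon>) * integral {s..t} w"
          using trans st by (auto simp: P_def distrib_left)
      qed
    next
      case (local x)
      \<comment> \<open>Solves g x + \<eta> = (1 + \<epsilon>)(g x - \<eta>): the weight varies near
        x by a factor of at most 1 + \<epsilon>.\<close>
      define \<eta> where "\<eta> = g x * \<epsilon> / (2 + \<epsilon>)"
      have gx: "g x > 0" using gpos local by simp
      have \<eta>: "\<eta> > 0" using gx e by (simp add: \<eta>_def)
      have rat: "g x + \<eta> = (1 + \<epsilon>) * (g x - \<eta>)"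
        using e by (simp add: \<eta>_def field_simps)
      have gm: "g x - \<eta> > 0"
        using gx e by (simp add: \<eta>_def field_simps)
      obtain r where r: "r > 0" "\<And>t. t \<in> {a..b} \<Longrightarrow> dist t x < r \<Longrightarrow> dist (g t) (g x) < \<eta>"
        using cg \<eta> local unfolding continuous_on_iff by (metis atLeastAtMost_iff)
      have "P s t" if st: "s \<le> x" "x \<le> t" "t - s < r" for s t unfolding P_def
      proof
        assume ab': "a \<le> s \<and> t \<le> b"
        have near: "\<bar>g u - g x\<bar> < \<eta>" if "u \<in> {s..t}" for u
          using r(2)[of u] that st ab' by (auto simp: dist_real_def)
        have sub: "{s..t} \<subseteq> {a..b}" using ab' by auto
        have "H s - H t \<le> (g x + \<eta>) * \<bar>d (p s) - d (p t)\<bar>" unfolding H_def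
          using near[of s] near[of t] st ab' by (intro powr_primitive_diff_le \<gamma> pos) (auto simp: g_def)
        also have "\<bar>d (p s) - d (p t)\<bar> \<le> norm (p t - p s)"
          using lip by (metis dist_commute dist_norm)
        also have "p t - p s = integral {s..t} p'"
          using st sub by (intro integral_unique[symmetric] fundamental_theorem_of_calculus)
            (auto intro!: has_vector_derivative_at_within der)
        also have "(g x - \<eta>) * norm (integral {s..t} p') \<le> integral {s..t} w"
        proof -
          have "norm (integral {s..t} p') \<le> integral {s..t} (\<lambda>u. w u / (g x - \<eta>))"
          proof (rule integral_norm_bound_integral)
            show "p' integrable_on {s..t}"
              by (rule integrable_continuous_interval) (rule continuous_on_subset[OF cont sub])
            show "(\<lambda>u. w u / (g x - \<eta>)) integrable_on {s..t}"
              using wint[of s t] ab' by (intro integrable_on_divide) auto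
            fix u assume u: "u \<in> {s..t}"
            have "(g x - \<eta>) * norm (p' u) \<le> w u" unfolding w_def
              using near[OF u] by (intro mult_right_mono) auto
            then show "norm (p' u) \<le> w u / (g x - \<eta>)" using gm by (simp add: field_simps)
          qed
          then show ?thesis using gm by (simp add: field_simps)
        qed
        then have "(1 + \<epsilon>) * ((g x - \<eta>) * norm (integral {s..t} p')) \<le> (1 + \<epsilon>) * integral {s..t} w"
          using e by (intro mult_left_mono) auto
        then have "(g x + \<eta>) * norm (integral {s..t} p') \<le> (1 + \<epsilon>) * integral {s..t} w"
          unfolding rat by (simp add: mult.assoc)
        finally show "H s - H t \<le> (1 + \<epsilon>) * integral {s..t} w"
          using gx \<eta> by (simp add: mult_left_mono)
      qed
      then show ?case using r(1) by blast
    qed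
    then show ?thesis by (simp add: P_def)
  qed
  have "H a - H b \<le> integral {a..b} w"
  proof (rule field_le_epsilon)
    fix e :: real assume "e > 0"
    let ?J = "integral {a..b} w"
    \<comment> \<open>The denominator is \<open>?J + 1\<close> because the integral itself may
      vanish.\<close>
    have "H a - H b \<le> (1 + e / (?J + 1)) * ?J" using eps[of "e / (?J + 1)"] J0 \<open>e > 0\<close> by simp
    also have "\<dots> = ?J + e * (?J / (?J + 1))" by (simp add: distrib_right)
    also have "\<dots> \<le> ?J + e * 1" using J0 \<open>e > 0\<close> by (intro add_left_mono mult_left_mono) auto
    finally show "H a - H b \<le> ?J + e" by simp
  qed
  then show ?thesis by (simp add: H_def w_def[abs_def] g_def)
qed

text \<open>The derivative may be missing at the breakpoints, and d vanishes at t = 1. The smooth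
  estimate is therefore used on compact inner intervals and carried to their ends by continuity of
  k, which persists at d = 0 because 1 - \<gamma> > 0.\<close>

lemma weighted_length_valid_path:
  fixes p :: "real \<Rightarrow> 'a :: euclidean_space" and d :: "'a \<Rightarrow> real"
  assumes \<gamma>: "0 \<le> \<gamma>" "\<gamma> < 1" and lip: "\<And>x y. \<bar>d x - d y\<bar> \<le> dist x y"
    and p: "valid_path p" and pos: "\<And>t. t \<in> {0..<1} \<Longrightarrow> d (p t) > 0" and fin: "d (p 1) = 0"
  shows "ennreal (d (p 0) powr (1 - \<gamma>) / (1 - \<gamma>)) \<le>
    (\<integral>\<^sup>+t\<in>{0..1}. ennreal (d (p t) powr (- \<gamma>) * norm (vector_derivative p (at t))) \<partial>lborel)"
proof -
  obtain S where S: "finite S" "p C1_differentiable_on {0..1} - S" and cp: "continuous_on {0..1} p"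
    using p by (auto simp: valid_path_def piecewise_C1_differentiable_on_def)
  define D where "D t = vector_derivative p (at t)" for t
  define w where "w t = d (p t) powr (- \<gamma>) * norm (D t)" for t
  define k where "k t = d (p t) powr (1 - \<gamma>) / (1 - \<gamma>)" for t
  define A where "A = {0..<1} - S"
  \<comment> \<open>On A the integrand w is continuous, which makes the cut-off F Borel measurable;
    F lies below the integrand of the length, and only that direction is needed at the end.\<close>
  define F where "F t = ennreal (indicator A t * w t)" for t
  \<comment> \<open>Half-open intervals make consecutive pieces disjoint, so \<open>I\<close> is
    exactly additive.\<close>
  define I where "I s t = (\<integral>\<^sup>+u\<in>{s..<t}. F u \<partial>lborel)" for s t
  have cd: "continuous_on UNIV d"
    unfolding continuous_on_iff using lip by (metis dist_real_def order_le_less_trans)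
  have cdp: "continuous_on {0..1} (\<lambda>t. d (p t))"
    by (rule continuous_on_compose2[OF cd cp]) auto
  have dp0: "d (p t) \<ge> 0" if "t \<in> {0..1}" for t
    using pos[of t] fin that by (cases "t = 1") (auto simp: less_imp_le)
  have ck: "continuous_on {0..1} k" unfolding k_def
    using \<gamma> dp0 by (intro continuous_intros continuous_on_powr' cdp) auto
  have C1: "\<forall>t\<in>{0..1} - S. p differentiable at t" "continuous_on ({0..1} - S) D"
    using S(2) unfolding C1_differentiable_on_eq D_def by auto
  have der: "(p has_vector_derivative D t) (at t)" if "t \<in> A" for t
    using C1(1) that by (auto simp: A_def D_def vector_derivative_works)
  have cA: "continuous_on A w" unfolding w_def
    using pos by (intro continuous_intros continuous_on_subset[OF C1(2)] continuous_on_subset[OF cdp])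
      (auto simp: A_def, metis less_irrefl)
  have Ab: "A \<in> sets borel" unfolding A_def by (intro sets.Diff borel_closed[OF finite_imp_closed[OF S(1)]]) simp
  have F: "F \<in> borel_measurable lborel"
    using borel_measurable_continuous_on_indicator[OF Ab cA] unfolding F_def by simp
  have inner: "ennreal (k s - k t) \<le> I s t" if st: "0 \<le> s" "s < t" "t \<le> 1" "S \<inter> {s<..<t} = {}" for s t
  proof (cases "I s t = \<infinity>")
    case False
    \<comment> \<open>With n + 3 each step is at most (t - s)/3, so s + h n \<le> t - h n for every
      n, including n = 0.\<close>
    define h where "h n = (t - s) / real (n + 3)" for n
    have h0: "h \<longlonglongrightarrow> 0"
      unfolding h_def by (rule LIMSEQ_ignore_initial_segment[OF lim_const_over_n])
    have hb: "0 < h n" "h n \<le> (t - s) / 3" for n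
      using st unfolding h_def by (simp, intro divide_left_mono, auto)
    have hb1: "s + h n \<in> {0..1}" "t - h n \<in> {0..1}" for n
      using hb[of n] st by auto
    have step: "k (s + h n) - k (t - h n) \<le> enn2real (I s t)" for n
    proof -
      let ?a = "s + h n" and ?b = "t - h n"
      have ab: "?a \<le> ?b" "{?a..?b} \<subseteq> {s<..<t}" using hb[of n] st by auto
      have sub: "{?a..?b} \<subseteq> A" using ab(2) st by (auto simp: A_def)
      have "k ?a - k ?b \<le> integral {?a..?b} w" unfolding k_def w_def
      proof (rule weighted_length_C1[OF \<gamma> ab(1) lip])
        show "continuous_on {?a..?b} D" using sub by (intro continuous_on_subset[OF C1(2)]) (auto simp: A_def)
      qed (use sub der pos in \<open>auto simp: A_def subset_iff\<close>)
      also have "integral {?a..?b} w = (LINT u:{?a..?b}|lborel. w u)"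
        using set_borel_integral_eq_integral[of "{?a..?b}" w] borel_integrable_compact[of "{?a..?b}" w]
          continuous_on_subset[OF cA sub] by (simp add: set_integrable_def)
      finally have 1: "k ?a - k ?b \<le> (LINT u:{?a..?b}|lborel. w u)" .
      have "ennreal (LINT u:{?a..?b}|lborel. w u) = (\<integral>\<^sup>+u. ennreal (indicator {?a..?b} u *\<^sub>R w u) \<partial>lborel)"
        unfolding set_lebesgue_integral_def
        by (rule nn_integral_eq_integral[symmetric, OF
              borel_integrable_compact[OF compact_Icc continuous_on_subset[OF cA sub]]])
           (simp add: w_def)
      also have "\<dots> \<le> I s t" unfolding I_def F_def
        using sub ab st by (intro nn_integral_mono) (auto simp: indicator_def subset_iff)
      finally have "ennreal (LINT u:{?a..?b}|lborel. w u) \<le> ennreal (enn2real (I s t))"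
        using False by (simp add: top.not_eq_extremum)
      then have "(LINT u:{?a..?b}|lborel. w u) \<le> enn2real (I s t)"
        by (simp add: ennreal_le_iff)
      then show ?thesis using 1 by simp
    qed
    have "(\<lambda>n. k (s + h n)) \<longlonglongrightarrow> k s"
    proof (rule continuous_on_tendsto_compose[OF ck])
      show "(\<lambda>n. s + h n) \<longlonglongrightarrow> s" using tendsto_add[OF tendsto_const h0] by simp
      show "\<forall>\<^sub>F n in sequentially. s + h n \<in> {0..1}"
        using hb1 by (intro always_eventually) auto
    qed (use st in auto)
    moreover have "(\<lambda>n. k (t - h n)) \<longlonglongrightarrow> k t"
    proof (rule continuous_on_tendsto_compose[OF ck])
      show "(\<lambda>n. t - h n) \<longlonglongrightarrow> t" using tendsto_diff[OF tendsto_const h0] by simp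
      show "\<forall>\<^sub>F n in sequentially. t - h n \<in> {0..1}"
        using hb1 by (intro always_eventually) auto
    qed (use st in auto)
    ultimately have "(\<lambda>n. k (s + h n) - k (t - h n)) \<longlonglongrightarrow> k s - k t" by (rule tendsto_diff)
    then have "k s - k t \<le> enn2real (I s t)"
      by (rule LIMSEQ_le_const2) (use step in auto)
    then show ?thesis
      using False ennreal_leI[of "k s - k t" "enn2real (I s t)"] by (simp add: top.not_eq_extremum)
  qed simp
  \<comment> \<open>Lengths may be infinite and \<open>ennreal\<close> sends negative numbers to 0,
    so a difference would not glue; the additive form does.\<close>
  have inner': "ennreal (k s) \<le> I s t + ennreal (k t)" if st: "0 \<le> s" "s \<le> t" "t \<le> 1" "S \<inter> {s<..<t} = {}" for s t
  proof (cases "s = t")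
    case False
    have kt: "k t \<ge> 0" using \<gamma> by (simp add: k_def)
    have "ennreal (k s) \<le> ennreal (max 0 (k s - k t) + k t)" by (intro ennreal_leI) auto
    also have "\<dots> = ennreal (k s - k t) + ennreal (k t)"
      using kt by (subst ennreal_plus) (auto simp: max_def ennreal_neg)
    finally show ?thesis using inner[of s t] st False by (meson add_right_mono order.not_eq_order_implies_strict order_trans)
  qed simp
  have add: "I s u + I u t = I s t" if "s \<le> u" "u \<le> t" for s u t
  proof -
    have "{s..<t} = {s..<u} \<union> {u..<t}" using that by auto
    then show ?thesis unfolding I_def using F
      by (simp only:) (rule nn_integral_disjoint_pair[symmetric], auto)
  qed
  define P where "P s t \<longleftrightarrow> (0 \<le> s \<and> t \<le> 1 \<longrightarrow> ennreal (k s) \<le> I s t + ennreal (k t))" for s t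
  have "P 0 1" using zero_le_one[where 'a = real]
  proof (induction rule: Bolzano)
    case (trans s u t)
    show ?case unfolding P_def
    proof
      assume st: "0 \<le> s \<and> t \<le> 1"
      have "ennreal (k s) \<le> I s u + ennreal (k u)" using trans st by (auto simp: P_def)
      also have "\<dots> \<le> I s u + (I u t + ennreal (k t))" using trans st by (intro add_left_mono) (auto simp: P_def)
      finally show "ennreal (k s) \<le> I s t + ennreal (k t)" unfolding add[OF trans(3,4), symmetric] by (simp only: add.assoc)
    qed
  next
    case (local x)
    \<comment> \<open>Close to x the only possible breakpoint is x itself; splitting there leaves
      two pieces without interior breakpoints.\<close>
    obtain r where r: "r > 0" "\<And>y. y \<in> S \<Longrightarrow> y \<noteq> x \<Longrightarrow> r \<le> dist x y"
      using finite_set_avoid[OF S(1), of x] by blast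
    have "P s t" if st: "s \<le> x" "x \<le> t" "t - s < r" for s t unfolding P_def
    proof
      assume b: "0 \<le> s \<and> t \<le> 1"
      have "S \<inter> {s<..<x} = {}" "S \<inter> {x<..<t} = {}"
        using r(2) st by (force simp: dist_real_def)+
      then have 1: "ennreal (k s) \<le> I s x + ennreal (k x)" "ennreal (k x) \<le> I x t + ennreal (k t)"
        using b st local by (auto intro!: inner')
      have "ennreal (k s) \<le> I s x + (I x t + ennreal (k t))" using 1 by (meson add_left_mono order_trans)
      then show "ennreal (k s) \<le> I s t + ennreal (k t)" unfolding add[OF st(1,2), symmetric] by (simp only: add.assoc)
    qed
    then show ?case using r(1) by blast
  qed
  moreover have "k 1 = 0" using fin by (simp add: k_def)
  ultimately have "ennreal (k 0) \<le> I 0 1" by (simp add: P_def)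
  also have "\<dots> \<le> (\<integral>\<^sup>+t\<in>{0..1}. ennreal (w t) \<partial>lborel)"
    unfolding I_def F_def by (intro nn_integral_mono) (auto simp: indicator_def)
  finally show ?thesis by (simp add: k_def w_def D_def)
qed

lemma riem_bdist_ge:
  fixes \<Omega> :: "(real ^ 'n) set"
  assumes "open \<Omega>" "frontier \<Omega> \<noteq> {}" "0 \<le> \<gamma>" "\<gamma> < 1"
  shows "ennreal (bdist \<Omega> x powr (1 - \<gamma>) / (1 - \<gamma>)) \<le> riem_bdist \<Omega> \<gamma> x"
  unfolding riem_bdist_def
proof (rule INF_greatest, clarify)
  fix p assume p: "valid_path p" "pathfinish p \<in> frontier \<Omega>" "p ` {0..<1} \<subseteq> \<Omega>" "x = pathstart p"
  have "ennreal (bdist \<Omega> (p 0) powr (1 - \<gamma>) / (1 - \<gamma>)) \<le> riem_length \<Omega> \<gamma> p"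
    unfolding riem_length_def
  proof (rule weighted_length_valid_path[OF assms(3,4) _ p(1)])
    show "\<bar>bdist \<Omega> x - bdist \<Omega> y\<bar> \<le> dist x y" for x y
      unfolding bdist_def by (rule infdist_triangle_abs)
    show "bdist \<Omega> (p t) > 0" if "t \<in> {0..<1}" for t
      using that p(3) by (intro bdist_pos assms) auto
    show "bdist \<Omega> (p 1) = 0" using p(2) by (simp add: bdist_def pathfinish_def)
  qed
  then show "ennreal (bdist \<Omega> (pathstart p) powr (1 - \<gamma>) / (1 - \<gamma>)) \<le> riem_length \<Omega> \<gamma> p"
    by (simp add: pathstart_def)
qed

section \<open>The one-dimensional supersolution\<close>

lemma powr_between_max:
  fixes q :: real
  assumes "0 < a" "a \<le> c" "c \<le> b"
  shows "c powr q \<le> max (a powr q) (b powr q)"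
proof (cases "q \<ge> 0")
  case True
  then have "c powr q \<le> b powr q" using assms by (intro powr_mono2) auto
  then show ?thesis by simp
next
  case False
  then have "c powr q \<le> a powr q" using assms by (intro powr_mono2') auto
  then show ?thesis by simp
qed

text \<open>The ground state substitution on a single edge: u and v are the values of a positive
  function, r is a conductance and g' - g = r (v - u) the current. It reduces to 2|a||b| \<le> |a|^2
  v/u + |b|^2 u/v and the reverse triangle inequality.\<close>

lemma two_point_ground_state:
  fixes a b :: complex and u v r :: real
  assumes "u > 0" "v > 0" "0 \<le> r" "g' - g = r * (v - u)"
  shows "(cmod a)\<^sup>2 * (g - g') / u + (cmod b)\<^sup>2 * (g' - g) / v \<le> r * (cmod (b - a))\<^sup>2"
proof -
  have "0 \<le> (cmod a * v - cmod b * u)\<^sup>2 / (u * v)" using assms by simp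
  also have "\<dots> = (cmod a)\<^sup>2 * v / u + (cmod b)\<^sup>2 * u / v - 2 * cmod a * cmod b"
    using assms by (simp add: field_simps power2_eq_square)
  finally have 1: "2 * cmod a * cmod b \<le> (cmod a)\<^sup>2 * v / u + (cmod b)\<^sup>2 * u / v" by simp
  have g: "g - g' = r * (u - v)" using assms(4) by (simp add: algebra_simps)
  have "(cmod a)\<^sup>2 * (g - g') / u + (cmod b)\<^sup>2 * (g' - g) / v
      = r * ((cmod a)\<^sup>2 + (cmod b)\<^sup>2 - ((cmod a)\<^sup>2 * v / u + (cmod b)\<^sup>2 * u / v))"
    unfolding g assms(4) using assms(1,2) by (simp add: field_simps)
  also have "\<dots> \<le> r * (cmod b - cmod a)\<^sup>2"
    using 1 by (intro mult_left_mono assms(3)) (simp add: power2_diff mult_ac)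
  also have "\<dots> \<le> r * (cmod (b - a))\<^sup>2"
    using norm_triangle_ineq3[of b a] by (intro mult_left_mono assms(3)) (simp add: abs_le_square_iff[symmetric])
  finally show ?thesis .
qed

text \<open>The positive supersolution is \<open>u(t) = t\<^sup>s - k t\<^bsup>s+1/2\<^esup>\<close>, and \<open>g' = t\<^bsup>1-2s\<^esup> u'\<close>. The correction
  \<open>k t\<^bsup>s+1/2\<^esup>\<close> produces a positive multiple of \<open>t\<^bsup>-s-1/2\<^esup>\<close>, which near \<open>t = 0\<close> absorbs the
  curvature term \<open>C g'(t)\<close> of order \<open>t\<^bsup>-s\<^esup>\<close>.\<close>

locale hardy_profile =
  fixes s k D :: real
  assumes s: "0 < s" "s < 1" and D: "0 < D" and k: "0 < k" "k * D powr (1/2) * (s + 1/2) \<le> s / 2"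
begin

definition u :: "real \<Rightarrow> real" where "u t = t powr s - k * t powr (s + 1/2)"
definition w :: "real \<Rightarrow> real" where "w t = t powr (1 - 2 * s)"
text \<open>As w is the weight t^\<beta> of the quadratic form and g' = w u', the divergence of
  w(\<sigma>) grad u(\<sigma>) is formally the Laplacian of g(\<sigma>). Second differences of
  g(\<sigma>) can thus stand in for the weighted operator.\<close>

definition g :: "real \<Rightarrow> real" where
  "g t = s / (1 - s) * t powr (1 - s) - k * (s + 1/2) / (3/2 - s) * t powr (3/2 - s)"
definition g1 :: "real \<Rightarrow> real" where
  "g1 t = s * t powr (- s) - k * (s + 1/2) * t powr (1/2 - s)"
definition g2 :: "real \<Rightarrow> real" where
  "g2 t = - (s\<^sup>2 * t powr (- s - 1)) - k * (s + 1/2) * (1/2 - s) * t powr (- s - 1/2)"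
definition g3 :: "real \<Rightarrow> real" where
  "g3 t = s\<^sup>2 * (s + 1) * t powr (- s - 2) + k * (s + 1/2) * (1/2 - s) * (s + 1/2) * t powr (- s - 3/2)"

text \<open>One smallness condition on k serves two purposes: directly it keeps \<open>g1\<close>
  positive on (0, D], and since s/2 \<le> (s + 1/2)/2 it also keeps u above half of t^s.\<close>

lemma kt_bound: "0 < t \<Longrightarrow> t \<le> D \<Longrightarrow> k * t powr (1/2) * (s + 1/2) \<le> s / 2"
proof -
  assume "0 < t" "t \<le> D"
  then have "t powr (1/2) \<le> D powr (1/2)" by (intro powr_mono2) auto
  then have "k * t powr (1/2) * (s + 1/2) \<le> k * D powr (1/2) * (s + 1/2)"
    using k(1) s by (intro mult_right_mono mult_left_mono) auto
  then show ?thesis using k(2) by linarith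
qed

lemma kt_bound': "0 < t \<Longrightarrow> t \<le> D \<Longrightarrow> k * t powr (1/2) \<le> 1/2"
proof -
  assume t: "0 < t" "t \<le> D"
  have "k * t powr (1/2) * (s + 1/2) \<le> (1/2) * (s + 1/2)" using kt_bound[OF t] s unfolding distrib_left by linarith
  then show ?thesis by (rule mult_right_le_imp_le) (use s in simp)
qed

lemma u_factor: "0 < t \<Longrightarrow> u t = t powr s * (1 - k * t powr (1/2))"
  by (simp add: u_def powr_add algebra_simps)

lemma u_ge: "0 < t \<Longrightarrow> t \<le> D \<Longrightarrow> t powr s / 2 \<le> u t"
proof -
  assume t: "0 < t" "t \<le> D"
  have "t powr s * (1/2) \<le> t powr s * (1 - k * t powr (1/2))"
    using kt_bound'[OF t] by (intro mult_left_mono) auto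
  then show ?thesis using u_factor[OF t(1)] by simp
qed

lemma u_pos: "0 < t \<Longrightarrow> t \<le> D \<Longrightarrow> 0 < u t"
  by (rule less_le_trans[OF _ u_ge]) auto

lemma w_nonneg: "0 \<le> w t"
  by (simp add: w_def)

lemma g1_factor: "0 < t \<Longrightarrow> g1 t = t powr (- s) * (s - k * t powr (1/2) * (s + 1/2))"
  using powr_add[of t "- s" "1/2"] by (simp add: g1_def algebra_simps)

lemma g1_pos: "0 < t \<Longrightarrow> t \<le> D \<Longrightarrow> 0 < g1 t"
  unfolding g1_factor using kt_bound[of t] s by (intro mult_pos_pos) auto

lemma g1_le: "0 < t \<Longrightarrow> g1 t \<le> s * t powr (- s)"
  using k s by (simp add: g1_def)

lemma u_deriv: "0 < t \<Longrightarrow> (u has_real_derivative g1 t / w t) (at t)"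
proof -
  assume t: "0 < t"
  have "(u has_real_derivative (s * t powr (s - 1) - k * ((s + 1/2) * t powr (s + 1/2 - 1)))) (at t)"
    unfolding u_def[abs_def] using t by (intro DERIV_diff DERIV_cmult has_real_derivative_powr) auto
  moreover have "s * t powr (s - 1) - k * ((s + 1/2) * t powr (s + 1/2 - 1)) = g1 t / w t"
  proof -
    have "s + 1/2 - 1 = 1/2 - s - (1 - 2 * s)" "s - 1 = - s - (1 - 2 * s)" by simp_all
    then show ?thesis
      unfolding g1_def w_def by (simp only: powr_diff diff_divide_distrib mult.assoc times_divide_eq_right)
  qed
  ultimately show ?thesis by simp
qed

lemma g_deriv: "0 < t \<Longrightarrow> (g has_real_derivative g1 t) (at t)"
proof -
  assume t: "0 < t"
  have "(g has_real_derivative (s / (1 - s) * ((1 - s) * t powr (1 - s - 1))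
      - k * (s + 1/2) / (3/2 - s) * ((3/2 - s) * t powr (3/2 - s - 1)))) (at t)"
    unfolding g_def[abs_def] using t by (intro DERIV_diff DERIV_cmult has_real_derivative_powr) auto
  then show ?thesis using s by (simp add: g1_def mult.assoc)
qed

lemma g1_deriv: "0 < t \<Longrightarrow> (g1 has_real_derivative g2 t) (at t)"
proof -
  assume t: "0 < t"
  have "(g1 has_real_derivative (s * (- s * t powr (- s - 1))
      - k * (s + 1/2) * ((1/2 - s) * t powr (1/2 - s - 1)))) (at t)"
    unfolding g1_def[abs_def] using t by (intro DERIV_diff DERIV_cmult has_real_derivative_powr) auto
  moreover have "s * (- s * t powr (- s - 1)) - k * (s + 1/2) * ((1/2 - s) * t powr (1/2 - s - 1)) = g2 t"
  proof -
    have e: "1/2 - s - 1 = - s - 1/2" by simp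
    show ?thesis unfolding g2_def e by (simp add: power2_eq_square)
  qed
  ultimately show ?thesis by simp
qed

lemma g2_deriv: "0 < t \<Longrightarrow> (g2 has_real_derivative g3 t) (at t)"
proof -
  assume t: "0 < t"
  have "(g2 has_real_derivative (- (s\<^sup>2 * ((- s - 1) * t powr (- s - 1 - 1)))
      - k * (s + 1/2) * (1/2 - s) * ((- s - 1/2) * t powr (- s - 1/2 - 1)))) (at t)"
    unfolding g2_def[abs_def] using t by (intro DERIV_diff DERIV_minus DERIV_cmult has_real_derivative_powr) auto
  moreover have "- (s\<^sup>2 * ((- s - 1) * t powr (- s - 1 - 1)))
      - k * (s + 1/2) * (1/2 - s) * ((- s - 1/2) * t powr (- s - 1/2 - 1)) = g3 t"
  proof -
    have e: "- s - 1/2 - 1 = - s - 3/2" "- s - 1 - 1 = - s - 2" by simp_all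
    have "- (s\<^sup>2 * ((- s - 1) * A)) - k * (s + 1/2) * (1/2 - s) * ((- s - 1/2) * B)
      = s\<^sup>2 * (s + 1) * A + k * (s + 1/2) * (1/2 - s) * (s + 1/2) * B" for A B :: real
      by (simp add: field_simps)
    then show ?thesis unfolding g3_def e .
  qed
  ultimately show ?thesis by simp
qed

lemma continuous_g: "continuous_on {0<..} g"
  by (meson DERIV_isCont continuous_at_imp_continuous_on g_deriv greaterThan_iff)

lemma continuous_u: "continuous_on {0<..} u"
  by (meson DERIV_isCont continuous_at_imp_continuous_on u_deriv greaterThan_iff)

lemma continuous_g1: "continuous_on {0<..} g1"
  by (meson DERIV_isCont continuous_at_imp_continuous_on g1_deriv greaterThan_iff)

lemma continuous_g2: "continuous_on {0<..} g2"
  by (meson DERIV_isCont continuous_at_imp_continuous_on g2_deriv greaterThan_iff)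

lemma continuous_g3: "continuous_on {0<..} g3"
  unfolding g3_def by (intro continuous_intros continuous_on_powr) auto

lemma continuous_w: "continuous_on {0<..} w"
  unfolding w_def by (intro continuous_intros continuous_on_powr) auto

lemma g_mono:
  assumes "0 < x" "x \<le> y" "y \<le> D" shows "g x \<le> g y"
  by (rule DERIV_nonneg_imp_nondecreasing[OF assms(2)])
     (use assms g_deriv g1_pos in \<open>meson less_eq_real_def less_le_trans order_trans\<close>)

text \<open>Since g' = w u', Cauchy's mean value theorem gives g y - g x = w z (u y - u x) with z
  between x and y. The power w is monotone, so w z is at most the larger endpoint value, and the
  edge inequality applies with r = w z (with r = 0 if x = y).\<close>

lemma two_point:
  fixes a b :: complex
  assumes x: "0 < x" "x \<le> D" and y: "0 < y" "y \<le> D"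
  shows "(cmod a)\<^sup>2 * (g x - g y) / u x + (cmod b)\<^sup>2 * (g y - g x) / u y
    \<le> max (w x) (w y) * (cmod (b - a))\<^sup>2"
proof -
  have ordered: "\<exists>r\<ge>0. r \<le> max (w x) (w y) \<and> g y - g x = r * (u y - u x)"
    if "0 < x" "x < y" "y \<le> D" for x y
  proof -
    have d: "((\<lambda>t. (g y - g x) * u t - (u y - u x) * g t) has_real_derivative
        (g y - g x) * (g1 t / w t) - (u y - u x) * g1 t) (at t)" if "x \<le> t" for t
      using that \<open>0 < x\<close> by (intro DERIV_diff DERIV_cmult u_deriv g_deriv) auto
    obtain z where z: "x < z" "z < y"
      and "((g y - g x) * u y - (u y - u x) * g y) - ((g y - g x) * u x - (u y - u x) * g x)
        = (y - x) * ((g y - g x) * (g1 z / w z) - (u y - u x) * g1 z)"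
      using MVT2[OF \<open>x < y\<close>, of "\<lambda>t. (g y - g x) * u t - (u y - u x) * g t"
          "\<lambda>t. (g y - g x) * (g1 t / w t) - (u y - u x) * g1 t"] d by blast
    moreover have "((g y - g x) * u y - (u y - u x) * g y) - ((g y - g x) * u x - (u y - u x) * g x) = 0"
      by (simp add: algebra_simps)
    ultimately have "(g y - g x) * (g1 z / w z) - (u y - u x) * g1 z = 0" using \<open>x < y\<close> by simp
    moreover have "g1 z > 0" using z that by (intro g1_pos) auto
    moreover have "w z > 0" using z that by (simp add: w_def)
    ultimately have "g1 z * ((g y - g x) - w z * (u y - u x)) = 0" by (simp add: field_simps)
    then have "g y - g x = w z * (u y - u x)" using \<open>g1 z > 0\<close> by simp
    moreover have "w z \<le> max (w x) (w y)"
      unfolding w_def using z that by (intro powr_between_max) auto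
    ultimately show ?thesis using w_nonneg by blast
  qed
  have "\<exists>r\<ge>0. r \<le> max (w x) (w y) \<and> g y - g x = r * (u y - u x)"
  proof (cases x y rule: linorder_cases)
    case less then show ?thesis using ordered x y by blast
  next
    case equal then show ?thesis using w_nonneg[of x] by (auto intro!: exI[of _ 0])
  next
    case greater
    then obtain r where "r \<ge> 0" "r \<le> max (w y) (w x)" "g x - g y = r * (u x - u y)"
      using ordered[of y x] x y by auto
    then show ?thesis by (intro exI[of _ r]) (auto simp: algebra_simps max.commute)
  qed
  then obtain r where r: "r \<ge> 0" "r \<le> max (w x) (w y)" "g y - g x = r * (u y - u x)" by blast
  have "(cmod a)\<^sup>2 * (g x - g y) / u x + (cmod b)\<^sup>2 * (g y - g x) / u y \<le> r * (cmod (b - a))\<^sup>2"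
    by (rule two_point_ground_state) (use u_pos x y r in auto)
  also have "\<dots> \<le> max (w x) (w y) * (cmod (b - a))\<^sup>2" using r(2) by (intro mult_right_mono) auto
  finally show ?thesis .
qed

text \<open>As t^s leaves no remainder, only the correction contributes: -g2 - s^2 t^(-2s-1) u is
  exactly (k/4) t^(-s-1/2), where 1/4 is the square of the extra exponent. Up to t0 this beats the
  curvature term C s t^(-s); beyond t0 all powers are comparable and the term with a takes
  over.\<close>

lemma supersolution:
  assumes "C \<ge> 0"
  shows "\<exists>a\<ge>0. \<forall>t. 0 < t \<and> t \<le> D \<longrightarrow>
    u t * (s\<^sup>2 * t powr (- 2 * s - 1) - a * t powr (- m)) \<le> - g2 t - C * g1 t"
proof -
  \<comment> \<open>Chosen so that C s t0^(1/2) \<le> k/4; the summand 1 avoids division by zero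
    when C = 0.\<close>
  define t0 where "t0 = (k / (4 * (C * s + 1)))\<^sup>2"
  have Cs: "C * s \<ge> 0" using assms s by simp
  have t0: "t0 > 0" using k Cs unfolding t0_def by (intro zero_less_power divide_pos_pos) auto
  \<comment> \<open>This exponent satisfies t^q t^s t^(-m) = t^(-s). In a, the factor 2 pays for u
    \<ge> t^s/2, and the sum of the two endpoint powers covers either sign of q.\<close>
  define q where "q = m - 2 * s"
  define a where "a = 2 * (C * s) * (t0 powr q + D powr q)"
  have "a \<ge> 0" using Cs by (simp add: a_def)
  moreover have "u t * (s\<^sup>2 * t powr (- 2 * s - 1) - a * t powr (- m)) \<le> - g2 t - C * g1 t"
    if t: "0 < t" "t \<le> D" for t
  proof -
    have e: "t powr (s + 1/2) * t powr (- 2 * s - 1) = t powr (- s - 1/2)"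
       "t powr s * t powr (- 2 * s - 1) = t powr (- s - 1)"
      by (simp_all add: powr_add[symmetric])
    have id0: "u t * t powr (- 2 * s - 1) = t powr (- s - 1) - k * t powr (- s - 1/2)"
      unfolding u_def left_diff_distrib mult.assoc e ..
    then have id: "- g2 t - u t * (s\<^sup>2 * t powr (- 2 * s - 1)) = k / 4 * t powr (- s - 1/2)"
    proof -
      have "u t * (s\<^sup>2 * t powr (- 2 * s - 1)) = s\<^sup>2 * (t powr (- s - 1) - k * t powr (- s - 1/2))"
        by (subst mult.left_commute) (simp only: id0)
      moreover have "- (- (s\<^sup>2 * A) - k * (s + 1/2) * (1/2 - s) * B) - s\<^sup>2 * (A - k * B) = k / 4 * B" for A B
        by (simp add: field_simps power2_eq_square)
      ultimately show ?thesis unfolding g2_def by (simp only:)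
    qed
    have cg: "C * g1 t \<le> C * s * t powr (- s)"
      using mult_left_mono[OF g1_le[OF t(1)] assms] by (simp add: mult.assoc)
    have um: "0 \<le> a * (u t * t powr (- m))" using \<open>a \<ge> 0\<close> u_pos[OF t] by simp
    have "C * s * t powr (- s) \<le> k / 4 * t powr (- s - 1/2) + a * (u t * t powr (- m))"
    proof (cases "t \<le> t0")
      case True
      have "t powr (1/2) \<le> t0 powr (1/2)" using True t by (intro powr_mono2) auto
      also have "t0 powr (1/2) = k / (4 * (C * s + 1))"
        unfolding t0_def powr_half_sqrt[OF zero_le_power2] using k Cs by (simp add: real_sqrt_abs)
      finally have "C * s * t powr (1/2) \<le> (C * s + 1) * (k / (4 * (C * s + 1)))"
        using Cs by (intro mult_mono) auto
      also have "\<dots> = k / 4" using Cs by (simp add: field_simps add_nonneg_eq_0_iff)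
      finally have "C * s * t powr (1/2) * t powr (- s - 1/2) \<le> k / 4 * t powr (- s - 1/2)"
        by (intro mult_right_mono) auto
      moreover have "t powr (1/2) * t powr (- s - 1/2) = t powr (- s)"
        by (simp add: powr_add[symmetric])
      ultimately show ?thesis using um by (simp add: mult.assoc)
    next
      case False
      have "t powr q \<le> max (t0 powr q) (D powr q)" using False t t0 by (intro powr_between_max) auto
      also have "\<dots> \<le> t0 powr q + D powr q" by simp
      finally have "2 * (C * s) * t powr q \<le> a" unfolding a_def using Cs by (intro mult_left_mono) auto
      then have "2 * (C * s) * t powr q * (t powr s / 2 * t powr (- m)) \<le> a * (u t * t powr (- m))"
        using u_ge[OF t] u_pos[OF t] \<open>a \<ge> 0\<close> Cs by (intro mult_mono) auto
      moreover have "t powr q * (t powr s * t powr (- m)) = t powr (- s)"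
        by (simp add: powr_add[symmetric] q_def)
      ultimately have "C * s * t powr (- s) \<le> a * (u t * t powr (- m))" by (simp add: mult.assoc)
      moreover have "0 \<le> k / 4 * t powr (- s - 1/2)" using k by simp
      ultimately show ?thesis by linarith
    qed
    then show ?thesis using id cg by (simp add: algebra_simps)
  qed
  ultimately show ?thesis by blast
qed

text \<open>Monotonicity of g allows the upper bounds for y and z to be inserted into Taylor
  expansions at t. The terms linear in h r cancel, c h^2 meets \<open>g1\<close> twice, and the
  squares leave r^2 \<open>g2\<close>. M and h0 are uniform in t, y, z and r, so the estimate can be
  integrated over x.\<close>

lemma second_difference:
  assumes m: "0 < m" and kk: "0 \<le> c"
  shows "\<exists>M. \<exists>h0>0. \<forall>h t y z r. 0 < h \<and> h \<le> h0 \<and> 2 * m \<le> t \<and> t \<le> D - m \<and>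
     0 < y \<and> 0 < z \<and> \<bar>r\<bar> \<le> 1 \<and> y \<le> t + h * r + c * h\<^sup>2 \<and> z \<le> t - h * r + c * h\<^sup>2
     \<longrightarrow> g y + g z - 2 * g t \<le> h\<^sup>2 * (2 * c * g1 t + r\<^sup>2 * g2 t) + M * h ^ 3"
proof -
  have sub: "{m..D} \<subseteq> {0<..}" using m by auto
  obtain B3 where "\<forall>x\<in>g3 ` {m..D}. norm x \<le> B3"
    using compact_imp_bounded[OF compact_continuous_image[OF continuous_on_subset[OF continuous_g3 sub]]]
    unfolding bounded_iff by auto
  then have B3: "\<bar>g3 t\<bar> \<le> B3" if "t \<in> {m..D}" for t using that by auto
  obtain B2 where "\<forall>x\<in>g2 ` {m..D}. norm x \<le> B2"
    using compact_imp_bounded[OF compact_continuous_image[OF continuous_on_subset[OF continuous_g2 sub]]]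
    unfolding bounded_iff by auto
  then have B2: "\<bar>g2 t\<bar> \<le> B2" if "t \<in> {m..D}" for t using that by auto
  have taylor: "g (t + e) \<le> g t + g1 t * e + g2 t / 2 * e\<^sup>2 + B3 / 6 * \<bar>e\<bar> ^ 3"
    if t: "t \<in> {m..D}" "t + e \<in> {m..D}" for t e
  proof (cases "e = 0")
    case False
    define diff where "diff n = (if n = 0 then g else if n = 1 then g1 else if n = 2 then g2 else g3)" for n :: nat
    have "\<forall>n t. n < 3 \<and> m \<le> t \<and> t \<le> D \<longrightarrow> DERIV (diff n) t :> diff (Suc n) t"
      using m g_deriv g1_deriv g2_deriv by (auto simp: diff_def numeral_3_eq_3 numeral_2_eq_2 less_Suc_eq)
    from Taylor[where n = 3 and diff = diff and f = g and x = "t + e" and c = t, OF _ _ this] t False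
    obtain \<xi> where \<xi>: "if t + e < t then t + e < \<xi> \<and> \<xi> < t else t < \<xi> \<and> \<xi> < t + e"
      and eq: "g (t + e) = (\<Sum>n<3. diff n t / fact n * e ^ n) + diff 3 \<xi> / fact 3 * e ^ 3"
      by (auto simp: diff_def)
    have "(\<Sum>n<3. diff n t / fact n * e ^ n) = g t + g1 t * e + g2 t / 2 * e\<^sup>2"
      by (simp add: diff_def numeral_3_eq_3 numeral_2_eq_2)
    moreover have "g3 \<xi> * e ^ 3 \<le> B3 * \<bar>e\<bar> ^ 3"
    proof -
      have "\<xi> \<in> {m..D}" using \<xi> t by (auto split: if_splits)
      then have "\<bar>g3 \<xi> * e ^ 3\<bar> \<le> B3 * \<bar>e\<bar> ^ 3"
        unfolding abs_mult power_abs by (intro mult_right_mono B3) auto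
      then show ?thesis by linarith
    qed
    moreover have "diff 3 \<xi> / fact 3 * e ^ 3 = g3 \<xi> * e ^ 3 / 6" by (simp add: diff_def fact_numeral)
    ultimately show ?thesis using eq by simp
  qed simp
  \<comment> \<open>The first summand absorbs the h^4 term by h \<le> 1; the second collects two
    cubic remainders at displacements of size at most h(1 + c).\<close>
  define M where "M = c\<^sup>2 * B2 + B3 / 3 * (1 + c) ^ 3"
  \<comment> \<open>Makes h(1 + c) \<le> m, which keeps both displaced points in {m..D}, where the
    bounds on \<open>g2\<close> and \<open>g3\<close> hold.\<close>
  define h0 where "h0 = min 1 (m / (1 + c))"
  have h0: "h0 > 0" using m kk by (simp add: h0_def)
  have "g y + g z - 2 * g t \<le> h\<^sup>2 * (2 * c * g1 t + r\<^sup>2 * g2 t) + M * h ^ 3"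
    if h: "0 < h" "h \<le> h0" and t: "2 * m \<le> t" "t \<le> D - m" and yz: "0 < y" "0 < z" and r: "\<bar>r\<bar> \<le> 1"
      and ub: "y \<le> t + h * r + c * h\<^sup>2" "z \<le> t - h * r + c * h\<^sup>2" for h t y z r
  proof -
    let ?e = "h * r + c * h\<^sup>2" and ?f = "- (h * r) + c * h\<^sup>2"
    have h1: "h \<le> 1" "h * (1 + c) \<le> m" using h kk by (auto simp: h0_def field_simps)
    have "h\<^sup>2 \<le> h" using h h1 by (simp add: power2_eq_square mult_left_le_one_le)
    then have ch: "c * h\<^sup>2 \<le> c * h" using kk by (intro mult_left_mono) auto
    have "\<bar>h * r\<bar> \<le> h" using r h by (simp add: abs_mult mult_left_le)
    then have ef: "\<bar>?e\<bar> \<le> h * (1 + c)" "\<bar>?f\<bar> \<le> h * (1 + c)"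
      using ch mult_nonneg_nonneg[OF kk zero_le_power2[of h]]
      unfolding distrib_left mult_1_right mult.commute[of h c] by linarith+
    have tD: "t \<in> {m..D}" "t + ?e \<in> {m..D}" "t + ?f \<in> {m..D}"
      using ef h1 t m by auto
    have B3n: "B3 \<ge> 0" and B2n: "B2 \<ge> 0" using B3[OF tD(1)] B2[OF tD(1)] by auto
    have cube: "B3 / 6 * \<bar>e\<bar> ^ 3 \<le> B3 / 6 * (h * (1 + c)) ^ 3" if "\<bar>e\<bar> \<le> h * (1 + c)" for e
      using that B3n by (intro mult_left_mono power_mono) auto
    have "g y \<le> g (t + ?e)" using yz ub tD by (intro g_mono) auto
    moreover have "g z \<le> g (t + ?f)" using yz ub tD by (intro g_mono) auto
    moreover have "g (t + ?e) \<le> g t + g1 t * ?e + g2 t / 2 * ?e\<^sup>2 + B3 / 6 * (h * (1 + c)) ^ 3"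
      using taylor[OF tD(1,2)] cube[OF ef(1)] by linarith
    moreover have "g (t + ?f) \<le> g t + g1 t * ?f + g2 t / 2 * ?f\<^sup>2 + B3 / 6 * (h * (1 + c)) ^ 3"
      using taylor[OF tD(1,3)] cube[OF ef(2)] by linarith
    moreover have "g1 t * ?e + g1 t * ?f = h\<^sup>2 * (2 * c * g1 t)" by (simp add: algebra_simps)
    moreover have "g2 t / 2 * ?e\<^sup>2 + g2 t / 2 * ?f\<^sup>2 = h\<^sup>2 * (r\<^sup>2 * g2 t) + g2 t * c\<^sup>2 * h ^ 4"
      by (simp add: power2_eq_square power4_eq_xxxx algebra_simps)
    moreover have "g2 t * c\<^sup>2 * h ^ 4 \<le> c\<^sup>2 * B2 * h ^ 3"
    proof -
      have "g2 t * c\<^sup>2 * h ^ 4 \<le> B2 * c\<^sup>2 * h ^ 4"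
        using B2[OF tD(1)] by (intro mult_right_mono) (auto simp: abs_le_iff)
      also have "\<dots> \<le> B2 * c\<^sup>2 * h ^ 3"
        using h h1 B2n by (intro mult_left_mono power_decreasing) auto
      finally show ?thesis by (simp add: mult_ac)
    qed
    moreover have "2 * (B3 / 6 * (h * (1 + c)) ^ 3) = B3 / 3 * (1 + c) ^ 3 * h ^ 3"
      by (simp add: power_mult_distrib)
    ultimately show ?thesis unfolding M_def distrib_left distrib_right by linarith
  qed
  then show ?thesis using h0 by blast
qed

end

section \<open>Test functions\<close>

lemma integrable_compact_support:
  fixes f :: "'a :: euclidean_space \<Rightarrow> 'b :: {banach, second_countable_topology}"
  assumes "compact K" "continuous_on K f" "\<And>x. x \<notin> K \<Longrightarrow> f x = 0"
  shows "integrable lborel f"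
proof -
  have "(\<lambda>x. indicator K x *\<^sub>R f x) = f" using assms(3) by (auto simp: indicator_def fun_eq_iff)
  then show ?thesis using borel_integrable_compact[OF assms(1,2)] by simp
qed

lemma integral_translation_lborel:
  fixes f :: "'a :: euclidean_space \<Rightarrow> 'b :: {banach, second_countable_topology}"
  assumes "integrable lborel f"
  shows "integrable lborel (\<lambda>x. f (x + c))" "(\<integral>x. f (x + c) \<partial>lborel) = (\<integral>x. f x \<partial>lborel)"
proof -
  have m: "(+) c \<in> lborel \<rightarrow>\<^sub>M (borel :: 'a measure)" by simp
  have f: "f \<in> borel_measurable borel" using borel_measurable_integrable[OF assms] by simp
  show "integrable lborel (\<lambda>x. f (x + c))"
    using integrable_distr_eq[OF m f] assms by (simp add: lborel_distr_plus add.commute)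
  show "(\<integral>x. f (x + c) \<partial>lborel) = (\<integral>x. f x \<partial>lborel)"
    using integral_distr[OF m f] by (simp add: lborel_distr_plus add.commute)
qed

lemma Cc_infinityD:
  assumes "\<phi> \<in> Cc_infinity \<Omega>"
  shows "continuous_on S \<phi>" "\<phi> differentiable (at x)"
    "compact (closure {x. \<phi> x \<noteq> 0})" "closure {x. \<phi> x \<noteq> 0} \<subseteq> \<Omega>"
    "x \<notin> closure {x. \<phi> x \<noteq> 0} \<Longrightarrow> \<phi> x = 0"
proof -
  have k: "Ck_on k \<phi> UNIV" for k using assms by (simp add: Cc_infinity_def)
  show "continuous_on S \<phi>" using k[of 0] by (auto intro: continuous_on_subset)
  show "\<phi> differentiable (at x)" using k[of 1] by simp
  show "compact (closure {x. \<phi> x \<noteq> 0})" "closure {x. \<phi> x \<noteq> 0} \<subseteq> \<Omega>"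
    using assms by (auto simp: Cc_infinity_def)
  show "\<phi> x = 0" if "x \<notin> closure {x. \<phi> x \<noteq> 0}"
    using that subsetD[OF closure_subset, of x "{x. \<phi> x \<noteq> 0}"] by auto
qed

lemma pderivative_outside_support:
  assumes "x \<notin> closure {x. f x \<noteq> 0}"
  shows "pderivative i f x = 0"
proof -
  have "(f has_derivative (\<lambda>_. 0)) (at x)"
  proof (rule has_derivative_transform_within_open)
    show "((\<lambda>_. 0) has_derivative (\<lambda>_. 0)) (at x)" by simp
    show "open (- closure {x. f x \<noteq> 0})" by (simp add: open_Compl)
    show "0 = f y" if "y \<in> - closure {x. f x \<noteq> 0}" for y
      using that subsetD[OF closure_subset, of y "{x. f x \<noteq> 0}"] by auto
  qed (use assms in simp)
  from pderivative_eqI[OF this] show ?thesis by simp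
qed

lemma Cc_infinity_pderivative:
  assumes "\<phi> \<in> Cc_infinity \<Omega>"
  shows "pderivative i \<phi> \<in> Cc_infinity \<Omega>"
proof -
  have k: "Ck_on k \<phi> UNIV" for k using assms by (simp add: Cc_infinity_def)
  have "Ck_on k (pderivative i \<phi>) UNIV" for k using k[of "Suc k"] by simp
  moreover have "closure {x. pderivative i \<phi> x \<noteq> 0} \<subseteq> closure {x. \<phi> x \<noteq> 0}"
    using pderivative_outside_support[of _ \<phi> i] by (intro closure_minimal) auto
  moreover have "compact (closure {x. pderivative i \<phi> x \<noteq> 0})"
    using Cc_infinityD(3)[OF assms] closed_Int_compact[of "closure {x. pderivative i \<phi> x \<noteq> 0}" "closure {x. \<phi> x \<noteq> 0}"] calculation(2)
    by (simp add: Int_absorb2)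
  ultimately show ?thesis using Cc_infinityD(4)[OF assms] by (auto simp: Cc_infinity_def)
qed

lemma Cc_infinity_bounded:
  assumes "\<phi> \<in> Cc_infinity \<Omega>"
  shows "\<exists>B. \<forall>x. norm (\<phi> x) \<le> B"
proof -
  let ?K = "closure {x. \<phi> x \<noteq> 0}"
  obtain B where B: "\<forall>y\<in>\<phi> ` ?K. norm y \<le> B"
    using compact_imp_bounded[OF compact_continuous_image[OF Cc_infinityD(1)[OF assms] Cc_infinityD(3)[OF assms]]]
    unfolding bounded_iff by blast
  have "norm (\<phi> x) \<le> max B 0" for x
    using B Cc_infinityD(5)[OF assms, of x] by (cases "x \<in> ?K") auto
  then show ?thesis by blast
qed

lemma Cc_infinity_lipschitz:
  fixes \<phi> :: "real ^ 'n \<Rightarrow> complex"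
  assumes "\<phi> \<in> Cc_infinity \<Omega>"
  shows "\<exists>L\<ge>0. \<forall>x y. norm (\<phi> x - \<phi> y) \<le> L * norm (x - y)"
proof -
  have "\<forall>i. \<exists>B. \<forall>x. norm (pderivative i \<phi> x) \<le> B"
    using Cc_infinity_bounded[OF Cc_infinity_pderivative[OF assms]] by blast
  then obtain B where B: "\<And>i x. norm (pderivative i \<phi> x) \<le> B i" by metis
  have B0: "0 \<le> B i" for i using B[of i] norm_ge_zero order_trans by blast
  have "norm (pderivative i \<phi> x) \<le> sum B UNIV" for i x
    using B[of i x] member_le_sum[of i UNIV B] B0 by force
  then have "norm (\<phi> x - \<phi> y) \<le> real CARD('n) * sum B UNIV * norm (x - y)" for x y
    using pderivative_lipschitz[of UNIV \<phi> "sum B UNIV" x y] Cc_infinityD(2)[OF assms] by simp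
  moreover have "real CARD('n) * sum B UNIV \<ge> 0" using B0 by (simp add: sum_nonneg)
  ultimately show ?thesis by blast
qed

lemma difference_quotient_tendsto:
  assumes "f differentiable (at x)" "h \<longlonglongrightarrow> (0::real)" "\<And>j. h j \<noteq> 0"
  shows "(\<lambda>j. (f (x + h j *\<^sub>R axis i 1) - f x) /\<^sub>R h j) \<longlonglongrightarrow> pderivative i f x"
proof -
  have "((\<lambda>t. f (x + t *\<^sub>R axis i 1)) has_vector_derivative pderivative i f x) (at 0)"
  proof -
    have "(f has_derivative frechet_derivative f (at x)) (at (x + 0 *\<^sub>R axis i 1))"
      using frechet_derivative_works[THEN iffD1, OF assms(1)] by simp
    moreover have "((\<lambda>t. x + t *\<^sub>R axis i 1) has_derivative (\<lambda>t. t *\<^sub>R axis i 1)) (at (0::real))"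
      by (auto intro!: derivative_eq_intros)
    ultimately have "((\<lambda>t. f (x + t *\<^sub>R axis i 1)) has_derivative (\<lambda>t. frechet_derivative f (at x) (t *\<^sub>R axis i 1))) (at 0)"
      by (rule has_derivative_compose[rotated])
    then show ?thesis
      unfolding has_vector_derivative_def pderivative_def
      using linear_frechet_derivative[OF assms(1)] by (simp add: linear_scale)
  qed
  then have "((\<lambda>t. norm (f (x + t *\<^sub>R axis i 1) - f x - t *\<^sub>R pderivative i f x) / norm t) \<longlongrightarrow> 0) (at 0)"
    by (simp add: has_vector_derivative_def has_derivative_iff_norm)
  then have "((\<lambda>t. norm ((f (x + t *\<^sub>R axis i 1) - f x) /\<^sub>R t - pderivative i f x)) \<longlongrightarrow> 0) (at 0)"
  proof (rule Lim_transform_eventually)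
    have "norm (f (x + t *\<^sub>R axis i 1) - f x - t *\<^sub>R pderivative i f x) / norm t
        = norm ((f (x + t *\<^sub>R axis i 1) - f x) /\<^sub>R t - pderivative i f x)" if "t \<noteq> 0" for t
    proof -
      have "(f (x + t *\<^sub>R axis i 1) - f x) /\<^sub>R t - pderivative i f x
          = (f (x + t *\<^sub>R axis i 1) - f x - t *\<^sub>R pderivative i f x) /\<^sub>R t"
        using that by (simp add: scaleR_right_diff_distrib)
      then show ?thesis by (simp add: divide_inverse_commute)
    qed
    then show "\<forall>\<^sub>F t in at 0. norm (f (x + t *\<^sub>R axis i 1) - f x - t *\<^sub>R pderivative i f x) / norm t
        = norm ((f (x + t *\<^sub>R axis i 1) - f x) /\<^sub>R t - pderivative i f x)"
      by (auto simp: eventually_at_filter)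
  qed
  then have "((\<lambda>t. (f (x + t *\<^sub>R axis i 1) - f x) /\<^sub>R t) \<longlongrightarrow> pderivative i f x) (at 0)"
    by (rule LIM_zero_cancel[OF tendsto_norm_zero_cancel])
  then show ?thesis
    by (rule filterlim_compose) (use assms(2,3) in \<open>auto simp: filterlim_at\<close>)
qed

section \<open>The ground state inequality\<close>

context hardy_profile
begin

text \<open>Summing the ground state inequality for the pairs
  \<open>(x, x + h e\<^sub>i)\<close> instead of integrating by parts means that only one-sided bounds for
  second differences of \<open>g \<circ> \<sigma>\<close> enter, and no differentiability of \<open>\<sigma>\<close>.\<close>

lemma difference_inequality:
  fixes \<phi> :: "real ^ 'n \<Rightarrow> complex" and \<sigma> :: "real ^ 'n \<Rightarrow> real" and h :: real and i :: 'n
  assumes \<phi>: "\<phi> \<in> Cc_infinity \<Omega>"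
    and lip: "\<And>x y. \<bar>\<sigma> x - \<sigma> y\<bar> \<le> dist x y"
    and m: "0 < m" and h: "0 < h" "h \<le> m / 2"
    and lo: "\<And>x. \<phi> x \<noteq> 0 \<Longrightarrow> 2 * m \<le> \<sigma> x" and up: "\<And>x. \<phi> x \<noteq> 0 \<Longrightarrow> \<sigma> x \<le> D - m"
  defines "K' \<equiv> {x + y |x y. x \<in> closure {x. \<phi> x \<noteq> 0} \<and> y \<in> cball 0 (m/2)}"
  defines "L \<equiv> \<lambda>x. (cmod (\<phi> x))\<^sup>2 / u (\<sigma> x) *
      (2 * g (\<sigma> x) - g (\<sigma> (x + h *\<^sub>R axis i 1)) - g (\<sigma> (x - h *\<^sub>R axis i 1)))"
  defines "R \<equiv> \<lambda>x. max (w (\<sigma> x)) (w (\<sigma> (x + h *\<^sub>R axis i 1))) * (cmod (\<phi> (x + h *\<^sub>R axis i 1) - \<phi> x))\<^sup>2"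
  shows "integrable lborel L" "integrable lborel R" "(\<integral>x. L x \<partial>lborel) \<le> (\<integral>x. R x \<partial>lborel)"
    "compact K'" "x \<notin> K' \<Longrightarrow> R x = 0" "x \<in> K' \<Longrightarrow> \<sigma> x \<in> {m..D}" "x \<in> K' \<Longrightarrow> \<sigma> (x + h *\<^sub>R axis i 1) \<in> {m..D}"
proof -
  define K where "K = closure {x. \<phi> x \<noteq> 0}"
  define e where "e = h *\<^sub>R axis i (1::real)"
  have ne: "norm e = h" using h by (simp add: e_def)
  have cs: "continuous_on S \<sigma>" for S
    unfolding continuous_on_iff using lip by (metis dist_real_def order_le_less_trans)
  have K: "compact K" "\<And>x. x \<notin> K \<Longrightarrow> \<phi> x = 0"
    unfolding K_def by (rule Cc_infinityD(3)[OF \<phi>], rule Cc_infinityD(5)[OF \<phi>])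
  have "closed {x. 2 * m \<le> \<sigma> x \<and> \<sigma> x \<le> D - m}"
    using closed_Collect_conj[OF closed_Collect_le[OF continuous_on_const cs] closed_Collect_le[OF cs continuous_on_const]] .
  then have "K \<subseteq> {x. 2 * m \<le> \<sigma> x \<and> \<sigma> x \<le> D - m}"
    unfolding K_def using lo up by (intro closure_minimal) auto
  then have Kb: "2 * m \<le> \<sigma> x" "\<sigma> x \<le> D - m" if "x \<in> K" for x using that by auto
  have near: "\<sigma> (x + y) \<in> {m..D}" if "x \<in> K" "norm y \<le> m" for x y
    using Kb[OF that(1)] lip[of "x + y" x] that(2) by (auto simp: dist_norm)
  have K'_mem: "\<exists>z\<in>K. norm (x - z) \<le> m / 2" if x: "x \<in> K'" for x
  proof -
    obtain z y where "x = z + y" "z \<in> K" "norm y \<le> m / 2"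
      using x unfolding K'_def K_def[symmetric] by auto
    then show ?thesis by (intro bexI[of _ z]) auto
  qed
  show comp: "compact K'" unfolding K'_def K_def[symmetric]
    by (rule compact_sums[OF K(1) compact_cball])
  show K'1: "\<sigma> x \<in> {m..D}" if x: "x \<in> K'" for x
  proof -
    obtain z where "z \<in> K" "norm (x - z) \<le> m / 2" using K'_mem[OF x] by blast
    then show ?thesis using near[of z "x - z"] m by simp
  qed
  have K'2: "\<sigma> (x + e) \<in> {m..D}" if x: "x \<in> K'" for x
  proof -
    obtain z where z: "z \<in> K" "norm (x - z) \<le> m / 2" using K'_mem[OF x] by blast
    have "norm (x - z + e) \<le> m" using norm_triangle_ineq[of "x - z" e] z(2) ne h by linarith
    then show ?thesis using near[of z "x - z + e"] z(1) by (simp add: algebra_simps)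
  qed
  then show "\<sigma> (x + h *\<^sub>R axis i 1) \<in> {m..D}" if "x \<in> K'" for x using that by (simp add: e_def)
  have K'I: "x + y \<in> K'" if "x \<in> K" "norm y \<le> m / 2" for x y
    using that by (auto simp: K'_def K_def)
  have KK': "x \<in> K'" if "x \<in> K" for x using K'I[OF that, of 0] m by simp
  \<comment> \<open>The thickening by m/2 \<ge> h makes K' contain every x for which either end of
    the edge from x to x + e lies in the support.\<close>
  have KK'e: "x \<in> K'" if "x + e \<in> K" for x using K'I[OF that, of "- e"] ne h by simp
  have R: "R x = max (w (\<sigma> x)) (w (\<sigma> (x + e))) * (cmod (\<phi> (x + e) - \<phi> x))\<^sup>2" for x
    by (simp add: R_def e_def)
  show R0: "R x = 0" if "x \<notin> K'" for x
  proof -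
    have "\<phi> x = 0" "\<phi> (x + e) = 0" using that KK' KK'e K(2) by blast+
    then show ?thesis unfolding R by simp
  qed
  have sub: "{m..D} \<subseteq> {0<..}" using m by auto
  have cw: "continuous_on S (\<lambda>x. w (f x))" if "continuous_on S f" "\<And>x. x \<in> S \<Longrightarrow> f x \<in> {m..D}" for S :: "(real ^ 'n) set" and f
    by (rule continuous_on_compose2[OF continuous_w that(1)]) (use that(2) sub in blast)
  have cg: "continuous_on S (\<lambda>x. g (f x))" if "continuous_on S f" "\<And>x. x \<in> S \<Longrightarrow> f x \<in> {m..D}" for S :: "(real ^ 'n) set" and f
    by (rule continuous_on_compose2[OF continuous_g that(1)]) (use that(2) sub in blast)
  have cu: "continuous_on S (\<lambda>x. u (f x))" if "continuous_on S f" "\<And>x. x \<in> S \<Longrightarrow> f x \<in> {m..D}" for S :: "(real ^ 'n) set" and f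
    by (rule continuous_on_compose2[OF continuous_u that(1)]) (use that(2) sub in blast)
  have cse: "continuous_on S (\<lambda>x. \<sigma> (x + y))" for S y
    by (intro continuous_on_compose2[OF cs[of UNIV]] continuous_intros) auto
  have cpe: "continuous_on S (\<lambda>x. \<phi> (x + y))" for S y
    by (intro continuous_on_compose2[OF Cc_infinityD(1)[OF \<phi>, of UNIV]] continuous_intros) auto
  show iR: "integrable lborel R"
    unfolding R[abs_def]
  proof (rule integrable_compact_support[OF comp])
    show "continuous_on K' (\<lambda>x. max (w (\<sigma> x)) (w (\<sigma> (x + e))) * (cmod (\<phi> (x + e) - \<phi> x))\<^sup>2)"
      by (intro continuous_intros cw cs cse cpe Cc_infinityD(1)[OF \<phi>] K'1 K'2)
  qed (use R0 R in auto)
  define T where "T y x = (cmod (\<phi> x))\<^sup>2 * (g (\<sigma> x) - g (\<sigma> (x + y))) / u (\<sigma> x)" for x y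
  have upos: "u (\<sigma> x) > 0" if "x \<in> K'" for x
    using K'1[OF that] m by (intro u_pos) auto
  have iT: "integrable lborel (T y)" if "norm y \<le> m" for y
    unfolding T_def[abs_def]
  proof (rule integrable_compact_support[OF K(1)])
    show "continuous_on K (\<lambda>x. (cmod (\<phi> x))\<^sup>2 * (g (\<sigma> x) - g (\<sigma> (x + y))) / u (\<sigma> x))"
      using upos KK' by (intro continuous_intros cg cu cs cse cpe Cc_infinityD(1)[OF \<phi>] near that K'1)
        (auto, metis less_irrefl)
  qed (use K(2) in auto)
  have LT: "L = (\<lambda>x. T e x + T (- e) x)"
    unfolding L_def T_def e_def[symmetric]
    by (auto simp: fun_eq_iff add_divide_distrib[symmetric] distrib_left[symmetric])
  have ie: "integrable lborel (T e)" "integrable lborel (T (- e))"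
    using iT[of e] iT[of "- e"] ne h unfolding norm_minus_cancel by linarith+
  show "integrable lborel L" unfolding LT using ie by auto
  \<comment> \<open>\<open>T e\<close> is the share of the edge (x, x + e) belonging to its first
    end. Translating \<open>T (- e)\<close> by e yields the share of the second end of the same
    edge, so that \<open>two_point\<close> applies pointwise.\<close>
  note tr = integral_translation_lborel[OF ie(2), of e]
  have "(\<integral>x. L x \<partial>lborel) = (\<integral>x. T e x \<partial>lborel) + (\<integral>x. T (- e) (x + e) \<partial>lborel)"
    unfolding LT tr(2) using ie by (rule Bochner_Integration.integral_add)
  also have "\<dots> = (\<integral>x. T e x + T (- e) (x + e) \<partial>lborel)"
    by (rule Bochner_Integration.integral_add[symmetric, OF ie(1) tr(1)])
  also have "\<dots> \<le> (\<integral>x. R x \<partial>lborel)"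
  proof (rule integral_mono[OF _ iR])
    show "integrable lborel (\<lambda>x. T e x + T (- e) (x + e))" using ie(1) tr(1) by auto
    fix x
    show "T e x + T (- e) (x + e) \<le> R x"
    proof (cases "x \<in> K'")
      case True
      have "0 < \<sigma> x" "\<sigma> x \<le> D" "0 < \<sigma> (x + e)" "\<sigma> (x + e) \<le> D"
        using K'1[OF True] K'2[OF True] m by auto
      from two_point[OF this, of "\<phi> x" "\<phi> (x + e)"] show ?thesis
        by (simp add: T_def R)
    next
      case False
      then have "\<phi> x = 0" "\<phi> (x + e) = 0" using KK' KK'e K(2) by auto
      then show ?thesis using R0[OF False] by (simp add: T_def)
    qed
  qed
  finally show "(\<integral>x. L x \<partial>lborel) \<le> (\<integral>x. R x \<partial>lborel)" .
qed

lemma sum_component_square: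
  fixes n :: "real ^ 'n"
  shows "(\<Sum>i\<in>UNIV. (n $ i)\<^sup>2) = (norm n)\<^sup>2"
  by (simp add: norm_vec_def L2_set_def sum_nonneg)

text \<open>Summed over the coordinate directions, |n| = 1 merges the terms with \<open>g2\<close>
  into one, while the curvature term is counted \<open>CARD('n)\<close> times. After division by h^2
  the error M h^3 is of order h. The left side is bounded from below before the limit, so difference
  quotients converge only for the smooth factor \<phi>.\<close>

lemma ground_state_inequality:
  fixes \<phi> :: "real ^ 'n \<Rightarrow> complex" and \<sigma> :: "real ^ 'n \<Rightarrow> real"
  assumes \<phi>: "\<phi> \<in> Cc_infinity \<Omega>"
    and lip: "\<And>x y. \<bar>\<sigma> x - \<sigma> y\<bar> \<le> dist x y"
    and m: "0 < m"
    and lo: "\<And>x. \<phi> x \<noteq> 0 \<Longrightarrow> 2 * m \<le> \<sigma> x" and up: "\<And>x. \<phi> x \<noteq> 0 \<Longrightarrow> \<sigma> x \<le> D - m"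
    and c: "0 \<le> c"
    and concave: "\<And>x. \<phi> x \<noteq> 0 \<Longrightarrow>
      \<exists>n. norm n = 1 \<and> (\<forall>v. norm v < 2 * m \<longrightarrow> \<sigma> (x + v) \<le> \<sigma> x + n \<bullet> v + c * (norm v)\<^sup>2)"
  shows "(\<integral>x. (cmod (\<phi> x))\<^sup>2 / u (\<sigma> x) * (- g2 (\<sigma> x) - 2 * c * real CARD('n) * g1 (\<sigma> x)) \<partial>lborel)
    \<le> (\<Sum>i\<in>UNIV. \<integral>x. w (\<sigma> x) * (cmod (pderivative i \<phi> x))\<^sup>2 \<partial>lborel)"
proof -
  define K where "K = closure {x. \<phi> x \<noteq> 0}"
  define K' where "K' = {x + y |x y. x \<in> K \<and> y \<in> cball 0 (m/2)}"
  define L where "L h i x = (cmod (\<phi> x))\<^sup>2 / u (\<sigma> x) *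
      (2 * g (\<sigma> x) - g (\<sigma> (x + h *\<^sub>R axis i 1)) - g (\<sigma> (x - h *\<^sub>R axis i 1)))" for h i x
  define R where "R h i x = max (w (\<sigma> x)) (w (\<sigma> (x + h *\<^sub>R axis i 1))) *
      (cmod (\<phi> (x + h *\<^sub>R axis i 1) - \<phi> x))\<^sup>2" for h i x
  note * = difference_inequality[OF \<phi> lip m _ _ lo up, folded K_def, folded K'_def, folded L_def R_def]
  define F where "F x = (cmod (\<phi> x))\<^sup>2 / u (\<sigma> x) * (- g2 (\<sigma> x) - 2 * c * real CARD('n) * g1 (\<sigma> x))" for x
  define P where "P x = (cmod (\<phi> x))\<^sup>2 / u (\<sigma> x)" for x
  have cs: "continuous_on S \<sigma>" for S
    unfolding continuous_on_iff using lip by (metis dist_real_def order_le_less_trans)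
  have K: "compact K" "\<And>x. x \<notin> K \<Longrightarrow> \<phi> x = 0"
    unfolding K_def by (rule Cc_infinityD(3)[OF \<phi>], rule Cc_infinityD(5)[OF \<phi>])
  have "closed {x. 2 * m \<le> \<sigma> x \<and> \<sigma> x \<le> D - m}"
    using closed_Collect_conj[OF closed_Collect_le[OF continuous_on_const cs] closed_Collect_le[OF cs continuous_on_const]] .
  then have "K \<subseteq> {x. 2 * m \<le> \<sigma> x \<and> \<sigma> x \<le> D - m}"
    unfolding K_def using lo up by (intro closure_minimal) auto
  then have Kb: "2 * m \<le> \<sigma> x" "\<sigma> x \<le> D - m" "0 < \<sigma> x" "\<sigma> x \<le> D" if "x \<in> K" for x using that m by auto
  have cK: "continuous_on K (\<lambda>x. f (\<sigma> x))" if "continuous_on {0<..} f" for f :: "real \<Rightarrow> real"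
    by (rule continuous_on_compose2[OF that cs]) (use Kb in auto)
  have unz: "u (\<sigma> x) \<noteq> 0" if "x \<in> K" for x using u_pos[OF Kb(3,4)[OF that]] by simp
  have iP: "integrable lborel P" unfolding P_def[abs_def]
    by (rule integrable_compact_support[OF K(1)])
       (use unz K(2) in \<open>auto intro!: continuous_intros cK continuous_u Cc_infinityD(1)[OF \<phi>]\<close>)
  have iF: "integrable lborel F" unfolding F_def[abs_def]
    by (rule integrable_compact_support[OF K(1)])
       (use unz K(2) in \<open>auto intro!: continuous_intros cK continuous_u continuous_g1 continuous_g2 Cc_infinityD(1)[OF \<phi>]\<close>)
  obtain M h0 where h0: "h0 > 0" and M: "\<And>h t y z r. 0 < h \<and> h \<le> h0 \<and> 2 * m \<le> t \<and> t \<le> D - m \<and>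
     0 < y \<and> 0 < z \<and> \<bar>r\<bar> \<le> 1 \<and> y \<le> t + h * r + c * h\<^sup>2 \<and> z \<le> t - h * r + c * h\<^sup>2
     \<Longrightarrow> g y + g z - 2 * g t \<le> h\<^sup>2 * (2 * c * g1 t + r\<^sup>2 * g2 t) + M * h ^ 3"
    using second_difference[OF m c] by blast
  have low: "h\<^sup>2 * F x - real CARD('n) * M * h ^ 3 * P x \<le> (\<Sum>i\<in>UNIV. L h i x)"
    if h: "0 < h" "h \<le> h0" "h \<le> m / 2" for h x
  proof (cases "\<phi> x = 0")
    case True then show ?thesis by (simp add: F_def P_def L_def)
  next
    case False
    then have xK: "x \<in> K" using K(2) by blast
    have P0: "P x \<ge> 0" unfolding P_def using u_pos[OF Kb(3,4)[OF xK]] by simp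
    obtain n where n: "norm n = 1" "\<And>v. norm v < 2 * m \<Longrightarrow> \<sigma> (x + v) \<le> \<sigma> x + n \<bullet> v + c * (norm v)\<^sup>2"
      using concave[OF False] by blast
    have each: "g (\<sigma> (x + h *\<^sub>R axis i 1)) + g (\<sigma> (x - h *\<^sub>R axis i 1)) - 2 * g (\<sigma> x)
        \<le> h\<^sup>2 * (2 * c * g1 (\<sigma> x) + (n $ i)\<^sup>2 * g2 (\<sigma> x)) + M * h ^ 3" for i
    proof (rule M, intro conjI)
      show "\<bar>n $ i\<bar> \<le> 1" using component_le_norm_cart[of n i] n(1) by simp
      show "\<sigma> (x + h *\<^sub>R axis i 1) \<le> \<sigma> x + h * n $ i + c * h\<^sup>2"
        using n(2)[of "h *\<^sub>R axis i 1"] h m by (simp add: inner_axis)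
      show "\<sigma> (x - h *\<^sub>R axis i 1) \<le> \<sigma> x - h * n $ i + c * h\<^sup>2"
        using n(2)[of "- (h *\<^sub>R axis i 1)"] h m by (simp add: inner_axis)
      show "0 < \<sigma> (x + h *\<^sub>R axis i 1)" "0 < \<sigma> (x - h *\<^sub>R axis i 1)"
        using lip[of "x + h *\<^sub>R axis i 1" x] lip[of "x - h *\<^sub>R axis i 1" x] Kb(1)[OF xK] h m
        by (auto simp: dist_norm)
    qed (use h Kb[OF xK] in auto)
    have "(\<Sum>i\<in>UNIV. g (\<sigma> (x + h *\<^sub>R axis i 1)) + g (\<sigma> (x - h *\<^sub>R axis i 1)) - 2 * g (\<sigma> x))
      \<le> (\<Sum>i\<in>UNIV. h\<^sup>2 * (2 * c * g1 (\<sigma> x) + (n $ i)\<^sup>2 * g2 (\<sigma> x)) + M * h ^ 3)"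
      by (rule sum_mono) (rule each)
    also have "\<dots> = h\<^sup>2 * (2 * c * real CARD('n) * g1 (\<sigma> x) + g2 (\<sigma> x)) + real CARD('n) * M * h ^ 3"
      using sum_component_square[of n] n(1)
      by (simp add: sum.distrib sum_distrib_left[symmetric] sum_distrib_right[symmetric] algebra_simps)
    finally have "P x * (\<Sum>i\<in>UNIV. g (\<sigma> (x + h *\<^sub>R axis i 1)) + g (\<sigma> (x - h *\<^sub>R axis i 1)) - 2 * g (\<sigma> x))
      \<le> P x * (h\<^sup>2 * (2 * c * real CARD('n) * g1 (\<sigma> x) + g2 (\<sigma> x)) + real CARD('n) * M * h ^ 3)"
      using P0 by (intro mult_left_mono)
    moreover have "(\<Sum>i\<in>UNIV. L h i x)
        = - (P x * (\<Sum>i\<in>UNIV. g (\<sigma> (x + h *\<^sub>R axis i 1)) + g (\<sigma> (x - h *\<^sub>R axis i 1)) - 2 * g (\<sigma> x)))"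
      unfolding sum_distrib_left sum_negf[symmetric] L_def P_def[symmetric]
      by (intro sum.cong) (auto simp: algebra_simps)
    moreover have "h\<^sup>2 * F x - real CARD('n) * M * h ^ 3 * P x
        = - (P x * (h\<^sup>2 * (2 * c * real CARD('n) * g1 (\<sigma> x) + g2 (\<sigma> x)) + real CARD('n) * M * h ^ 3))"
      by (simp add: F_def P_def[symmetric] algebra_simps)
    ultimately show ?thesis by linarith
  qed
  define h1 where "h1 = min h0 (m / 2)"
  have h1: "h1 > 0" using h0 m by (simp add: h1_def)
  define h where "h j = h1 / real (Suc j)" for j
  have h: "0 < h j" "h j \<le> h0" "h j \<le> m / 2" for j
  proof -
    show "0 < h j" using h1 by (simp add: h_def)
    have "h j \<le> h1" using h1 unfolding h_def by (simp add: field_simps)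
    then show "h j \<le> h0" "h j \<le> m / 2" by (auto simp: h1_def)
  qed
  have hlim: "h \<longlonglongrightarrow> 0" unfolding h_def
    by (rule LIMSEQ_Suc[OF lim_const_over_n])
  have ineq: "integral\<^sup>L lborel F - real CARD('n) * M * h j * integral\<^sup>L lborel P
      \<le> (\<Sum>i\<in>UNIV. \<integral>x. R (h j) i x / (h j)\<^sup>2 \<partial>lborel)" for j
  proof -
    note iL = *(1)[OF h(1,3)]
    have "(\<integral>x. (h j)\<^sup>2 * F x - real CARD('n) * M * (h j) ^ 3 * P x \<partial>lborel) \<le> (\<integral>x. (\<Sum>i\<in>UNIV. L (h j) i x) \<partial>lborel)"
      using iF iP iL low[OF h] by (intro integral_mono) auto
    also have "\<dots> = (\<Sum>i\<in>UNIV. \<integral>x. L (h j) i x \<partial>lborel)"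
      using iL by (intro Bochner_Integration.integral_sum)
    also have "\<dots> \<le> (\<Sum>i\<in>UNIV. \<integral>x. R (h j) i x \<partial>lborel)"
      by (intro sum_mono *(3) h)
    also have "(\<integral>x. (h j)\<^sup>2 * F x - real CARD('n) * M * (h j) ^ 3 * P x \<partial>lborel)
        = (h j)\<^sup>2 * (integral\<^sup>L lborel F - real CARD('n) * M * h j * integral\<^sup>L lborel P)"
      using iF iP by (subst Bochner_Integration.integral_diff) (auto simp: algebra_simps power2_eq_square power3_eq_cube)
    finally have "integral\<^sup>L lborel F - real CARD('n) * M * h j * integral\<^sup>L lborel P
        \<le> (\<Sum>i\<in>UNIV. \<integral>x. R (h j) i x \<partial>lborel) / (h j)\<^sup>2"
      using h(1)[of j] by (simp add: field_simps)
    also have "\<dots> = (\<Sum>i\<in>UNIV. \<integral>x. R (h j) i x / (h j)\<^sup>2 \<partial>lborel)"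
      by (simp add: sum_divide_distrib)
    finally show ?thesis .
  qed
  have lim: "(\<lambda>j. \<integral>x. R (h j) i x / (h j)\<^sup>2 \<partial>lborel) \<longlonglongrightarrow> (\<integral>x. w (\<sigma> x) * (cmod (pderivative i \<phi> x))\<^sup>2 \<partial>lborel)" for i
  proof -
    have "compact (w ` {m..D})"
      using m by (intro compact_continuous_image continuous_on_subset[OF continuous_w]) auto
    from compact_imp_bounded[OF this] obtain B where B: "\<forall>y\<in>w ` {m..D}. norm y \<le> B"
      unfolding bounded_iff by (rule exE)
    obtain l where l: "l \<ge> 0" "\<And>x y. norm (\<phi> x - \<phi> y) \<le> l * norm (x - y)"
      using Cc_infinity_lipschitz[OF \<phi>] by blast
    have cK': "compact K'" by (rule *(4)[OF h(1,3)])
    have s1: "\<sigma> x \<in> {m..D}" if "x \<in> K'" for x by (rule *(6)[OF h(1,3) _ _ that])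
    have s2: "\<sigma> (x + h j *\<^sub>R axis i 1) \<in> {m..D}" if "x \<in> K'" for x j by (rule *(7)[OF h(1,3) _ _ that])
    have R0: "R (h j) i x = 0" if "x \<notin> K'" for x j by (rule *(5)[OF h(1,3) _ _ that])
    show ?thesis
    \<comment> \<open>The Lipschitz constant l of \<phi> and the bound B of w on {m..D} dominate the
      quotients by B l^2, on a compact set K' common to all j.\<close>
    proof (rule integral_dominated_convergence[where w = "\<lambda>x. indicator K' x * (B * l\<^sup>2)"])
      have ck: "continuous_on K (\<lambda>x. w (\<sigma> x) * (cmod (pderivative i \<phi> x))\<^sup>2)"
        by (intro continuous_intros cK continuous_w Cc_infinityD(1)[OF Cc_infinity_pderivative[OF \<phi>]])
      have "integrable lborel (\<lambda>x. w (\<sigma> x) * (cmod (pderivative i \<phi> x))\<^sup>2)"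
        by (rule integrable_compact_support[OF K(1) ck])
           (use pderivative_outside_support[of _ \<phi> i] in \<open>auto simp: K_def\<close>)
      then show "(\<lambda>x. w (\<sigma> x) * (cmod (pderivative i \<phi> x))\<^sup>2) \<in> borel_measurable lborel" by simp
      show "(\<lambda>x. R (h j) i x / (h j)\<^sup>2) \<in> borel_measurable lborel" for j
        using *(2)[OF h(1,3), of j i] by (intro borel_measurable_divide) auto
      show "integrable lborel (\<lambda>x. indicator K' x * (B * l\<^sup>2))"
        by (rule integrable_compact_support[OF cK']) (auto intro: continuous_on_eq[OF continuous_on_const])
      show "AE x in lborel. (\<lambda>j. R (h j) i x / (h j)\<^sup>2) \<longlonglongrightarrow> w (\<sigma> x) * (cmod (pderivative i \<phi> x))\<^sup>2"
      proof (rule AE_I2)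
        fix x
        show "(\<lambda>j. R (h j) i x / (h j)\<^sup>2) \<longlonglongrightarrow> w (\<sigma> x) * (cmod (pderivative i \<phi> x))\<^sup>2"
        proof (cases "x \<in> K'")
          case True
          have eq: "R (h j) i x / (h j)\<^sup>2 = max (w (\<sigma> x)) (w (\<sigma> (x + h j *\<^sub>R axis i 1))) *
              (cmod ((\<phi> (x + h j *\<^sub>R axis i 1) - \<phi> x) /\<^sub>R h j))\<^sup>2" for j
            using h(1)[of j] by (simp add: R_def power_mult_distrib power_divide divide_inverse power_inverse)
          have "(\<lambda>j. \<sigma> (x + h j *\<^sub>R axis i 1)) \<longlonglongrightarrow> \<sigma> x"
          proof (rule continuous_on_tendsto_compose[OF cs[of UNIV]])
            show "(\<lambda>j. x + h j *\<^sub>R axis i 1) \<longlonglongrightarrow> x"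
              using tendsto_add[OF tendsto_const tendsto_scaleR[OF hlim tendsto_const], of x "axis i 1"] by simp
          qed auto
          moreover have "isCont w (\<sigma> x)"
            using continuous_w s1[OF True] m by (auto simp: continuous_on_eq_continuous_at)
          ultimately have "(\<lambda>j. w (\<sigma> (x + h j *\<^sub>R axis i 1))) \<longlonglongrightarrow> w (\<sigma> x)"
            by (metis isCont_tendsto_compose)
          then have "(\<lambda>j. max (w (\<sigma> x)) (w (\<sigma> (x + h j *\<^sub>R axis i 1)))) \<longlonglongrightarrow> max (w (\<sigma> x)) (w (\<sigma> x))"
            by (intro tendsto_max tendsto_const)
          moreover have "(\<lambda>j. (\<phi> (x + h j *\<^sub>R axis i 1) - \<phi> x) /\<^sub>R h j) \<longlonglongrightarrow> pderivative i \<phi> x"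
            using h(1) by (intro difference_quotient_tendsto Cc_infinityD(2)[OF \<phi>] hlim) (metis less_irrefl)
          ultimately have "(\<lambda>j. max (w (\<sigma> x)) (w (\<sigma> (x + h j *\<^sub>R axis i 1))) *
              (cmod ((\<phi> (x + h j *\<^sub>R axis i 1) - \<phi> x) /\<^sub>R h j))\<^sup>2)
            \<longlonglongrightarrow> max (w (\<sigma> x)) (w (\<sigma> x)) * (cmod (pderivative i \<phi> x))\<^sup>2"
            by (intro tendsto_mult tendsto_power tendsto_norm)
          then show ?thesis unfolding eq by (simp only: max.idem)
        next
          case False
          have "x \<notin> K"
            using False m by (auto simp: K'_def)
          then show ?thesis using R0[OF False] pderivative_outside_support[of x \<phi> i] by (simp add: K_def)
        qed
      qed
      show "AE x in lborel. norm (R (h j) i x / (h j)\<^sup>2) \<le> indicator K' x * (B * l\<^sup>2)" for j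
      proof (rule AE_I2)
        fix x
        show "norm (R (h j) i x / (h j)\<^sup>2) \<le> indicator K' x * (B * l\<^sup>2)"
        proof (cases "x \<in> K'")
          case True
          have mB: "max (w (\<sigma> x)) (w (\<sigma> (x + h j *\<^sub>R axis i 1))) \<le> B" (is "?m \<le> B")
            using bspec[OF B imageI[OF s1[OF True]]] bspec[OF B imageI[OF s2[OF True, of j]]] by auto
          have m0: "?m \<ge> 0" using w_nonneg by (simp add: max_def)
          have "cmod (\<phi> (x + h j *\<^sub>R axis i 1) - \<phi> x) \<le> l * h j"
            using l(2)[of "x + h j *\<^sub>R axis i 1" x] h(1)[of j] by simp
          then have "(cmod (\<phi> (x + h j *\<^sub>R axis i 1) - \<phi> x))\<^sup>2 \<le> (l * h j)\<^sup>2"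
            by (intro power_mono) auto
          then have "R (h j) i x \<le> B * (l * h j)\<^sup>2"
            unfolding R_def using mB m0 by (intro mult_mono) auto
          moreover have "R (h j) i x \<ge> 0" unfolding R_def using m0 by simp
          ultimately show ?thesis using True h(1)[of j] by (simp add: field_simps power_mult_distrib)
        qed (simp add: R0)
      qed
    qed
  qed
  have "(\<lambda>j. integral\<^sup>L lborel F - real CARD('n) * M * h j * integral\<^sup>L lborel P)
      \<longlonglongrightarrow> integral\<^sup>L lborel F - real CARD('n) * M * 0 * integral\<^sup>L lborel P"
    by (intro tendsto_intros hlim)
  moreover have "(\<lambda>j. \<Sum>i\<in>UNIV. \<integral>x. R (h j) i x / (h j)\<^sup>2 \<partial>lborel)
      \<longlonglongrightarrow> (\<Sum>i\<in>UNIV. \<integral>x. w (\<sigma> x) * (cmod (pderivative i \<phi> x))\<^sup>2 \<partial>lborel)"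
    by (intro tendsto_sum lim)
  ultimately have "integral\<^sup>L lborel F - real CARD('n) * M * 0 * integral\<^sup>L lborel P
      \<le> (\<Sum>i\<in>UNIV. \<integral>x. w (\<sigma> x) * (cmod (pderivative i \<phi> x))\<^sup>2 \<partial>lborel)"
    by (rule LIMSEQ_le) (use ineq in blast)
  then show ?thesis by (simp add: F_def[abs_def])
qed

end

section \<open>The weighted Euclidean inequality for test functions\<close>

lemma nn_integral_lebesgue_on_compact_support:
  fixes f :: "'a :: euclidean_space \<Rightarrow> real"
  assumes "open \<Omega>" "compact K" "K \<subseteq> \<Omega>" "continuous_on K f" "\<And>x. x \<notin> K \<Longrightarrow> f x = 0" "\<And>x. 0 \<le> f x"
  shows "(\<integral>\<^sup>+x. ennreal (f x) \<partial>lebesgue_on \<Omega>) = ennreal (\<integral>x. f x \<partial>lborel)"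
proof -
  have "(\<integral>\<^sup>+x. ennreal (f x) \<partial>lebesgue_on \<Omega>) = (\<integral>\<^sup>+x. ennreal (f x) * indicator \<Omega> x \<partial>lebesgue)"
    using assms(1) by (intro nn_integral_restrict_space) (simp add: borel_open)
  also have "\<dots> = (\<integral>\<^sup>+x. ennreal (f x) \<partial>lborel)"
    unfolding nn_integral_completion
  proof (rule nn_integral_cong)
    show "ennreal (f x) * indicator \<Omega> x = ennreal (f x)" for x
      using assms(3) assms(5)[of x] by (cases "x \<in> K") (auto simp: indicator_def)
  qed
  also have "\<dots> = ennreal (\<integral>x. f x \<partial>lborel)"
    by (rule nn_integral_eq_integral[OF integrable_compact_support[OF assms(2,4,5)]]) (simp_all add: assms(6))
  finally show ?thesis .
qed

lemma integral_lebesgue_on_compact_support: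
  fixes f :: "'a :: euclidean_space \<Rightarrow> 'b :: {banach, second_countable_topology}"
  assumes "open \<Omega>" "compact K" "K \<subseteq> \<Omega>" "continuous_on K f" "\<And>x. x \<notin> K \<Longrightarrow> f x = 0"
  shows "(\<integral>x. f x \<partial>lebesgue_on \<Omega>) = (\<integral>x. f x \<partial>lborel)"
proof -
  have "(\<integral>x. f x \<partial>lebesgue_on \<Omega>) = (\<integral>x. indicator \<Omega> x *\<^sub>R f x \<partial>lebesgue)"
    using assms(1) by (intro integral_restrict_space) (simp add: borel_open)
  also have "(\<lambda>x. indicator \<Omega> x *\<^sub>R f x) = f"
  proof
    show "indicator \<Omega> x *\<^sub>R f x = f x" for x
      using assms(3) assms(5)[of x] by (cases "x \<in> K") (auto simp: indicator_def)
  qed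
  also have "(\<integral>x. f x \<partial>lebesgue) = (\<integral>x. f x \<partial>lborel)"
    using integrable_compact_support[OF assms(2,4,5)] by (intro integral_completion) auto
  finally show ?thesis .
qed

text \<open>The classical gradient of a test function; \<open>weak_gradient\<close> is a chosen
  representative and agrees with it only almost everywhere.\<close>

definition grad :: "(real ^ 'n \<Rightarrow> complex) \<Rightarrow> real ^ 'n \<Rightarrow> complex ^ 'n" where
  "grad \<phi> x = (\<chi> i. pderivative i \<phi> x)"

lemma norm_grad_square: "(norm (grad \<phi> x))\<^sup>2 = (\<Sum>i\<in>UNIV. (cmod (pderivative i \<phi> x))\<^sup>2)"
  by (simp add: grad_def norm_vec_def L2_set_def sum_nonneg)

lemma bdist_bounded:
  fixes \<Omega> :: "(real ^ 'n) set"
  assumes "bounded \<Omega>" "frontier \<Omega> \<noteq> {}"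
  shows "\<exists>B>0. \<forall>x\<in>\<Omega>. bdist \<Omega> x \<le> B"
proof -
  obtain p where p: "p \<in> frontier \<Omega>" using assms(2) by blast
  obtain B where B: "\<forall>x\<in>\<Omega>. dist p x \<le> B" using assms(1) unfolding bounded_any_center[of \<Omega> p] by blast
  have "bdist \<Omega> x \<le> max 1 B" if "x \<in> \<Omega>" for x
  proof -
    have "bdist \<Omega> x \<le> dist x p" unfolding bdist_def by (rule infdist_le[OF p])
    then show ?thesis using bspec[OF B that] by (simp add: dist_commute)
  qed
  then show ?thesis by (intro exI[of _ "max 1 B"]) auto
qed

lemma bdist_lipschitz: "\<bar>bdist \<Omega> x - bdist \<Omega> y\<bar> \<le> dist x y"
  unfolding bdist_def by (rule infdist_triangle_abs)

lemma continuous_on_bdist: "continuous_on S (bdist \<Omega>)"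
  unfolding bdist_def by (intro continuous_intros)

text \<open>The margin m in the ground state inequality depends on the support of \<phi>, but it
  does not survive in the conclusion of that inequality. The constant a comes from
  \<open>supersolution\<close>, fed only with data of \<Omega> and \<gamma>, so it serves all test
  functions.\<close>

lemma Hardy_test_functions:
  fixes \<Omega> :: "(real ^ 'n) set" and \<gamma> :: real
  defines "s \<equiv> (1 + (real CARD('n) - 2) * \<gamma>) / 2"
  assumes "open \<Omega>" "bounded \<Omega>" "C2_boundary \<Omega>" "frontier \<Omega> \<noteq> {}"
    and s: "0 < s" "s < 1"
  shows "\<exists>a\<ge>0. \<forall>\<phi>\<in>Cc_infinity \<Omega>.
    (\<integral>\<^sup>+x. ennreal (s\<^sup>2 * (cmod (\<phi> x))\<^sup>2 * bdist \<Omega> x powr ((2 - real CARD('n)) * \<gamma> - 2)) \<partial>lebesgue_on \<Omega>)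
    \<le> (\<integral>\<^sup>+x. ennreal ((norm (grad \<phi> x))\<^sup>2 * bdist \<Omega> x powr ((2 - real CARD('n)) * \<gamma>)) \<partial>lebesgue_on \<Omega>)
      + ennreal a * (\<integral>\<^sup>+x. ennreal ((cmod (\<phi> x))\<^sup>2 * bdist \<Omega> x powr (- (real CARD('n) * \<gamma>))) \<partial>lebesgue_on \<Omega>)"
proof -
  let ?N = "real CARD('n)"
  obtain R where R: "R > 0" and ext: "\<forall>y\<in>frontier \<Omega>. \<exists>z. dist y z = R \<and> ball z R \<inter> \<Omega> = {}"
    using uniform_exterior_ball[OF assms(3,4)] by blast
  obtain B where B: "B > 0" "\<And>x. x \<in> \<Omega> \<Longrightarrow> bdist \<Omega> x \<le> B"
    using bdist_bounded[OF assms(3,5)] by blast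
  \<comment> \<open>The extra 1 leaves room for \<sigma> \<le> D - m with m \<le> 1.\<close>
  define D where "D = B + 1"
  \<comment> \<open>The largest admissible k: it gives equality in the last condition of
    \<open>hardy_profile\<close>.\<close>
  define k where "k = s / (2 * (s + 1/2) * D powr (1/2))"
  have D: "D > 0" using B by (simp add: D_def)
  interpret hardy_profile s k D
  proof
    show "0 < k" using s D by (simp add: k_def)
    have "s / (2 * b * a) * a * b \<le> s / 2" if "a > 0" "b > 0" for a b :: real
      using that by simp
    from this[of "D powr (1/2)" "s + 1/2"] show "k * D powr (1/2) * (s + 1/2) \<le> s / 2"
      unfolding k_def using s D by simp
  qed (use s D in auto)
  define c where "c = 1 / (2 * R)"
  have c: "c \<ge> 0" using R by (simp add: c_def)
  obtain a where a: "a \<ge> 0" and super: "\<And>t. 0 < t \<and> t \<le> D \<Longrightarrow>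
    u t * (s\<^sup>2 * t powr (- 2 * s - 1) - a * t powr (- (?N * \<gamma>))) \<le> - g2 t - 2 * c * ?N * g1 t"
    using supersolution[of "2 * c * ?N" "?N * \<gamma>"] c by auto
  have e: "(2 - ?N) * \<gamma> - 2 = - 2 * s - 1" "(2 - ?N) * \<gamma> = 1 - 2 * s"
    by (simp_all add: s_def field_simps)
  have pos: "bdist \<Omega> x > 0" "bdist \<Omega> x \<le> D" if "x \<in> \<Omega>" for x
    using bdist_pos[OF assms(2,5) that] B(2)[OF that] by (auto simp: D_def)
  show ?thesis
  proof (intro exI[of _ a] conjI a ballI)
    fix \<phi> assume \<phi>: "\<phi> \<in> Cc_infinity \<Omega>"
    define K where "K = closure {x. \<phi> x \<noteq> 0}"
    have K: "compact K" "K \<subseteq> \<Omega>" unfolding K_def using Cc_infinityD(3,4)[OF \<phi>] .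
    have K0: "\<phi> x = 0" if "x \<notin> K" for x using that unfolding K_def by (rule Cc_infinityD(5)[OF \<phi>])
    have p0: "pderivative i \<phi> x = 0" if "x \<notin> K" for x i
      using that unfolding K_def by (rule pderivative_outside_support)
    have nzO: "x \<in> \<Omega>" if "\<phi> x \<noteq> 0" for x using K0 K(2) that by blast
    have "\<exists>m0>0. \<forall>x\<in>K. m0 \<le> bdist \<Omega> x"
    proof (cases "K = {}")
      case False
      obtain x0 where "x0 \<in> K" "\<And>x. x \<in> K \<Longrightarrow> bdist \<Omega> x0 \<le> bdist \<Omega> x"
        using continuous_attains_inf[OF K(1) False continuous_on_bdist[of K \<Omega>]] by blast
      then show ?thesis using pos(1) K(2) by blast
    qed (auto intro: exI[of _ 1])
    then obtain m0 where m0: "m0 > 0" "\<And>x. x \<in> K \<Longrightarrow> m0 \<le> bdist \<Omega> x" by blast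
    define m where "m = min 1 (m0 / 2)"
    have m: "m > 0" using m0 by (simp add: m_def)
    have main: "(\<integral>x. (cmod (\<phi> x))\<^sup>2 / u (bdist \<Omega> x) * (- g2 (bdist \<Omega> x) - 2 * c * ?N * g1 (bdist \<Omega> x)) \<partial>lborel)
      \<le> (\<Sum>i\<in>UNIV. \<integral>x. w (bdist \<Omega> x) * (cmod (pderivative i \<phi> x))\<^sup>2 \<partial>lborel)"
    proof (rule ground_state_inequality[OF \<phi> bdist_lipschitz m])
      fix x assume nz: "\<phi> x \<noteq> 0"
      then have xK: "x \<in> K" using K0 by blast
      show lo: "2 * m \<le> bdist \<Omega> x" using m0(2)[OF xK] by (simp add: m_def)
      show "bdist \<Omega> x \<le> D - m" using B(2)[OF nzO[OF nz]] by (simp add: m_def D_def)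
      obtain n where n: "norm n = 1" "\<And>v. x + v \<in> \<Omega> \<Longrightarrow> bdist \<Omega> (x + v) \<le> bdist \<Omega> x + n \<bullet> v + (norm v)\<^sup>2 / (2 * R)"
        using bdist_semiconcave[OF assms(2) R ext nzO[OF nz] assms(5)] by blast
      have "bdist \<Omega> (x + v) \<le> bdist \<Omega> x + n \<bullet> v + c * (norm v)\<^sup>2" if "norm v < 2 * m" for v
      proof -
        have "x + v \<in> ball x (bdist \<Omega> x)" using that lo by (simp add: dist_norm)
        then have "x + v \<in> \<Omega>" using ball_bdist_subset[OF nzO[OF nz]] by blast
        from n(2)[OF this] show ?thesis by (simp add: c_def)
      qed
      with n(1) show "\<exists>n. norm n = 1 \<and> (\<forall>v. norm v < 2 * m \<longrightarrow>
          bdist \<Omega> (x + v) \<le> bdist \<Omega> x + n \<bullet> v + c * (norm v)\<^sup>2)" by blast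
    qed (rule c)
    have bK: "0 < bdist \<Omega> x" "bdist \<Omega> x \<le> D" if "x \<in> K" for x using pos K(2) that by auto
    have cK: "continuous_on K (\<lambda>x. f (bdist \<Omega> x))" if "continuous_on {0<..} f" for f :: "real \<Rightarrow> real"
      by (rule continuous_on_compose2[OF that continuous_on_bdist]) (use bK in auto)
    have cp: "continuous_on {0<..} (\<lambda>t::real. t powr q)" for q
      by (intro continuous_intros continuous_on_powr) auto
    note [continuous_intros] = cK[OF cp] cK[OF continuous_u] cK[OF continuous_g1] cK[OF continuous_g2] cK[OF continuous_w]
      Cc_infinityD(1)[OF \<phi>] Cc_infinityD(1)[OF Cc_infinity_pderivative[OF \<phi>]]
    have unz: "u (bdist \<Omega> x) > 0" if "x \<in> K" for x using u_pos[OF bK[OF that]] .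
    define f1 where "f1 x = s\<^sup>2 * (cmod (\<phi> x))\<^sup>2 * bdist \<Omega> x powr ((2 - ?N) * \<gamma> - 2)" for x
    define f2 where "f2 x = (norm (grad \<phi> x))\<^sup>2 * bdist \<Omega> x powr ((2 - ?N) * \<gamma>)" for x
    define f3 where "f3 x = (cmod (\<phi> x))\<^sup>2 * bdist \<Omega> x powr (- (?N * \<gamma>))" for x
    define f0 where "f0 x = (cmod (\<phi> x))\<^sup>2 / u (bdist \<Omega> x) * (- g2 (bdist \<Omega> x) - 2 * c * ?N * g1 (bdist \<Omega> x))" for x
    have cont: "continuous_on K f1" "continuous_on K f2" "continuous_on K f3" "continuous_on K f0"
      unfolding f1_def f2_def f3_def f0_def norm_grad_square
      by (intro continuous_intros; use unz in force)+
    have zero: "f1 x = 0" "f2 x = 0" "f3 x = 0" "f0 x = 0" if "x \<notin> K" for x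
      using K0[OF that] p0[OF that] by (simp_all add: f1_def f2_def f3_def f0_def norm_grad_square)
    have int: "integrable lborel f1" "integrable lborel f2" "integrable lborel f3" "integrable lborel f0"
      by (rule integrable_compact_support[OF K(1) cont(1) zero(1)], assumption)
         (rule integrable_compact_support[OF K(1) cont(2) zero(2)], assumption,
          rule integrable_compact_support[OF K(1) cont(3) zero(3)], assumption,
          rule integrable_compact_support[OF K(1) cont(4) zero(4)], assumption)
    have "f1 x - a * f3 x \<le> f0 x" for x
    proof (cases "x \<in> K")
      case True
      let ?t = "bdist \<Omega> x"
      have "f1 x - a * f3 x = (cmod (\<phi> x))\<^sup>2 / u ?t * (u ?t * (s\<^sup>2 * ?t powr (- 2 * s - 1) - a * ?t powr (- (?N * \<gamma>))))"
        using unz[OF True] unfolding f1_def f3_def e(1) by (simp add: field_simps)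
      also have "\<dots> \<le> f0 x" unfolding f0_def
        using unz[OF True] bK[OF True] by (intro mult_left_mono super) auto
      finally show ?thesis .
    qed (simp add: zero)
    then have "(\<integral>x. f1 x - a * f3 x \<partial>lborel) \<le> (\<integral>x. f0 x \<partial>lborel)"
      using int by (intro integral_mono) auto
    also have "\<dots> \<le> (\<Sum>i\<in>UNIV. \<integral>x. w (bdist \<Omega> x) * (cmod (pderivative i \<phi> x))\<^sup>2 \<partial>lborel)"
      using main unfolding f0_def .
    also have "\<dots> = (\<integral>x. f2 x \<partial>lborel)"
    proof -
      have ci: "continuous_on K (\<lambda>x. w (bdist \<Omega> x) * (cmod (pderivative i \<phi> x))\<^sup>2)" for i
        by (intro continuous_intros)
      have "integrable lborel (\<lambda>x. w (bdist \<Omega> x) * (cmod (pderivative i \<phi> x))\<^sup>2)" for i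
        by (rule integrable_compact_support[OF K(1) ci]) (simp add: p0)
      then have "(\<Sum>i\<in>UNIV. \<integral>x. w (bdist \<Omega> x) * (cmod (pderivative i \<phi> x))\<^sup>2 \<partial>lborel)
          = (\<integral>x. (\<Sum>i\<in>UNIV. w (bdist \<Omega> x) * (cmod (pderivative i \<phi> x))\<^sup>2) \<partial>lborel)"
        by (intro Bochner_Integration.integral_sum[symmetric])
      then show ?thesis
        by (simp only: f2_def norm_grad_square w_def e(2) sum_distrib_right mult.commute[of "_ powr _"])
    qed
    finally have real: "(\<integral>x. f1 x \<partial>lborel) \<le> (\<integral>x. f2 x \<partial>lborel) + a * (\<integral>x. f3 x \<partial>lborel)"
      using int by (simp add: Bochner_Integration.integral_diff)
    have nn: "(\<integral>\<^sup>+x. ennreal (f x) \<partial>lebesgue_on \<Omega>) = ennreal (\<integral>x. f x \<partial>lborel)"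
      if "continuous_on K f" "\<And>x. x \<notin> K \<Longrightarrow> f x = 0" "\<And>x. 0 \<le> f x" for f
      by (rule nn_integral_lebesgue_on_compact_support[OF assms(2) K that])
    have nonneg: "0 \<le> f1 x" "0 \<le> f2 x" "0 \<le> f3 x" for x by (simp_all add: f1_def f2_def f3_def)
    have N: "(\<integral>\<^sup>+x. ennreal (f1 x) \<partial>lebesgue_on \<Omega>) = ennreal (\<integral>x. f1 x \<partial>lborel)"
       "(\<integral>\<^sup>+x. ennreal (f2 x) \<partial>lebesgue_on \<Omega>) = ennreal (\<integral>x. f2 x \<partial>lborel)"
       "(\<integral>\<^sup>+x. ennreal (f3 x) \<partial>lebesgue_on \<Omega>) = ennreal (\<integral>x. f3 x \<partial>lborel)"
      by (rule nn[OF cont(1) zero(1) nonneg(1)], assumption)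
         (rule nn[OF cont(2) zero(2) nonneg(2)], assumption,
          rule nn[OF cont(3) zero(3) nonneg(3)], assumption)
    have I: "0 \<le> (\<integral>x. f2 x \<partial>lborel)" "0 \<le> (\<integral>x. f3 x \<partial>lborel)"
      by (rule integral_nonneg_AE, simp add: nonneg)+
    have "(\<integral>\<^sup>+x. ennreal (f1 x) \<partial>lebesgue_on \<Omega>) \<le> (\<integral>\<^sup>+x. ennreal (f2 x) \<partial>lebesgue_on \<Omega>)
        + ennreal a * (\<integral>\<^sup>+x. ennreal (f3 x) \<partial>lebesgue_on \<Omega>)"
      unfolding N using real I a by (simp add: ennreal_mult[symmetric] ennreal_plus[symmetric] ennreal_leI del: ennreal_plus)
    then show "(\<integral>\<^sup>+x. ennreal (s\<^sup>2 * (cmod (\<phi> x))\<^sup>2 * bdist \<Omega> x powr ((2 - ?N) * \<gamma> - 2)) \<partial>lebesgue_on \<Omega>)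
      \<le> (\<integral>\<^sup>+x. ennreal ((norm (grad \<phi> x))\<^sup>2 * bdist \<Omega> x powr ((2 - ?N) * \<gamma>)) \<partial>lebesgue_on \<Omega>)
        + ennreal a * (\<integral>\<^sup>+x. ennreal ((cmod (\<phi> x))\<^sup>2 * bdist \<Omega> x powr (- (?N * \<gamma>))) \<partial>lebesgue_on \<Omega>)"
      unfolding f1_def f2_def f3_def .
  qed
qed

section \<open>Smooth bumps and the fundamental lemma\<close>

text \<open>Allowing a polynomial factor P(1/t) makes the standard flat functions a family closed
  under differentiation: the derivative replaces P by X^2 (P - P'). A single differentiability
  statement then yields smoothness of all orders.\<close>

definition expo :: "real poly \<Rightarrow> real \<Rightarrow> real" where
  "expo P t = (if t > 0 then poly P (1 / t) * exp (- (1 / t)) else 0)"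

lemma poly_div_exp_tendsto_0: "((\<lambda>y. poly Q y / exp y) \<longlongrightarrow> (0::real)) at_top"
proof -
  have "((\<lambda>y. \<Sum>i\<le>degree Q. coeff Q i * (y ^ i / exp y)) \<longlongrightarrow> 0) at_top"
    by (intro tendsto_null_sum tendsto_mult_right_zero tendsto_power_div_exp_0)
  then show ?thesis by (simp add: poly_altdef sum_divide_distrib)
qed

text \<open>Only t = 0 is delicate: with y = 1/h the right difference quotient is (X P)(y) / exp y,
  which tends to 0, and the left one vanishes.\<close>

lemma expo_deriv: "(expo P has_real_derivative expo ([:0, 0, 1:] * (P - pderiv P)) t) (at t)"
proof (cases t "0::real" rule: linorder_cases)
  case less
  have "(expo P has_real_derivative 0) (at t)"
    by (rule has_field_derivative_transform_within_open[where S = "{..<0}" and f = "\<lambda>_. 0"])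
       (use less in \<open>auto simp: expo_def\<close>)
  then show ?thesis using less by (simp add: expo_def)
next
  case greater
  have "((\<lambda>t. poly P (1 / t) * exp (- (1 / t))) has_real_derivative expo ([:0, 0, 1:] * (P - pderiv P)) t) (at t)"
    using greater
    by (auto intro!: derivative_eq_intros DERIV_chain2[OF poly_DERIV] simp: expo_def field_simps power2_eq_square)
  then show ?thesis
    by (rule has_field_derivative_transform_within_open[where S = "{0<..}"])
       (use greater in \<open>auto simp: expo_def\<close>)
next
  case equal
  have "((\<lambda>h. expo P h / h) \<longlongrightarrow> 0) (at_right 0)"
  proof (rule Lim_transform_eventually)
    show "((\<lambda>h. poly ([:0, 1:] * P) (inverse h) / exp (inverse h)) \<longlongrightarrow> (0::real)) (at_right 0)"
      by (rule filterlim_compose[OF poly_div_exp_tendsto_0 filterlim_inverse_at_top_right])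
    show "\<forall>\<^sub>F h in at_right 0. poly ([:0, 1:] * P) (inverse h) / exp (inverse h) = expo P h / h"
      by (auto simp: eventually_at_filter expo_def exp_minus divide_inverse mult_ac)
  qed
  moreover have "((\<lambda>h. expo P h / h) \<longlongrightarrow> 0) (at_left 0)"
    by (rule Lim_transform_eventually[OF tendsto_const]) (auto simp: eventually_at_filter expo_def)
  ultimately have "((\<lambda>h. expo P h / h) \<longlongrightarrow> 0) (at 0)" by (simp add: filterlim_split_at)
  then show ?thesis using equal by (simp add: DERIV_def expo_def)
qed

text \<open>This class is closed under partial derivatives, hence consists of smooth functions.\<close>

inductive elementary_smooth :: "(real ^ 'n \<Rightarrow> real) \<Rightarrow> bool" where
  es_expo: "elementary_smooth (\<lambda>x. expo P (c * x $ i + d))"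
| es_const: "elementary_smooth (\<lambda>x. c)"
| es_add: "elementary_smooth f \<Longrightarrow> elementary_smooth g \<Longrightarrow> elementary_smooth (\<lambda>x. f x + g x)"
| es_mult: "elementary_smooth f \<Longrightarrow> elementary_smooth g \<Longrightarrow> elementary_smooth (\<lambda>x. f x * g x)"

lemma elementary_smooth_prod:
  "finite I \<Longrightarrow> (\<And>i. i \<in> I \<Longrightarrow> elementary_smooth (f i)) \<Longrightarrow> elementary_smooth (\<lambda>x. \<Prod>i\<in>I. f i x)"
  by (induction I rule: finite_induct) (auto intro: es_const es_mult)

lemma elementary_smooth_derivative:
  "elementary_smooth f \<Longrightarrow> \<exists>f'. (\<forall>x. (f has_derivative (\<lambda>h. \<Sum>i\<in>UNIV. h $ i * f' i x)) (at x)) \<and>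
    (\<forall>i. elementary_smooth (f' i))"
proof (induction rule: elementary_smooth.induct)
  case (es_expo P c i d)
  let ?Q = "[:0, 0, 1:] * (P - pderiv P)"
  let ?f' = "\<lambda>j x. if j = i then c * expo ?Q (c * x $ i + d) else 0"
  have "((\<lambda>x. expo P (c * x $ i + d)) has_derivative (\<lambda>h. \<Sum>j\<in>UNIV. h $ j * ?f' j x)) (at x)" for x :: "real ^ 'a"
  proof -
    have "((\<lambda>x. c * x $ i + d) has_derivative (\<lambda>h. c * h $ i)) (at x)"
      by (auto intro!: derivative_eq_intros bounded_linear_imp_has_derivative bounded_linear_vec_nth)
    from has_derivative_compose[OF this expo_deriv[unfolded has_field_derivative_def]]
    show ?thesis by (simp add: if_distrib[of "\<lambda>a. _ * a"] mult_ac cong: if_cong)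
  qed
  moreover have "elementary_smooth (?f' j)" for j
    by (cases "j = i") (auto intro: elementary_smooth.intros)
  ultimately show ?case by (intro exI[of _ ?f']) auto
next
  case (es_const c)
  then show ?case by (intro exI[of _ "\<lambda>_ _. 0"]) (auto intro: elementary_smooth.intros)
next
  case (es_add f g)
  then obtain f' g' where f': "\<forall>x. (f has_derivative (\<lambda>h. \<Sum>i\<in>UNIV. h $ i * f' i x)) (at x)" "\<forall>i. elementary_smooth (f' i)"
    and g': "\<forall>x. (g has_derivative (\<lambda>h. \<Sum>i\<in>UNIV. h $ i * g' i x)) (at x)" "\<forall>i. elementary_smooth (g' i)" by blast
  have "((\<lambda>x. f x + g x) has_derivative (\<lambda>h. \<Sum>i\<in>UNIV. h $ i * (f' i x + g' i x))) (at x)" for x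
    using has_derivative_add[OF f'(1)[rule_format, of x] g'(1)[rule_format, of x]]
    by (simp add: distrib_left sum.distrib)
  then show ?case using f'(2) g'(2)
    by (intro exI[of _ "\<lambda>i x. f' i x + g' i x"]) (auto intro: elementary_smooth.intros)
next
  case (es_mult f g)
  then obtain f' g' where f': "\<forall>x. (f has_derivative (\<lambda>h. \<Sum>i\<in>UNIV. h $ i * f' i x)) (at x)" "\<forall>i. elementary_smooth (f' i)"
    and g': "\<forall>x. (g has_derivative (\<lambda>h. \<Sum>i\<in>UNIV. h $ i * g' i x)) (at x)" "\<forall>i. elementary_smooth (g' i)" by blast
  have "((\<lambda>x. f x * g x) has_derivative (\<lambda>h. \<Sum>i\<in>UNIV. h $ i * (f x * g' i x + f' i x * g x))) (at x)" for x
    using has_derivative_mult[OF f'(1)[rule_format, of x] g'(1)[rule_format, of x]]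
    by (simp add: distrib_left sum.distrib sum_distrib_left sum_distrib_right mult_ac)
  moreover have "elementary_smooth (\<lambda>x. f x * g' i x + f' i x * g x)" for i
    using f'(2) g'(2) es_mult(1,2) by (intro elementary_smooth.es_add elementary_smooth.es_mult) auto
  ultimately show ?case by (intro exI[of _ "\<lambda>i x. f x * g' i x + f' i x * g x"]) auto
qed

lemma elementary_smooth_Ck:
  assumes "elementary_smooth f"
  shows "Ck_on k (\<lambda>x. complex_of_real (f x)) UNIV"
  using assms
proof (induction k arbitrary: f)
  case 0
  obtain f' where "\<forall>x. (f has_derivative (\<lambda>h. \<Sum>i\<in>UNIV. h $ i * f' i x)) (at x)"
    using elementary_smooth_derivative[OF 0] by blast
  then have "continuous_on UNIV f"
    using has_derivative_continuous continuous_at_imp_continuous_on by blast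
  then show ?case by (auto intro!: continuous_intros)
next
  case (Suc k)
  obtain f' where f': "\<forall>x. (f has_derivative (\<lambda>h. \<Sum>i\<in>UNIV. h $ i * f' i x)) (at x)" "\<forall>i. elementary_smooth (f' i)"
    using elementary_smooth_derivative[OF Suc.prems] by blast
  have der: "((\<lambda>x. complex_of_real (f x)) has_derivative (\<lambda>h. of_real (\<Sum>i\<in>UNIV. h $ i * f' i x))) (at x)" for x
    using f'(1) by (intro has_derivative_of_real) blast
  have "pderivative i (\<lambda>x. complex_of_real (f x)) = (\<lambda>x. complex_of_real (f' i x))" for i
  proof
    fix x
    show "pderivative i (\<lambda>x. complex_of_real (f x)) x = complex_of_real (f' i x)"
      using pderivative_eqI[OF der, of i x]
      by (simp add: axis_def if_distrib[of "\<lambda>a. a * _"] cong: if_cong)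
  qed
  moreover have "(\<lambda>x. complex_of_real (f x)) differentiable (at x)" for x
    using der by (auto simp: differentiable_def)
  ultimately show ?case using Suc.IH f'(2) by simp
qed

text \<open>As k grows, \<open>expo 1 (k * t)\<close> = exp(-1/(k t)) tends to 1 for t > 0, so these
  products approach the indicator of the open box from below. The arguments are written in the
  affine form demanded by \<open>es_expo\<close>.\<close>

definition bump :: "real ^ 'n \<Rightarrow> real ^ 'n \<Rightarrow> real \<Rightarrow> real ^ 'n \<Rightarrow> real" where
  "bump c d k x = (\<Prod>i\<in>UNIV. expo 1 (k * x $ i + (- k * c $ i)) * expo 1 (- k * x $ i + k * d $ i))"

lemma expo_1_bounds: "0 \<le> expo 1 t" "expo 1 t \<le> 1"
  by (auto simp: expo_def)

lemma bump_bounds: "0 \<le> bump c d k x" "bump c d k x \<le> 1"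
  unfolding bump_def using expo_1_bounds
  by (auto intro!: prod_nonneg prod_le_1 mult_nonneg_nonneg mult_le_one)

lemma bump_outside:
  assumes "k > 0" "x \<notin> box c d" shows "bump c d k x = 0"
proof -
  obtain i where i: "\<not> (c $ i < x $ i \<and> x $ i < d $ i)"
    using assms(2) by (auto simp: mem_box_cart)
  have "expo 1 (k * x $ i + (- k * c $ i)) * expo 1 (- k * x $ i + k * d $ i) = 0"
  proof (cases "c $ i < x $ i")
    case True
    then have "k * d $ i \<le> k * x $ i" using i assms(1) by simp
    then show ?thesis by (simp add: expo_def)
  next
    case False
    then have "k * x $ i \<le> k * c $ i" using assms(1) by simp
    then show ?thesis by (simp add: expo_def)
  qed
  then show ?thesis unfolding bump_def by (intro prod_zero) auto
qed

lemma bump_Cc_infinity: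
  assumes "k > 0" "cbox c d \<subseteq> \<Omega>"
  shows "(\<lambda>x. complex_of_real (bump c d k x)) \<in> Cc_infinity \<Omega>"
proof -
  have "elementary_smooth (bump c d k)" unfolding bump_def[abs_def]
    by (intro elementary_smooth_prod es_mult es_expo) auto
  then have "Ck_on j (\<lambda>x. complex_of_real (bump c d k x)) UNIV" for j by (rule elementary_smooth_Ck)
  moreover have sub: "closure {x. complex_of_real (bump c d k x) \<noteq> 0} \<subseteq> cbox c d"
    using bump_outside[OF assms(1), of _ c d] box_subset_cbox[of c d] by (intro closure_minimal) auto
  moreover have "compact (closure {x. complex_of_real (bump c d k x) \<noteq> 0})"
    using compact_Int_closed[OF compact_cbox[of c d], of "closure {x. complex_of_real (bump c d k x) \<noteq> 0}"] sub
    by (simp add: Int_absorb1)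
  ultimately show ?thesis using assms(2) by (auto simp: Cc_infinity_def)
qed

lemma expo_1_scaled_tendsto:
  assumes "t > 0" shows "(\<lambda>j. expo 1 (real (Suc j) * t)) \<longlonglongrightarrow> 1"
proof -
  have "(\<lambda>j. exp (- ((1 / t) / real (Suc j)))) \<longlonglongrightarrow> exp (- 0)"
    by (intro tendsto_exp tendsto_minus LIMSEQ_Suc[OF lim_const_over_n])
  moreover have "exp (- ((1 / t) / real (Suc j))) = expo 1 (real (Suc j) * t)" for j
    using assms by (simp add: expo_def mult.commute)
  ultimately show ?thesis by simp
qed

lemma bump_tendsto_indicator: "(\<lambda>j. bump c d (real (Suc j)) x) \<longlonglongrightarrow> indicator (box c d) x"
proof (cases "x \<in> box c d")
  case True
  have "(\<lambda>j. \<Prod>i\<in>UNIV. expo 1 (real (Suc j) * (x $ i - c $ i)) * expo 1 (real (Suc j) * (d $ i - x $ i)))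
      \<longlonglongrightarrow> (\<Prod>i\<in>(UNIV :: 'a set). 1 * 1)"
    using True by (intro tendsto_prod tendsto_mult expo_1_scaled_tendsto) (auto simp: mem_box_cart)
  moreover have "bump c d (real (Suc j)) x =
      (\<Prod>i\<in>UNIV. expo 1 (real (Suc j) * (x $ i - c $ i)) * expo 1 (real (Suc j) * (d $ i - x $ i)))" for j
    unfolding bump_def by (simp add: algebra_simps)
  ultimately show ?thesis using True by simp
next
  case False
  then show ?thesis by (simp add: bump_outside)
qed

section \<open>Functions with vanishing integrals over boxes\<close>

text \<open>\<open>ennreal\<close> cuts off negative values, so the two densities are the positive
  and the negative part of r. The resulting measures agree on open boxes, an intersection-stable
  generator, hence everywhere; uniqueness of densities makes the two parts equal and therefore
  zero.\<close>

lemma AE_zero_of_box_integrals: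
  fixes r :: "'a :: euclidean_space \<Rightarrow> real"
  assumes r: "integrable lborel r" and z: "\<And>c d. (\<integral>x. indicator (box c d) x * r x \<partial>lborel) = 0"
  shows "AE x in lborel. r x = 0"
proof -
  let ?M = "density lborel (\<lambda>x. ennreal (r x))" and ?N = "density lborel (\<lambda>x. ennreal (- r x))"
  have m [measurable]: "r \<in> borel_measurable borel" using borel_measurable_integrable[OF r] by simp
  have ei: "emeasure ?M (box c d) = (\<integral>\<^sup>+x. ennreal (indicator (box c d) x * r x) \<partial>lborel)"
    "emeasure ?N (box c d) = (\<integral>\<^sup>+x. ennreal (- (indicator (box c d) x * r x)) \<partial>lborel)" for c d :: 'a
    by (subst emeasure_density, simp, simp, intro nn_integral_cong, simp add: indicator_def)+
  have fin: "(\<integral>\<^sup>+x. ennreal (indicator (box c d) x * r x) \<partial>lborel) < \<infinity>"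
    "(\<integral>\<^sup>+x. ennreal (- (indicator (box c d) x * r x)) \<partial>lborel) < \<infinity>"
    and ib: "integrable lborel (\<lambda>x. indicator (box c d) x * r x)" for c d :: 'a
  proof -
    show ib: "integrable lborel (\<lambda>x. indicator (box c d) x * r x)"
      using integrable_mult_indicator[OF _ r, of "box c d"] by simp
    show "(\<integral>\<^sup>+x. ennreal (indicator (box c d) x * r x) \<partial>lborel) < \<infinity>"
      "(\<integral>\<^sup>+x. ennreal (- (indicator (box c d) x * r x)) \<partial>lborel) < \<infinity>"
      using real_integrable_def[THEN iffD1, OF ib] by (auto simp: top.not_eq_extremum)
  qed
  have eq: "emeasure ?M (box c d) = emeasure ?N (box c d)" for c d :: 'a
  proof -
    have "enn2real (\<integral>\<^sup>+x. ennreal (indicator (box c d) x * r x) \<partial>lborel)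
        = enn2real (\<integral>\<^sup>+x. ennreal (- (indicator (box c d) x * r x)) \<partial>lborel)"
      using z[of c d] real_lebesgue_integral_def[OF ib[of c d]] by simp
    then show ?thesis using fin[of c d] unfolding ei
      by (metis ennreal_enn2real infinity_ennreal_def)
  qed
  have "?M = ?N"
  proof (rule measure_eqI_generator_eq[where E = "range (\<lambda>(a, b). box a b :: 'a set)" and \<Omega> = UNIV
        and A = "\<lambda>i::nat. box (- (real i *\<^sub>R One)) (real i *\<^sub>R One)"])
    show "Int_stable (range (\<lambda>(a, b). box a b :: 'a set))"
      by (auto simp: Int_stable_def box_Int_box)
    show "sets ?M = sigma_sets UNIV (range (\<lambda>(a, b). box a b))" "sets ?N = sigma_sets UNIV (range (\<lambda>(a, b). box a b))"
      by (simp_all add: borel_eq_box)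
    show "emeasure ?M (box (- (real i *\<^sub>R One)) (real i *\<^sub>R One)) \<noteq> \<infinity>" for i
      unfolding ei using fin(1)[of "- (real i *\<^sub>R One)" "real i *\<^sub>R One"] by simp
  qed (auto simp: eq UN_box_eq_UNIV)
  then have "AE x in lborel. ennreal (r x) = ennreal (- r x)"
    by (subst (asm) sigma_finite_measure.density_unique_iff[OF sigma_finite_lborel]) auto
  then show ?thesis
    by eventually_elim (smt (verit) ennreal_eq_0_iff ennreal_neg)
qed

lemma AE_zero_of_box_integrals_lebesgue:
  fixes r :: "'a :: euclidean_space \<Rightarrow> real"
  assumes r: "integrable lebesgue r" and z: "\<And>c d. (\<integral>x. indicator (box c d) x * r x \<partial>lebesgue) = 0"
  shows "AE x in lebesgue. r x = 0"
proof -
  have rm: "r \<in> borel_measurable lebesgue" using r by auto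
  obtain r' where m: "r' \<in> borel_measurable lborel" and eq: "AE x in lborel. r x = r' x"
    using completion_ex_borel_measurable_real[OF rm] by blast
  have eqL: "AE x in lebesgue. r x = r' x" by (rule AE_completion[OF eq])
  have "integrable lebesgue r'"
    using integrable_cong_AE[OF rm measurable_completion[OF m] eqL] r by simp
  then have "integrable lborel r'" using integrable_completion[OF m] by simp
  moreover have "(\<integral>x. indicator (box c d) x * r' x \<partial>lborel) = 0" for c d
  proof -
    have m': "(\<lambda>x. indicator (box c d) x * r' x) \<in> borel_measurable lborel" using m by simp
    have "(\<integral>x. indicator (box c d) x * r' x \<partial>lborel) = (\<integral>x. indicator (box c d) x * r' x \<partial>lebesgue)"
      by (rule integral_completion[symmetric, OF m'])
    also have "\<dots> = (\<integral>x. indicator (box c d) x * r x \<partial>lebesgue)"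
    proof (rule integral_cong_AE)
      show "(\<lambda>x. indicator (box c d) x * r' x) \<in> borel_measurable lebesgue" by (rule measurable_completion[OF m'])
      have "box c d \<in> sets lebesgue" by (simp add: borel_open)
      then show "(\<lambda>x. indicator (box c d) x * r x) \<in> borel_measurable lebesgue"
        using rm by (intro borel_measurable_times borel_measurable_indicator)
      show "AE x in lebesgue. indicator (box c d) x * r' x = indicator (box c d) x * r x"
        using eqL by eventually_elim simp
    qed
    finally show ?thesis using z by simp
  qed
  ultimately have "AE x in lborel. r' x = 0" by (rule AE_zero_of_box_integrals)
  then have "AE x in lebesgue. r' x = 0" by (rule AE_completion)
  with eqL show ?thesis by eventually_elim simp
qed

lemma locally_integrable_indicator:
  fixes f :: "real ^ 'n \<Rightarrow> 'b :: {banach, second_countable_topology}"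
  assumes "locally_integrable_on \<Omega> f" "compact K" "K \<subseteq> \<Omega>"
  shows "integrable lebesgue (\<lambda>x. indicator K x *\<^sub>R f x)"
  using assms unfolding locally_integrable_on_def
  by (subst integrable_restrict_space[symmetric]) (auto simp: borel_closed compact_imp_closed)

text \<open>Bumps of increasing steepness are test functions and tend to the indicator of the open
  box. The closed box inside \<Omega> supplies the integrable majorant that local integrability of h
  alone provides.\<close>

lemma box_integral_zero:
  fixes h :: "real ^ 'n \<Rightarrow> complex"
  assumes "open \<Omega>" and li: "locally_integrable_on \<Omega> h"
    and z: "\<And>\<phi>. \<phi> \<in> Cc_infinity \<Omega> \<Longrightarrow> (\<integral>x. h x * \<phi> x \<partial>lebesgue_on \<Omega>) = 0"
    and cd: "cbox c d \<subseteq> \<Omega>"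
  shows "(\<integral>x. indicator (box c d) x *\<^sub>R h x \<partial>lebesgue) = 0"
proof -
  have i: "integrable lebesgue (\<lambda>x. indicator (cbox c d) x *\<^sub>R h x)"
    by (rule locally_integrable_indicator[OF li compact_cbox cd])
  define b where "b j x = (indicator (cbox c d) x *\<^sub>R h x) * complex_of_real (bump c d (real (Suc j)) x)" for j x
  have bm: "(\<lambda>x. complex_of_real (bump c d (real (Suc j)) x)) \<in> borel_measurable lebesgue" for j
  proof -
    have "continuous_on UNIV (\<lambda>x. complex_of_real (bump c d (real (Suc j)) x))"
      by (rule Cc_infinityD(1)[OF bump_Cc_infinity[OF _ cd]]) simp
    then show ?thesis by (intro measurable_completion) (simp add: borel_measurable_continuous_onI)
  qed
  have hm: "(\<lambda>x. indicator (cbox c d) x *\<^sub>R h x) \<in> borel_measurable lebesgue" using i by auto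
  have bj: "(\<integral>x. b j x \<partial>lebesgue) = 0" for j
  proof -
    have "(\<integral>x. h x * complex_of_real (bump c d (real (Suc j)) x) \<partial>lebesgue_on \<Omega>) = 0"
      by (intro z bump_Cc_infinity cd) simp
    then have "(\<integral>x. indicator \<Omega> x *\<^sub>R (h x * complex_of_real (bump c d (real (Suc j)) x)) \<partial>lebesgue) = 0"
      using assms(1) by (subst (asm) integral_restrict_space) (auto simp: borel_open)
    moreover have "indicator \<Omega> x *\<^sub>R (h x * complex_of_real (bump c d (real (Suc j)) x)) = b j x" for x
      using cd bump_outside[of "real (Suc j)" x c d] box_subset_cbox[of c d]
      unfolding b_def by (cases "x \<in> box c d") (auto simp: indicator_def)
    ultimately show ?thesis by simp
  qed
  have "(\<lambda>j. \<integral>x. b j x \<partial>lebesgue) \<longlonglongrightarrow> (\<integral>x. indicator (box c d) x *\<^sub>R h x \<partial>lebesgue)"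
  proof (rule integral_dominated_convergence[where w = "\<lambda>x. norm (indicator (cbox c d) x *\<^sub>R h x)"])
    show "(\<lambda>x. indicator (box c d) x *\<^sub>R h x) \<in> borel_measurable lebesgue"
    proof -
      have "(\<lambda>x. indicator (box c d) x *\<^sub>R (indicator (cbox c d) x *\<^sub>R h x)) \<in> borel_measurable lebesgue"
        by (intro borel_measurable_scaleR borel_measurable_indicator hm) (simp add: borel_open)
      moreover have "indicator (box c d) x *\<^sub>R (indicator (cbox c d) x *\<^sub>R h x) = indicator (box c d) x *\<^sub>R h x" for x
        using box_subset_cbox[of c d] by (auto simp: indicator_def)
      ultimately show ?thesis by (simp only:)
    qed
    show "b j \<in> borel_measurable lebesgue" for j
      unfolding b_def[abs_def] by (intro borel_measurable_times hm bm)
    show "integrable lebesgue (\<lambda>x. norm (indicator (cbox c d) x *\<^sub>R h x))"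
      by (rule integrable_norm[OF i])
    show "AE x in lebesgue. (\<lambda>j. b j x) \<longlonglongrightarrow> indicator (box c d) x *\<^sub>R h x"
    proof (rule AE_I2)
      fix x
      have "(\<lambda>j. b j x) \<longlonglongrightarrow> (indicator (cbox c d) x *\<^sub>R h x) * complex_of_real (indicator (box c d) x)"
        unfolding b_def by (intro tendsto_mult tendsto_const tendsto_of_real bump_tendsto_indicator)
      moreover have "(indicator (cbox c d) x *\<^sub>R h x) * complex_of_real (indicator (box c d) x) = indicator (box c d) x *\<^sub>R h x"
        using box_subset_cbox[of c d] by (auto simp: indicator_def)
      ultimately show "(\<lambda>j. b j x) \<longlonglongrightarrow> indicator (box c d) x *\<^sub>R h x" by simp
    qed
    show "AE x in lebesgue. norm (b j x) \<le> norm (indicator (cbox c d) x *\<^sub>R h x)" for j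
      using bump_bounds[of c d "real (Suc j)"] unfolding b_def norm_mult
      by (intro AE_I2 mult_right_le_one_le) auto
  qed
  then show ?thesis unfolding bj by (simp add: LIMSEQ_const_iff)
qed

text \<open>An open set is a countable union of closed boxes, so it suffices to treat each of them;
  there h can be cut off to a function integrable on the whole space, whose real and imaginary parts
  have vanishing box integrals.\<close>

lemma fundamental_lemma:
  fixes h :: "real ^ 'n \<Rightarrow> complex"
  assumes "open \<Omega>" and li: "locally_integrable_on \<Omega> h"
    and z: "\<And>\<phi>. \<phi> \<in> Cc_infinity \<Omega> \<Longrightarrow> (\<integral>x. h x * \<phi> x \<partial>lebesgue_on \<Omega>) = 0"
  shows "AE x in lebesgue_on \<Omega>. h x = 0"
proof -
  have local: "AE x in lebesgue. x \<in> cbox a b \<longrightarrow> h x = 0" if ab: "cbox a b \<subseteq> \<Omega>" for a b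
  proof -
    \<comment> \<open>The cut-off uses the open box because intersections of open boxes are again
      open boxes; the missing boundary is a null set.\<close>
    define H where "H x = indicator (box a b) x *\<^sub>R h x" for x
    have i: "integrable lebesgue H"
    proof -
      have "integrable lebesgue (\<lambda>x. indicator (cbox a b) x *\<^sub>R h x)"
        by (rule locally_integrable_indicator[OF li compact_cbox ab])
      from integrable_mult_indicator[OF _ this, of "box a b"]
      have "integrable lebesgue (\<lambda>x. indicator (box a b) x *\<^sub>R (indicator (cbox a b) x *\<^sub>R h x))"
        by (simp add: borel_open)
      moreover have "indicator (box a b) x *\<^sub>R (indicator (cbox a b) x *\<^sub>R h x) = H x" for x
        using box_subset_cbox[of a b] by (auto simp: indicator_def H_def)
      ultimately show ?thesis by simp
    qed
    have box0: "(\<integral>x. indicator (box c d) x *\<^sub>R H x \<partial>lebesgue) = 0" for c d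
    proof -
      obtain e f where ef: "box c d \<inter> box a b = box e f" using box_Int_box by blast
      have eq: "indicator (box c d) x *\<^sub>R H x = indicator (box e f) x *\<^sub>R h x" for x
        unfolding H_def ef[symmetric] by (auto simp: indicator_def)
      show ?thesis
      \<comment> \<open>If \<open>box e f\<close> is empty, nothing confines \<open>cbox e f\<close>
        to \<Omega>; otherwise it is the closure of the open box.\<close>
      proof (cases "box e f = {}")
        case True then show ?thesis unfolding eq by simp
      next
        case False
        have "cbox e f = closure (box e f)" using closure_box[OF False] by simp
        also have "\<dots> \<subseteq> cbox a b" using ef box_subset_cbox[of a b] by (intro closure_minimal) auto
        finally show ?thesis unfolding eq using ab by (intro box_integral_zero[OF assms]) auto
      qed
    qed
    have ii: "integrable lebesgue (\<lambda>x. indicator (box c d) x *\<^sub>R H x)" for c d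
      by (rule integrable_mult_indicator[OF _ i]) (simp add: borel_open)
    have "AE x in lebesgue. Re (H x) = 0"
    proof (rule AE_zero_of_box_integrals_lebesgue)
      show "integrable lebesgue (\<lambda>x. Re (H x))" using i by simp
      show "(\<integral>x. indicator (box c d) x * Re (H x) \<partial>lebesgue) = 0" for c d
        using integral_Re[OF ii, of c d] box0[of c d] by simp
    qed
    moreover have "AE x in lebesgue. Im (H x) = 0"
    proof (rule AE_zero_of_box_integrals_lebesgue)
      show "integrable lebesgue (\<lambda>x. Im (H x))" using i by simp
      show "(\<integral>x. indicator (box c d) x * Im (H x) \<partial>lebesgue) = 0" for c d
        using integral_Im[OF ii, of c d] box0[of c d] by simp
    qed
    moreover have "AE x in lebesgue. x \<notin> cbox a b - box a b"
      using negligible_frontier_interval[of a b] unfolding negligible_iff_null_sets by (rule AE_not_in)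
    ultimately show ?thesis
      by eventually_elim (auto simp: H_def complex_eq_iff)
  qed
  obtain \<D> where D: "countable \<D>" "\<D> \<subseteq> Pow \<Omega>" "\<And>X. X \<in> \<D> \<Longrightarrow> \<exists>a b. X = cbox a b" "\<Union>\<D> = \<Omega>"
    using open_countable_Union_open_cbox[OF assms(1)] by metis
  have "AE x in lebesgue. \<forall>X\<in>\<D>. x \<in> X \<longrightarrow> h x = 0"
  proof (rule AE_ball_countable'[OF _ D(1)])
    fix X assume X: "X \<in> \<D>"
    then obtain a b where "X = cbox a b" using D(3) by blast
    then show "AE x in lebesgue. x \<in> X \<longrightarrow> h x = 0" using local[of a b] X D(2) by auto
  qed
  then have "AE x in lebesgue. x \<in> \<Omega> \<longrightarrow> h x = 0"
    by eventually_elim (use D(4) in auto)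
  then show ?thesis using assms(1) by (subst AE_restrict_space_iff) (auto simp: borel_open)
qed

section \<open>Uniqueness of weak gradients\<close>

text \<open>By translation invariance every difference quotient of f has integral zero. The
  Lipschitz bound on a thickened support permits the limit, so no iterated integrals are
  needed.\<close>

lemma integral_pderivative_zero:
  fixes f :: "real ^ 'n \<Rightarrow> complex"
  assumes K: "compact K" "\<And>x. x \<notin> K \<Longrightarrow> f x = 0"
    and d: "\<And>x. f differentiable (at x)" and c: "continuous_on UNIV (pderivative i f)"
    and L: "\<And>x y. norm (f x - f y) \<le> L * norm (x - y)"
  shows "(\<integral>x. pderivative i f x \<partial>lborel) = 0"
proof -
  define K' where "K' = {x + y |x y. x \<in> K \<and> y \<in> cball 0 (1::real)}"
  have K': "compact K'" unfolding K'_def by (rule compact_sums[OF K(1) compact_cball])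
  define h where "h j = 1 / real (Suc j)" for j
  have h: "0 < h j" "h j \<le> 1" for j by (simp_all add: h_def)
  have hlim: "h \<longlonglongrightarrow> 0" unfolding h_def by (rule LIMSEQ_Suc[OF lim_const_over_n])
  have cf: "continuous_on S f" for S
    using d by (meson continuous_at_imp_continuous_on differentiable_imp_continuous_within)
  have fi: "integrable lborel f" by (rule integrable_compact_support[OF K(1) cf K(2)])
  note tr = integral_translation_lborel[OF fi]
  have zero: "(\<integral>x. (f (x + h j *\<^sub>R axis i 1) - f x) /\<^sub>R h j \<partial>lborel) = 0" for j
    using fi tr by (simp add: Bochner_Integration.integral_diff)
  have "(\<lambda>j. \<integral>x. (f (x + h j *\<^sub>R axis i 1) - f x) /\<^sub>R h j \<partial>lborel) \<longlonglongrightarrow> (\<integral>x. pderivative i f x \<partial>lborel)"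
  proof (rule integral_dominated_convergence[where w = "\<lambda>x. indicator K' x * L"])
    show "pderivative i f \<in> borel_measurable lborel"
      using borel_measurable_continuous_onI[OF c] by simp
    show "(\<lambda>x. (f (x + h j *\<^sub>R axis i 1) - f x) /\<^sub>R h j) \<in> borel_measurable lborel" for j
      using tr(1)[of "h j *\<^sub>R axis i 1"] fi by (intro borel_measurable_scaleR borel_measurable_diff) auto
    show "integrable lborel (\<lambda>x. indicator K' x * L)"
      by (rule integrable_compact_support[OF K']) (auto intro: continuous_on_eq[OF continuous_on_const])
    show "AE x in lborel. (\<lambda>j. (f (x + h j *\<^sub>R axis i 1) - f x) /\<^sub>R h j) \<longlonglongrightarrow> pderivative i f x"
      using h(1) by (intro AE_I2 difference_quotient_tendsto d hlim) (metis less_irrefl)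
    show "AE x in lborel. norm ((f (x + h j *\<^sub>R axis i 1) - f x) /\<^sub>R h j) \<le> indicator K' x * L" for j
    proof (rule AE_I2)
      fix x
      show "norm ((f (x + h j *\<^sub>R axis i 1) - f x) /\<^sub>R h j) \<le> indicator K' x * L"
      proof (cases "x \<in> K'")
        case True
        have "norm (f (x + h j *\<^sub>R axis i 1) - f x) \<le> L * h j"
          using L[of "x + h j *\<^sub>R axis i 1" x] h(1)[of j] by (simp add: norm_axis_1)
        then show ?thesis using True h(1)[of j] unfolding norm_scaleR by (simp add: field_simps)
      next
        case False
        have "x \<notin> K" using False unfolding K'_def by force
        moreover have "x + h j *\<^sub>R axis i 1 \<notin> K"
        proof
          assume a: "x + h j *\<^sub>R axis i 1 \<in> K"
          have "norm (- (h j *\<^sub>R axis i (1::real))) \<le> 1" using h[of j] by (simp add: norm_axis_1)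
          then have "x + h j *\<^sub>R axis i 1 + - (h j *\<^sub>R axis i 1) \<in> K'"
            unfolding K'_def using a by (metis (mono_tags, lifting) mem_Collect_eq mem_cball_0)
          then show False using False by simp
        qed
        ultimately show ?thesis using K(2) False by simp
      qed
    qed
  qed
  then show ?thesis unfolding zero by (simp add: LIMSEQ_const_iff)
qed

lemma integration_by_parts_Cc_infinity:
  fixes \<phi> \<psi> :: "real ^ 'n \<Rightarrow> complex"
  assumes \<phi>: "\<phi> \<in> Cc_infinity \<Omega>" and \<psi>: "\<psi> \<in> Cc_infinity \<Omega>"
  shows "(\<integral>x. \<phi> x * pderivative i \<psi> x \<partial>lborel) = - (\<integral>x. pderivative i \<phi> x * \<psi> x \<partial>lborel)"
proof -
  define K where "K = closure {x. \<phi> x \<noteq> 0}"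
  have K: "compact K" "K \<subseteq> \<Omega>" unfolding K_def by (rule Cc_infinityD(3,4)[OF \<phi>])+
  have K0: "\<phi> x = 0" "pderivative i \<phi> x = 0" if "x \<notin> K" for x
    using that unfolding K_def by (rule Cc_infinityD(5)[OF \<phi>], intro pderivative_outside_support)
  note d\<phi> = Cc_infinity_pderivative[OF \<phi>] and d\<psi> = Cc_infinity_pderivative[OF \<psi>]
  have pd: "pderivative i (\<lambda>x. \<phi> x * \<psi> x) x = \<phi> x * pderivative i \<psi> x + pderivative i \<phi> x * \<psi> x" for x
    unfolding pderivative_def[of i \<phi>] pderivative_def[of i \<psi>]
    by (rule pderivative_eqI[OF has_derivative_mult])
       (use Cc_infinityD(2)[OF \<phi>] Cc_infinityD(2)[OF \<psi>] frechet_derivative_works in blast)+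
  obtain A where A: "\<And>x. norm (\<phi> x) \<le> A" using Cc_infinity_bounded[OF \<phi>] by blast
  obtain B where B: "\<And>x. norm (\<psi> x) \<le> B" using Cc_infinity_bounded[OF \<psi>] by blast
  obtain l where l: "\<And>x y. norm (\<phi> x - \<phi> y) \<le> l * norm (x - y)" using Cc_infinity_lipschitz[OF \<phi>] by blast
  obtain m where m: "\<And>x y. norm (\<psi> x - \<psi> y) \<le> m * norm (x - y)" using Cc_infinity_lipschitz[OF \<psi>] by blast
  have "(\<integral>x. pderivative i (\<lambda>x. \<phi> x * \<psi> x) x \<partial>lborel) = 0"
  proof (rule integral_pderivative_zero[where K = K and L = "A * m + l * B"])
    show "compact K" by (rule K)
    show "(\<lambda>x. \<phi> x * \<psi> x) differentiable (at x)" for x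
      by (intro differentiable_mult Cc_infinityD(2)[OF \<phi>] Cc_infinityD(2)[OF \<psi>])
    show "continuous_on UNIV (pderivative i (\<lambda>x. \<phi> x * \<psi> x))" unfolding pd[abs_def]
      by (intro continuous_intros Cc_infinityD(1)[OF \<phi>] Cc_infinityD(1)[OF \<psi>] Cc_infinityD(1)[OF d\<phi>] Cc_infinityD(1)[OF d\<psi>])
    fix x y
    have "\<phi> x * \<psi> x - \<phi> y * \<psi> y = \<phi> x * (\<psi> x - \<psi> y) + (\<phi> x - \<phi> y) * \<psi> y" by (simp add: algebra_simps)
    also have "norm \<dots> \<le> norm (\<phi> x) * norm (\<psi> x - \<psi> y) + norm (\<phi> x - \<phi> y) * norm (\<psi> y)"
      by (metis norm_mult norm_triangle_ineq)
    also have "\<dots> \<le> A * (m * norm (x - y)) + (l * norm (x - y)) * B"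
      by (intro add_mono mult_mono A B l m norm_ge_zero
          order_trans[OF norm_ge_zero A] order_trans[OF norm_ge_zero l])
    finally show "norm (\<phi> x * \<psi> x - \<phi> y * \<psi> y) \<le> (A * m + l * B) * norm (x - y)"
      by (simp add: algebra_simps)
  qed (simp add: K0)
  moreover have "integrable lborel (\<lambda>x. \<phi> x * pderivative i \<psi> x)" "integrable lborel (\<lambda>x. pderivative i \<phi> x * \<psi> x)"
    by (rule integrable_compact_support[OF K(1)],
        intro continuous_intros Cc_infinityD(1)[OF \<phi>] Cc_infinityD(1)[OF \<psi>] Cc_infinityD(1)[OF d\<phi>] Cc_infinityD(1)[OF d\<psi>],
        simp add: K0)+
  ultimately show ?thesis unfolding pd by (simp add: add_eq_0_iff)
qed

lemma continuous_locally_integrable: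
  fixes f :: "real ^ 'n \<Rightarrow> 'b :: {banach, second_countable_topology}"
  assumes "continuous_on UNIV f"
  shows "locally_integrable_on \<Omega> f"
  unfolding locally_integrable_on_def
proof (intro allI impI)
  fix K :: "(real ^ 'n) set" assume K: "compact K \<and> K \<subseteq> \<Omega>"
  have i: "integrable lborel (\<lambda>x. indicator K x *\<^sub>R f x)"
    using K by (intro borel_integrable_compact continuous_on_subset[OF assms]) auto
  then have "integrable lebesgue (\<lambda>x. indicator K x *\<^sub>R f x)"
    by (subst integrable_completion) auto
  then show "integrable (lebesgue_on K) f"
    using K by (subst integrable_restrict_space) (auto simp: borel_closed compact_imp_closed)
qed

lemma continuous_on_grad:
  assumes "\<phi> \<in> Cc_infinity \<Omega>" shows "continuous_on S (grad \<phi>)"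
  unfolding grad_def[abs_def]
  by (intro continuous_on_vec_lambda Cc_infinityD(1)[OF Cc_infinity_pderivative[OF assms]])

lemma has_weak_gradient_grad:
  fixes \<phi> :: "real ^ 'n \<Rightarrow> complex"
  assumes "open \<Omega>" and \<phi>: "\<phi> \<in> Cc_infinity \<Omega>"
  shows "has_weak_gradient \<Omega> \<phi> (grad \<phi>)"
  unfolding has_weak_gradient_def
proof (intro conjI ballI allI)
  show "locally_integrable_on \<Omega> \<phi>" by (intro continuous_locally_integrable Cc_infinityD(1)[OF \<phi>])
  show "locally_integrable_on \<Omega> (grad \<phi>)" by (intro continuous_locally_integrable continuous_on_grad[OF \<phi>])
  fix \<psi> i assume \<psi>: "\<psi> \<in> Cc_infinity \<Omega>"
  define K where "K = closure {x. \<phi> x \<noteq> 0}"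
  have K: "compact K" "K \<subseteq> \<Omega>" unfolding K_def by (rule Cc_infinityD(3,4)[OF \<phi>])+
  have K0: "\<phi> x = 0" "pderivative i \<phi> x = 0" if "x \<notin> K" for x
    using that unfolding K_def by (rule Cc_infinityD(5)[OF \<phi>], intro pderivative_outside_support)
  note d\<phi> = Cc_infinity_pderivative[OF \<phi>] and d\<psi> = Cc_infinity_pderivative[OF \<psi>]
  have "(\<integral>x. \<phi> x * pderivative i \<psi> x \<partial>lebesgue_on \<Omega>) = (\<integral>x. \<phi> x * pderivative i \<psi> x \<partial>lborel)"
    by (rule integral_lebesgue_on_compact_support[OF assms(1) K])
       (intro continuous_intros Cc_infinityD(1)[OF \<phi>] Cc_infinityD(1)[OF d\<psi>], simp add: K0)
  moreover have "(\<integral>x. pderivative i \<phi> x * \<psi> x \<partial>lebesgue_on \<Omega>) = (\<integral>x. pderivative i \<phi> x * \<psi> x \<partial>lborel)"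
    by (rule integral_lebesgue_on_compact_support[OF assms(1) K])
       (intro continuous_intros Cc_infinityD(1)[OF \<psi>] Cc_infinityD(1)[OF d\<phi>], simp add: K0)
  ultimately show "(\<integral>x. \<phi> x * pderivative i \<psi> x \<partial>lebesgue_on \<Omega>) = - (\<integral>x. grad \<phi> x $ i * \<psi> x \<partial>lebesgue_on \<Omega>)"
    using integration_by_parts_Cc_infinity[OF \<phi> \<psi>, of i] by (simp add: grad_def)
qed

section \<open>Differences, uniqueness and measurability of weak gradients\<close>

lemma integrable_times_test_function:
  fixes f \<psi> :: "real ^ 'n \<Rightarrow> complex"
  assumes "open \<Omega>" "locally_integrable_on \<Omega> f" and \<psi>: "\<psi> \<in> Cc_infinity \<Omega>"
  shows "integrable (lebesgue_on \<Omega>) (\<lambda>x. f x * \<psi> x)"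
proof -
  let ?K = "closure {x. \<psi> x \<noteq> 0}"
  have i: "integrable lebesgue (\<lambda>x. indicator ?K x *\<^sub>R f x)"
    by (rule locally_integrable_indicator[OF assms(2) Cc_infinityD(3,4)[OF \<psi>]])
  obtain B where B: "\<And>x. norm (\<psi> x) \<le> B" using Cc_infinity_bounded[OF \<psi>] by blast
  have \<psi>m: "\<psi> \<in> borel_measurable lebesgue"
    using Cc_infinityD(1)[OF \<psi>, of UNIV] by (intro measurable_completion) (simp add: borel_measurable_continuous_onI)
  have "integrable lebesgue (\<lambda>x. (indicator ?K x *\<^sub>R f x) * \<psi> x)"
  proof (rule Bochner_Integration.integrable_bound)
    show "integrable lebesgue (\<lambda>x. B *\<^sub>R (indicator ?K x *\<^sub>R f x))" using i by (rule integrable_scaleR_right)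
    show "(\<lambda>x. (indicator ?K x *\<^sub>R f x) * \<psi> x) \<in> borel_measurable lebesgue"
      using i by (intro borel_measurable_times \<psi>m) auto
    show "AE x in lebesgue. norm ((indicator ?K x *\<^sub>R f x) * \<psi> x) \<le> norm (B *\<^sub>R (indicator ?K x *\<^sub>R f x))"
    proof (rule AE_I2)
      fix x
      have "norm (indicator ?K x *\<^sub>R f x) * norm (\<psi> x) \<le> norm (indicator ?K x *\<^sub>R f x) * \<bar>B\<bar>"
        using B[of x] by (intro mult_left_mono) auto
      then show "norm ((indicator ?K x *\<^sub>R f x) * \<psi> x) \<le> norm (B *\<^sub>R (indicator ?K x *\<^sub>R f x))"
        unfolding norm_mult norm_scaleR by (simp add: mult.commute)
    qed
  qed
  moreover have "(indicator ?K x *\<^sub>R f x) * \<psi> x = indicator \<Omega> x *\<^sub>R (f x * \<psi> x)" for x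
    using Cc_infinityD(5)[OF \<psi>, of x] Cc_infinityD(4)[OF \<psi>]
    by (cases "x \<in> ?K") (auto simp: indicator_def)
  ultimately have "integrable lebesgue (\<lambda>x. indicator \<Omega> x *\<^sub>R (f x * \<psi> x))" by (simp only:)
  then show ?thesis using assms(1) by (subst integrable_restrict_space) (auto simp: borel_open)
qed

lemma locally_integrable_diff:
  assumes "locally_integrable_on \<Omega> f" "locally_integrable_on \<Omega> g"
  shows "locally_integrable_on \<Omega> (\<lambda>x. f x - g x)"
  using assms unfolding locally_integrable_on_def by auto

lemma locally_integrable_component:
  fixes g :: "real ^ 'n \<Rightarrow> complex ^ 'n"
  assumes "locally_integrable_on \<Omega> g"
  shows "locally_integrable_on \<Omega> (\<lambda>x. g x $ i)"
  using assms integrable_bounded_linear[OF bounded_linear_vec_nth[of i]]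
  unfolding locally_integrable_on_def by blast

lemma has_weak_gradient_diff:
  assumes "open \<Omega>" and 1: "has_weak_gradient \<Omega> f g" and 2: "has_weak_gradient \<Omega> f' g'"
  shows "has_weak_gradient \<Omega> (\<lambda>x. f x - f' x) (\<lambda>x. g x - g' x)"
  unfolding has_weak_gradient_def
proof (intro conjI ballI allI)
  have li: "locally_integrable_on \<Omega> f" "locally_integrable_on \<Omega> g" "locally_integrable_on \<Omega> f'" "locally_integrable_on \<Omega> g'"
    using 1 2 by (auto simp: has_weak_gradient_def)
  show "locally_integrable_on \<Omega> (\<lambda>x. f x - f' x)" "locally_integrable_on \<Omega> (\<lambda>x. g x - g' x)"
    using li by (auto intro: locally_integrable_diff)
  fix \<psi> i assume \<psi>: "\<psi> \<in> Cc_infinity \<Omega>"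
  note I = integrable_times_test_function[OF assms(1)]
  show "(\<integral>x. (f x - f' x) * pderivative i \<psi> x \<partial>lebesgue_on \<Omega>)
      = - (\<integral>x. (g x - g' x) $ i * \<psi> x \<partial>lebesgue_on \<Omega>)"
    using I[OF li(1) Cc_infinity_pderivative[OF \<psi>, of i]] I[OF li(3) Cc_infinity_pderivative[OF \<psi>, of i]]
      I[OF locally_integrable_component[OF li(2), of i] \<psi>] I[OF locally_integrable_component[OF li(4), of i] \<psi>] 1 2 \<psi>
    by (simp add: left_diff_distrib Bochner_Integration.integral_diff has_weak_gradient_def)
qed

text \<open>Since \<open>weak_gradient\<close> is a Hilbert choice, its value at f - \<phi> is not
  literally the difference of the two gradients. The difference of two candidates is a weak gradient
  of 0, and the fundamental lemma removes it componentwise.\<close>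

lemma weak_gradient_unique:
  assumes "open \<Omega>" and 1: "has_weak_gradient \<Omega> f g" and 2: "has_weak_gradient \<Omega> f g'"
  shows "AE x in lebesgue_on \<Omega>. g x = g' x"
proof -
  have d: "has_weak_gradient \<Omega> (\<lambda>x. 0) (\<lambda>x. g x - g' x)"
    using has_weak_gradient_diff[OF assms] by simp
  have "AE x in lebesgue_on \<Omega>. \<forall>i\<in>UNIV. (g x - g' x) $ i = 0"
  proof (intro AE_finite_allI fundamental_lemma[OF assms(1)])
    show "locally_integrable_on \<Omega> (\<lambda>x. (g x - g' x) $ i)" for i
      using d by (intro locally_integrable_component) (simp add: has_weak_gradient_def)
    show "(\<integral>x. (g x - g' x) $ i * \<phi> x \<partial>lebesgue_on \<Omega>) = 0" if "\<phi> \<in> Cc_infinity \<Omega>" for \<phi> i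
      using d that by (simp add: has_weak_gradient_def)
  qed simp
  then show ?thesis by eventually_elim (simp add: vec_eq_iff)
qed

lemma has_weak_gradient_weak_gradient:
  assumes "weakly_differentiable_on \<Omega> f"
  shows "has_weak_gradient \<Omega> f (weak_gradient \<Omega> f)"
  using someI_ex[OF assms[unfolded weakly_differentiable_on_def]] by (simp add: weak_gradient_def)

text \<open>An exhaustion by compact sets exhibits the function as a pointwise limit of integrable
  ones. Measurability is what splitting nonnegative integrals of sums requires.\<close>

lemma locally_integrable_measurable:
  fixes f :: "real ^ 'n \<Rightarrow> 'b :: {banach, second_countable_topology}"
  assumes "open \<Omega>" "locally_integrable_on \<Omega> f"
  shows "f \<in> borel_measurable (lebesgue_on \<Omega>)"
proof -
  obtain C :: "nat \<Rightarrow> (real ^ 'n) set" where C: "\<And>n. compact (C n)" "\<And>n. C n \<subseteq> \<Omega>"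
      "\<And>K. compact K \<Longrightarrow> K \<subseteq> \<Omega> \<Longrightarrow> \<exists>N. \<forall>n\<ge>N. K \<subseteq> C n"
    by (rule open_Union_compact_subsets[OF assms(1)]) (rule that; assumption)
  have "(\<lambda>x. indicator \<Omega> x *\<^sub>R f x) \<in> borel_measurable lebesgue"
  proof (rule borel_measurable_LIMSEQ_metric)
    show "(\<lambda>x. indicator (C n) x *\<^sub>R f x) \<in> borel_measurable lebesgue" for n
      using locally_integrable_indicator[OF assms(2) C(1,2)] by auto
    show "(\<lambda>n. indicator (C n) x *\<^sub>R f x) \<longlonglongrightarrow> indicator \<Omega> x *\<^sub>R f x" for x
    proof (cases "x \<in> \<Omega>")
      case True
      obtain N where "\<forall>n\<ge>N. {x} \<subseteq> C n" using C(3)[of "{x}"] True by auto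
      then have "\<forall>\<^sub>F n in sequentially. indicator (C n) x *\<^sub>R f x = indicator \<Omega> x *\<^sub>R f x"
        using True by (auto simp: eventually_sequentially indicator_def)
      then show ?thesis by (rule tendsto_eventually)
    next
      case False
      then have "indicator (C n) x *\<^sub>R f x = indicator \<Omega> x *\<^sub>R f x" for n
        using C(2)[of n] by (auto simp: indicator_def)
      then show ?thesis by (simp only:) simp
    qed
  qed
  then show ?thesis using assms(1) by (subst borel_measurable_restrict_space_iff) (auto simp: borel_open)
qed

section \<open>The closure of the test functions\<close>

text \<open>The form (b + c)^2 \<le> (1 + \<epsilon>) b^2 + (1 + 1/\<epsilon>) c^2 of the triangle
  inequality stays within \<open>ennreal\<close> integrals, without square roots and without
  finiteness; \<epsilon> is sent to 0 later.\<close>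

lemma weighted_square_triangle:
  fixes a b c W :: "'a \<Rightarrow> real"
  assumes m: "a \<in> borel_measurable M" "b \<in> borel_measurable M" "c \<in> borel_measurable M" "W \<in> borel_measurable M"
    and nn: "\<And>x. 0 \<le> W x" "\<And>x. 0 \<le> a x" and e: "\<epsilon> > 0"
    and le: "AE x in M. a x \<le> b x + c x"
  shows "(\<integral>\<^sup>+x. ennreal ((a x)\<^sup>2 * W x) \<partial>M) \<le> ennreal (1 + \<epsilon>) * (\<integral>\<^sup>+x. ennreal ((b x)\<^sup>2 * W x) \<partial>M)
    + ennreal (1 + 1 / \<epsilon>) * (\<integral>\<^sup>+x. ennreal ((c x)\<^sup>2 * W x) \<partial>M)"
proof -
  have "(\<integral>\<^sup>+x. ennreal ((a x)\<^sup>2 * W x) \<partial>M)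
      \<le> (\<integral>\<^sup>+x. ennreal (1 + \<epsilon>) * ennreal ((b x)\<^sup>2 * W x) + ennreal (1 + 1 / \<epsilon>) * ennreal ((c x)\<^sup>2 * W x) \<partial>M)"
  proof (rule nn_integral_mono_AE, use le in eventually_elim)
    case (elim x)
    have "(a x)\<^sup>2 \<le> (b x + c x)\<^sup>2" using elim nn(2)[of x] by (intro power_mono) auto
    also have "\<dots> \<le> (1 + \<epsilon>) * (b x)\<^sup>2 + (1 + 1 / \<epsilon>) * (c x)\<^sup>2"
    proof -
      have "0 \<le> (\<epsilon> * b x - c x)\<^sup>2 / \<epsilon>" using e by simp
      also have "\<dots> = \<epsilon> * (b x)\<^sup>2 + (1 / \<epsilon>) * (c x)\<^sup>2 - 2 * b x * c x"
        using e by (simp add: field_simps power2_eq_square)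
      finally show ?thesis by (simp add: power2_sum algebra_simps)
    qed
    finally have "(a x)\<^sup>2 * W x \<le> ((1 + \<epsilon>) * (b x)\<^sup>2 + (1 + 1 / \<epsilon>) * (c x)\<^sup>2) * W x"
      using nn(1) by (rule mult_right_mono)
    also have "\<dots> = (1 + \<epsilon>) * ((b x)\<^sup>2 * W x) + (1 + 1 / \<epsilon>) * ((c x)\<^sup>2 * W x)" by (simp add: algebra_simps)
    finally have "ennreal ((a x)\<^sup>2 * W x) \<le> ennreal ((1 + \<epsilon>) * ((b x)\<^sup>2 * W x) + (1 + 1 / \<epsilon>) * ((c x)\<^sup>2 * W x))"
      by (rule ennreal_leI)
    also have "\<dots> = ennreal (1 + \<epsilon>) * ennreal ((b x)\<^sup>2 * W x) + ennreal (1 + 1 / \<epsilon>) * ennreal ((c x)\<^sup>2 * W x)"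
      using e nn(1)[of x] by (subst ennreal_plus) (auto simp: ennreal_mult intro!: mult_nonneg_nonneg add_nonneg_nonneg)
    finally show ?case .
  qed
  also have "\<dots> = ennreal (1 + \<epsilon>) * (\<integral>\<^sup>+x. ennreal ((b x)\<^sup>2 * W x) \<partial>M)
    + ennreal (1 + 1 / \<epsilon>) * (\<integral>\<^sup>+x. ennreal ((c x)\<^sup>2 * W x) \<partial>M)"
    using m by (subst nn_integral_add) (auto simp: nn_integral_cmult)
  finally show ?thesis .
qed

lemma borel_measurable_bdist_powr:
  "(\<lambda>x. bdist \<Omega> x powr q) \<in> borel_measurable (lebesgue_on S)"
proof -
  have "bdist \<Omega> \<in> borel_measurable lborel"
    using borel_measurable_continuous_onI[OF continuous_on_bdist] by simp
  then have "(\<lambda>x. bdist \<Omega> x powr q) \<in> borel_measurable lborel" by simp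
  then show ?thesis by (intro measurable_restrict_space1 measurable_completion)
qed

lemma nn_integral_dvol:
  fixes \<Omega> :: "(real ^ 'n) set"
  assumes "f \<in> borel_measurable (lebesgue_on \<Omega>)" "\<And>x. 0 \<le> f x"
  shows "(\<integral>\<^sup>+x. ennreal (f x) \<partial>dvol \<Omega> \<gamma>)
    = (\<integral>\<^sup>+x. ennreal (f x * bdist \<Omega> x powr (- (real CARD('n) * \<gamma>))) \<partial>lebesgue_on \<Omega>)"
proof -
  have "(\<integral>\<^sup>+x. ennreal (f x) \<partial>dvol \<Omega> \<gamma>)
    = (\<integral>\<^sup>+x. ennreal (bdist \<Omega> x powr (- (real CARD('n) * \<gamma>))) * ennreal (f x) \<partial>lebesgue_on \<Omega>)"
    unfolding dvol_def using assms(1) borel_measurable_bdist_powr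
    by (intro nn_integral_density measurable_compose[OF _ measurable_ennreal])
  also have "\<dots> = (\<integral>\<^sup>+x. ennreal (f x * bdist \<Omega> x powr (- (real CARD('n) * \<gamma>))) \<partial>lebesgue_on \<Omega>)"
    using assms(2) by (intro nn_integral_cong) (simp add: ennreal_mult[symmetric] mult.commute)
  finally show ?thesis .
qed

lemma ennreal_divide_left_mono:
  fixes a b c :: ennreal
  assumes "b \<le> c" shows "a / c \<le> a / b"
proof -
  have "inverse c \<le> inverse b"
  proof (cases "b = 0 \<or> c = top")
    case False
    then obtain x y where "b = ennreal x" "c = ennreal y" "0 < x" "x \<le> y"
      using assms by (cases b; cases c) (auto simp: top_unique)
    then show ?thesis by (simp add: inverse_ennreal ennreal_leI le_imp_inverse_le)
  qed auto
  then show ?thesis unfolding divide_ennreal_def by (rule mult_left_mono) simp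
qed

text \<open>Bookkeeping for \<open>Hardy_W12_0\<close>: q and l are the energy and the squared norm
  of f, q' and l' those of the remainder f - \<phi> n, e1 and e2 stand for 1 + \<epsilon> and 1 +
  1/\<epsilon>. The remainder enters only through q' + l', with a coefficient that is independent of
  n.\<close>

lemma ennreal_combine:
  fixes X P B q l q' l' A K e1 e2 Y Z :: ennreal
  assumes "X \<le> e1 * Y + e2 * Z" "Y \<le> P + A * B" "Z \<le> K * l'"
    "P \<le> e1 * q + e2 * q'" "B \<le> e1 * l + e2 * l'"
  shows "X \<le> e1 * e1 * (q + A * l) + (e1 * e2 * (1 + A) + e2 * K) * (q' + l')"
proof -
  have "X \<le> e1 * Y + e2 * Z" by fact
  also have "\<dots> \<le> e1 * ((e1 * q + e2 * q') + A * (e1 * l + e2 * l')) + e2 * (K * l')"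
    using assms(2-5) by (intro add_mono mult_left_mono order_trans[OF assms(2)]) auto
  also have "\<dots> = e1 * e1 * (q + A * l) + (e1 * e2 * q' + e1 * e2 * A * l' + e2 * K * l')"
    by (simp add: distrib_left distrib_right mult_ac add_ac)
  also have "\<dots> \<le> e1 * e1 * (q + A * l) + (e1 * e2 * (q' + l') + e1 * e2 * A * (q' + l') + e2 * K * (q' + l'))"
    by (intro add_mono mult_left_mono order_refl) (auto simp: add_increasing add_increasing2)
  also have "\<dots> = e1 * e1 * (q + A * l) + (e1 * e2 * (1 + A) + e2 * K) * (q' + l')"
    by (simp add: distrib_left distrib_right mult_ac add_ac)
  finally show ?thesis .
qed

text \<open>Convergence in the Sobolev norm does not by itself control the remainder in the singular
  weight. With a truncated weight it does; the limits are then taken in the order n, \<epsilon>,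
  truncation level k, the last by Fatou's lemma.\<close>

lemma Hardy_W12_0:
  fixes \<Omega> :: "(real ^ 'n) set" and \<gamma> s a :: real
  assumes op: "open \<Omega>" and fr: "frontier \<Omega> \<noteq> {}" and a: "a \<ge> 0"
    and H: "\<And>\<phi>. \<phi> \<in> Cc_infinity \<Omega> \<Longrightarrow>
      (\<integral>\<^sup>+x. ennreal (s\<^sup>2 * (cmod (\<phi> x))\<^sup>2 * bdist \<Omega> x powr ((2 - real CARD('n)) * \<gamma> - 2)) \<partial>lebesgue_on \<Omega>)
      \<le> (\<integral>\<^sup>+x. ennreal ((norm (grad \<phi> x))\<^sup>2 * bdist \<Omega> x powr ((2 - real CARD('n)) * \<gamma>)) \<partial>lebesgue_on \<Omega>)
        + ennreal a * (\<integral>\<^sup>+x. ennreal ((cmod (\<phi> x))\<^sup>2 * bdist \<Omega> x powr (- (real CARD('n) * \<gamma>))) \<partial>lebesgue_on \<Omega>)"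
    and f: "f \<in> W12_0 \<Omega> \<gamma>"
  shows "(\<integral>\<^sup>+x. ennreal (s\<^sup>2 * (cmod (f x))\<^sup>2 * bdist \<Omega> x powr ((2 - real CARD('n)) * \<gamma> - 2)) \<partial>lebesgue_on \<Omega>)
    \<le> Qform \<Omega> \<gamma> f + ennreal a * L2_normsq \<Omega> \<gamma> f"
proof -
  let ?N = "real CARD('n)"
  define M where "M = lebesgue_on \<Omega>"
  define W0 where "W0 x = bdist \<Omega> x powr (- (?N * \<gamma>))" for x
  define W1 where "W1 x = bdist \<Omega> x powr ((2 - ?N) * \<gamma> - 2)" for x
  define W2 where "W2 x = bdist \<Omega> x powr ((2 - ?N) * \<gamma>)" for x
  have Wm [measurable]: "W0 \<in> borel_measurable M" "W1 \<in> borel_measurable M" "W2 \<in> borel_measurable M"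
    unfolding W0_def[abs_def] W1_def[abs_def] W2_def[abs_def] M_def by (rule borel_measurable_bdist_powr)+
  have Wn: "0 \<le> W0 x" "0 \<le> W1 x" "0 \<le> W2 x" for x by (simp_all add: W0_def W1_def W2_def)
  obtain \<phi> where \<phi>: "\<And>n::nat. \<phi> n \<in> Cc_infinity \<Omega>"
    and lim: "(\<lambda>n. Qform \<Omega> \<gamma> (\<lambda>x. f x - \<phi> n x) + L2_normsq \<Omega> \<gamma> (\<lambda>x. f x - \<phi> n x)) \<longlonglongrightarrow> 0"
    using f by (auto simp: W12_0_def)
  have fW: "weakly_differentiable_on \<Omega> f" "Qform \<Omega> \<gamma> f + L2_normsq \<Omega> \<gamma> f < \<infinity>"
    using f by (auto simp: W12_0_def W12_def)
  note wf = has_weak_gradient_weak_gradient[OF fW(1)]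
  define r where "r n x = f x - \<phi> n x" for n x
  have wr0: "has_weak_gradient \<Omega> (r n) (\<lambda>x. weak_gradient \<Omega> f x - grad (\<phi> n) x)" for n
    unfolding r_def[abs_def] by (rule has_weak_gradient_diff[OF op wf has_weak_gradient_grad[OF op \<phi>]])
  then have wr: "has_weak_gradient \<Omega> (r n) (weak_gradient \<Omega> (r n))" for n
    by (intro has_weak_gradient_weak_gradient) (auto simp: weakly_differentiable_on_def)
  have gr: "AE x in M. weak_gradient \<Omega> (r n) x = weak_gradient \<Omega> f x - grad (\<phi> n) x" for n
    unfolding M_def by (rule weak_gradient_unique[OF op wr wr0])
  have meas: "h \<in> borel_measurable M" "h' \<in> borel_measurable M" if "has_weak_gradient \<Omega> h h'" for h h'
    using that op unfolding M_def has_weak_gradient_def by (auto intro: locally_integrable_measurable)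
  have [measurable]: "f \<in> borel_measurable M" "r n \<in> borel_measurable M" "\<phi> n \<in> borel_measurable M"
    "weak_gradient \<Omega> f \<in> borel_measurable M" "weak_gradient \<Omega> (r n) \<in> borel_measurable M"
    "grad (\<phi> n) \<in> borel_measurable M" for n
    using meas[OF wf] meas[OF wr] meas[OF has_weak_gradient_grad[OF op \<phi>[of n]]] by auto
  have L2: "L2_normsq \<Omega> \<gamma> h = (\<integral>\<^sup>+x. ennreal ((cmod (h x))\<^sup>2 * W0 x) \<partial>M)" if "h \<in> borel_measurable M" for h
    unfolding L2_normsq_def W0_def M_def
    by (rule nn_integral_dvol) (use that in \<open>auto simp: M_def\<close>)
  have Q: "Qform \<Omega> \<gamma> h = (\<integral>\<^sup>+x. ennreal ((norm (weak_gradient \<Omega> h x))\<^sup>2 * W2 x) \<partial>M)" for h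
    by (simp add: Qform_def W2_def M_def)
  define T where "T = Qform \<Omega> \<gamma> f + ennreal a * L2_normsq \<Omega> \<gamma> f"
  \<comment> \<open>\<open>V k\<close> is below the Hardy weight and below \<open>k\<close> times the volume density, so that
    \<open>\<integral> |f - \<phi> n|\<^sup>2 V k\<close> is controlled by the \<open>L\<^sup>2\<close> norm.\<close>
  define V where "V k x = min (s\<^sup>2 * W1 x) (real k * W0 x)" for k :: nat and x
  have Vm [measurable]: "V k \<in> borel_measurable M" for k unfolding V_def[abs_def] by simp
  have Vn: "0 \<le> V k x" for k x using Wn by (simp add: V_def)
  have est: "(\<integral>\<^sup>+x. ennreal ((cmod (f x))\<^sup>2 * V k x) \<partial>M) \<le>
      ennreal (1 + \<epsilon>) * ennreal (1 + \<epsilon>) * T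
      + (ennreal (1 + \<epsilon>) * ennreal (1 + 1 / \<epsilon>) * (1 + ennreal a) + ennreal (1 + 1 / \<epsilon>) * ennreal (real k))
        * (Qform \<Omega> \<gamma> (r n) + L2_normsq \<Omega> \<gamma> (r n))" if e: "\<epsilon> > 0" for k n \<epsilon>
    unfolding T_def
  proof (rule ennreal_combine)
    show "(\<integral>\<^sup>+x. ennreal ((cmod (f x))\<^sup>2 * V k x) \<partial>M)
      \<le> ennreal (1 + \<epsilon>) * (\<integral>\<^sup>+x. ennreal ((cmod (\<phi> n x))\<^sup>2 * V k x) \<partial>M)
        + ennreal (1 + 1 / \<epsilon>) * (\<integral>\<^sup>+x. ennreal ((cmod (r n x))\<^sup>2 * V k x) \<partial>M)"
    proof (rule weighted_square_triangle[OF _ _ _ _ _ _ e])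
      show "AE x in M. cmod (f x) \<le> cmod (\<phi> n x) + cmod (r n x)"
      proof (rule AE_I2)
        fix x
        show "cmod (f x) \<le> cmod (\<phi> n x) + cmod (r n x)"
          using norm_triangle_ineq[of "\<phi> n x" "r n x"] by (simp add: r_def)
      qed
    qed (use Vn in auto)
    have "(\<integral>\<^sup>+x. ennreal ((cmod (\<phi> n x))\<^sup>2 * V k x) \<partial>M)
      \<le> (\<integral>\<^sup>+x. ennreal (s\<^sup>2 * (cmod (\<phi> n x))\<^sup>2 * W1 x) \<partial>M)"
    proof (intro nn_integral_mono ennreal_leI)
      fix x
      have "(cmod (\<phi> n x))\<^sup>2 * V k x \<le> (cmod (\<phi> n x))\<^sup>2 * (s\<^sup>2 * W1 x)"
        by (intro mult_left_mono) (auto simp: V_def)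
      then show "(cmod (\<phi> n x))\<^sup>2 * V k x \<le> s\<^sup>2 * (cmod (\<phi> n x))\<^sup>2 * W1 x" by (simp add: mult_ac)
    qed
    also have "\<dots> \<le> (\<integral>\<^sup>+x. ennreal ((norm (grad (\<phi> n) x))\<^sup>2 * W2 x) \<partial>M)
        + ennreal a * (\<integral>\<^sup>+x. ennreal ((cmod (\<phi> n x))\<^sup>2 * W0 x) \<partial>M)"
      unfolding M_def W0_def W1_def W2_def by (rule H[OF \<phi>])
    finally show "(\<integral>\<^sup>+x. ennreal ((cmod (\<phi> n x))\<^sup>2 * V k x) \<partial>M)
      \<le> (\<integral>\<^sup>+x. ennreal ((norm (grad (\<phi> n) x))\<^sup>2 * W2 x) \<partial>M)
        + ennreal a * (\<integral>\<^sup>+x. ennreal ((cmod (\<phi> n x))\<^sup>2 * W0 x) \<partial>M)" .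
    have "(\<integral>\<^sup>+x. ennreal ((cmod (r n x))\<^sup>2 * V k x) \<partial>M)
      \<le> (\<integral>\<^sup>+x. ennreal (real k) * ennreal ((cmod (r n x))\<^sup>2 * W0 x) \<partial>M)"
    proof (rule nn_integral_mono)
      fix x
      have "(cmod (r n x))\<^sup>2 * V k x \<le> (cmod (r n x))\<^sup>2 * (real k * W0 x)"
        by (intro mult_left_mono) (auto simp: V_def)
      then have "(cmod (r n x))\<^sup>2 * V k x \<le> real k * ((cmod (r n x))\<^sup>2 * W0 x)" by (simp add: mult_ac)
      then show "ennreal ((cmod (r n x))\<^sup>2 * V k x) \<le> ennreal (real k) * ennreal ((cmod (r n x))\<^sup>2 * W0 x)"
        using Wn by (simp add: ennreal_mult[symmetric] ennreal_leI)
    qed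
    then show "(\<integral>\<^sup>+x. ennreal ((cmod (r n x))\<^sup>2 * V k x) \<partial>M) \<le> ennreal (real k) * L2_normsq \<Omega> \<gamma> (r n)"
      by (simp add: nn_integral_cmult L2)
    show "(\<integral>\<^sup>+x. ennreal ((norm (grad (\<phi> n) x))\<^sup>2 * W2 x) \<partial>M)
      \<le> ennreal (1 + \<epsilon>) * Qform \<Omega> \<gamma> f + ennreal (1 + 1 / \<epsilon>) * Qform \<Omega> \<gamma> (r n)"
      unfolding Q
    proof (rule weighted_square_triangle[OF _ _ _ _ _ _ e])
      show "AE x in M. norm (grad (\<phi> n) x) \<le> norm (weak_gradient \<Omega> f x) + norm (weak_gradient \<Omega> (r n) x)"
        using gr[of n]
      proof eventually_elim
        case (elim x)
        show ?case using norm_triangle_ineq4[of "weak_gradient \<Omega> f x" "weak_gradient \<Omega> (r n) x"]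
          by (simp add: elim)
      qed
    qed (use Wn in auto)
    show "(\<integral>\<^sup>+x. ennreal ((cmod (\<phi> n x))\<^sup>2 * W0 x) \<partial>M)
      \<le> ennreal (1 + \<epsilon>) * L2_normsq \<Omega> \<gamma> f + ennreal (1 + 1 / \<epsilon>) * L2_normsq \<Omega> \<gamma> (r n)"
      unfolding L2[OF \<open>f \<in> borel_measurable M\<close>] L2[OF \<open>r n \<in> borel_measurable M\<close>]
    proof (rule weighted_square_triangle[OF _ _ _ _ _ _ e])
      show "AE x in M. cmod (\<phi> n x) \<le> cmod (f x) + cmod (r n x)"
      proof (rule AE_I2)
        fix x
        show "cmod (\<phi> n x) \<le> cmod (f x) + cmod (r n x)"
          using norm_triangle_ineq4[of "f x" "r n x"] by (simp add: r_def)
      qed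
    qed (use Wn in auto)
  qed
  have eps: "(\<integral>\<^sup>+x. ennreal ((cmod (f x))\<^sup>2 * V k x) \<partial>M) \<le> ennreal ((1 + \<epsilon>)\<^sup>2) * T" if e: "\<epsilon> > 0" for k \<epsilon>
  proof -
    define C where "C = ennreal (1 + \<epsilon>) * ennreal (1 + 1 / \<epsilon>) * (1 + ennreal a) + ennreal (1 + 1 / \<epsilon>) * ennreal (real k)"
    \<comment> \<open>In \<open>ennreal\<close> a constant factor passes through the limit only if
      it is finite; C is finite because k and \<epsilon> are fixed while n grows.\<close>
    have C: "C < top" unfolding C_def by (simp add: ennreal_mult_less_top)
    have "(\<lambda>n. ennreal (1 + \<epsilon>) * ennreal (1 + \<epsilon>) * T + C * (Qform \<Omega> \<gamma> (r n) + L2_normsq \<Omega> \<gamma> (r n)))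
      \<longlonglongrightarrow> ennreal (1 + \<epsilon>) * ennreal (1 + \<epsilon>) * T + C * 0"
      using lim unfolding r_def[abs_def] by (intro tendsto_add tendsto_const ennreal_tendsto_cmult[OF C])
    then have "(\<integral>\<^sup>+x. ennreal ((cmod (f x))\<^sup>2 * V k x) \<partial>M) \<le> ennreal (1 + \<epsilon>) * ennreal (1 + \<epsilon>) * T + C * 0"
      by (rule LIMSEQ_le_const) (use est[OF e, of k, folded C_def] in blast)
    then show ?thesis using e by (simp add: power2_eq_square ennreal_mult)
  qed
  have T: "T < top" using fW(2) unfolding T_def by (auto simp: ennreal_mult_less_top ennreal_add_less_top)
  have bound: "(\<integral>\<^sup>+x. ennreal ((cmod (f x))\<^sup>2 * V k x) \<partial>M) \<le> T" for k
  proof -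
    have "(\<lambda>j. (1 + 1 / real (Suc j))\<^sup>2) \<longlonglongrightarrow> (1 + 0)\<^sup>2"
      by (intro tendsto_power tendsto_add tendsto_const LIMSEQ_Suc[OF lim_const_over_n])
    then have "(\<lambda>j. T * ennreal ((1 + 1 / real (Suc j))\<^sup>2)) \<longlonglongrightarrow> T * ennreal ((1 + 0)\<^sup>2)"
      by (intro ennreal_tendsto_cmult[OF T] tendsto_ennrealI)
    moreover have "(\<integral>\<^sup>+x. ennreal ((cmod (f x))\<^sup>2 * V k x) \<partial>M) \<le> T * ennreal ((1 + 1 / real (Suc j))\<^sup>2)" for j
      using eps[of "1 / real (Suc j)" k] by (simp add: mult.commute)
    ultimately have "(\<integral>\<^sup>+x. ennreal ((cmod (f x))\<^sup>2 * V k x) \<partial>M) \<le> T * ennreal ((1 + 0)\<^sup>2)"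
      by (intro LIMSEQ_le_const) auto
    then show ?thesis by simp
  qed
  have "(\<integral>\<^sup>+x. ennreal (s\<^sup>2 * (cmod (f x))\<^sup>2 * W1 x) \<partial>M)
      = (\<integral>\<^sup>+x. liminf (\<lambda>k. ennreal ((cmod (f x))\<^sup>2 * V k x)) \<partial>M)"
  proof (rule nn_integral_cong)
    fix x assume "x \<in> space M"
    then have x: "x \<in> \<Omega>" by (simp add: M_def space_restrict_space)
    have W0: "W0 x > 0" using bdist_pos[OF op fr x] by (simp add: W0_def)
    \<comment> \<open>As W0 x > 0, the truncation is inactive from some k on, so
      \<open>V k x\<close> is eventually constant and its lower limit is the full Hardy
      weight.\<close>
    obtain k0 :: nat where k0: "s\<^sup>2 * W1 x / W0 x \<le> real k0" using real_arch_simple by blast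
    have Vk: "V k x = s\<^sup>2 * W1 x" if "k \<ge> k0" for k
    proof -
      have "s\<^sup>2 * W1 x / W0 x \<le> real k" using k0 that by linarith
      then show ?thesis using W0 by (simp add: V_def field_simps)
    qed
    have "\<forall>\<^sub>F k in sequentially. ennreal ((cmod (f x))\<^sup>2 * V k x) = ennreal (s\<^sup>2 * (cmod (f x))\<^sup>2 * W1 x)"
      unfolding eventually_sequentially by (intro exI[of _ k0] allI impI) (simp add: Vk mult_ac)
    from lim_imp_Liminf[OF _ tendsto_eventually[OF this]]
    show "ennreal (s\<^sup>2 * (cmod (f x))\<^sup>2 * W1 x) = liminf (\<lambda>k. ennreal ((cmod (f x))\<^sup>2 * V k x))" by simp
  qed
  also have "\<dots> \<le> liminf (\<lambda>k. \<integral>\<^sup>+x. ennreal ((cmod (f x))\<^sup>2 * V k x) \<partial>M)"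
    by (rule nn_integral_liminf) simp
  also have "\<dots> \<le> liminf (\<lambda>k::nat. T)" by (intro Liminf_mono always_eventually allI bound)
  also have "\<dots> = T" by (simp add: Liminf_const)
  finally show ?thesis by (simp add: T_def M_def W1_def)
qed

section \<open>From the weighted Euclidean inequality to the Riemannian one\<close>

theorem theorem4p5:
  fixes \<Omega> :: "(real ^ 'n) set" and \<gamma> :: real
  assumes "open \<Omega>" and "bounded \<Omega>" and "connected \<Omega>" and "C2_boundary \<Omega>"
    and "0 \<le> real CARD('n) * \<gamma>" and "real CARD('n) * \<gamma> < 1"
  shows "\<exists>c. c \<le> 2 * (1 - \<gamma>) / (1 + (real CARD('n) - 2) * \<gamma>) \<and> weak_Hardy \<Omega> \<gamma> c"
proof -
  let ?N = "real CARD('n)"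
  define s where "s = (1 + (?N - 2) * \<gamma>) / 2"
  \<comment> \<open>The value for which c s = 1 - \<gamma>; as 2s is the denominator of the stated
    bound, the bound is attained with equality.\<close>
  define c where "c = (1 - \<gamma>) / s"
  have N: "?N \<ge> 1" using zero_less_card_finite[where 'a = 'n] by linarith
  have \<gamma>: "0 \<le> \<gamma>" "\<gamma> < 1"
  proof -
    show g0: "0 \<le> \<gamma>" using assms(5) N by (simp add: zero_le_mult_iff)
    have "\<gamma> \<le> ?N * \<gamma>" using mult_right_mono[OF N g0] by simp
    then show "\<gamma> < 1" using assms(6) by linarith
  qed
  have s: "0 < s" "s < 1"
  proof -
    \<comment> \<open>2s = 1 + N\<gamma> - 2\<gamma> is at least 1 - \<gamma> and less than 2 -
      2\<gamma>; this covers N = 1 as well.\<close>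
    have "\<gamma> \<le> ?N * \<gamma>" using mult_right_mono[OF N \<gamma>(1)] by simp
    then show "0 < s" "s < 1" using \<gamma> assms(6) by (simp_all add: s_def left_diff_distrib)
  qed
  have c: "c > 0" using \<gamma> s by (simp add: c_def)
  have "\<exists>a\<ge>0. \<forall>f\<in>W12_0 \<Omega> \<gamma>. (\<integral>\<^sup>+x. ennreal ((cmod (f x))\<^sup>2) / (riem_bdist \<Omega> \<gamma> x)\<^sup>2 \<partial>dvol \<Omega> \<gamma>)
      \<le> ennreal (c\<^sup>2) * (Qform \<Omega> \<gamma> f + ennreal a * L2_normsq \<Omega> \<gamma> f)"
  \<comment> \<open>The empty set has empty frontier, where the boundary distance degenerates to 0;
    the integrals over it vanish anyway. A bounded nonempty set has nonempty frontier.\<close>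
  proof (cases "\<Omega> = {}")
    case True
    then have "space (dvol \<Omega> \<gamma>) = {}" by (simp add: dvol_def space_restrict_space)
    then show ?thesis by (intro exI[of _ 0]) (simp add: nn_integral_empty)
  next
    case False
    have "\<Omega> \<noteq> UNIV" using assms(2) not_bounded_UNIV by blast
    then have fr: "frontier \<Omega> \<noteq> {}" using False frontier_eq_empty by blast
    obtain a where a: "a \<ge> 0" and H: "\<And>\<phi>. \<phi> \<in> Cc_infinity \<Omega> \<Longrightarrow>
      (\<integral>\<^sup>+x. ennreal (s\<^sup>2 * (cmod (\<phi> x))\<^sup>2 * bdist \<Omega> x powr ((2 - ?N) * \<gamma> - 2)) \<partial>lebesgue_on \<Omega>)
      \<le> (\<integral>\<^sup>+x. ennreal ((norm (grad \<phi> x))\<^sup>2 * bdist \<Omega> x powr ((2 - ?N) * \<gamma>)) \<partial>lebesgue_on \<Omega>)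
        + ennreal a * (\<integral>\<^sup>+x. ennreal ((cmod (\<phi> x))\<^sup>2 * bdist \<Omega> x powr (- (?N * \<gamma>))) \<partial>lebesgue_on \<Omega>)"
      using Hardy_test_functions[OF assms(1,2,4) fr, of \<gamma>] s unfolding s_def by blast
    have "(\<integral>\<^sup>+x. ennreal ((cmod (f x))\<^sup>2) / (riem_bdist \<Omega> \<gamma> x)\<^sup>2 \<partial>dvol \<Omega> \<gamma>)
      \<le> ennreal (c\<^sup>2) * (Qform \<Omega> \<gamma> f + ennreal a * L2_normsq \<Omega> \<gamma> f)" if f: "f \<in> W12_0 \<Omega> \<gamma>" for f
    proof -
      have fm: "f \<in> borel_measurable (lebesgue_on \<Omega>)"
        using f assms(1) by (auto simp: W12_0_def W12_def weakly_differentiable_on_def has_weak_gradient_def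
            intro: locally_integrable_measurable)
      then have f2m: "(\<lambda>x. (cmod (f x))\<^sup>2) \<in> borel_measurable (lebesgue_on \<Omega>)" by simp
      have "(\<integral>\<^sup>+x. ennreal ((cmod (f x))\<^sup>2) / (riem_bdist \<Omega> \<gamma> x)\<^sup>2 \<partial>dvol \<Omega> \<gamma>)
          \<le> (\<integral>\<^sup>+x. ennreal ((cmod (f x))\<^sup>2 * ((1 - \<gamma>)\<^sup>2 * bdist \<Omega> x powr (2 * \<gamma> - 2))) \<partial>dvol \<Omega> \<gamma>)"
      proof (rule nn_integral_mono)
        fix x assume "x \<in> space (dvol \<Omega> \<gamma>)"
        then have x: "x \<in> \<Omega>" by (simp add: dvol_def space_restrict_space)
        \<comment> \<open>E is the lower bound for the Riemannian distance; its positivity makes the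
          quotient by its square an ordinary real number.\<close>
        define t where "t = bdist \<Omega> x"
        have t: "t > 0" unfolding t_def by (rule bdist_pos[OF assms(1) fr x])
        define E where "E = t powr (1 - \<gamma>) / (1 - \<gamma>)"
        have E: "E > 0" using t \<gamma> by (simp add: E_def)
        have "ennreal E \<le> riem_bdist \<Omega> \<gamma> x"
          unfolding E_def t_def by (rule riem_bdist_ge[OF assms(1) fr \<gamma>])
        then have "ennreal ((cmod (f x))\<^sup>2) / (riem_bdist \<Omega> \<gamma> x)\<^sup>2 \<le> ennreal ((cmod (f x))\<^sup>2) / (ennreal E)\<^sup>2"
          by (intro ennreal_divide_left_mono power_mono) auto
        also have "\<dots> = ennreal ((cmod (f x))\<^sup>2 / E\<^sup>2)"
          using E by (simp add: ennreal_power divide_ennreal)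
        also have "(cmod (f x))\<^sup>2 / E\<^sup>2 = (cmod (f x))\<^sup>2 * ((1 - \<gamma>)\<^sup>2 * t powr (2 * \<gamma> - 2))"
        proof -
          have "(t powr (1 - \<gamma>))\<^sup>2 * t powr (2 * \<gamma> - 2) = 1"
            using t by (simp add: power2_eq_square powr_add[symmetric])
          then have "1 / (t powr (1 - \<gamma>))\<^sup>2 = t powr (2 * \<gamma> - 2)"
            using t by (simp add: field_simps)
          moreover have "(cmod (f x))\<^sup>2 / E\<^sup>2 = (cmod (f x))\<^sup>2 * ((1 - \<gamma>)\<^sup>2 * (1 / (t powr (1 - \<gamma>))\<^sup>2))"
            by (simp add: E_def power_divide)
          ultimately show ?thesis by (simp only:)
        qed
        finally show "ennreal ((cmod (f x))\<^sup>2) / (riem_bdist \<Omega> \<gamma> x)\<^sup>2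
            \<le> ennreal ((cmod (f x))\<^sup>2 * ((1 - \<gamma>)\<^sup>2 * bdist \<Omega> x powr (2 * \<gamma> - 2)))" by (simp add: t_def)
      qed
      also have "\<dots> = (\<integral>\<^sup>+x. ennreal ((cmod (f x))\<^sup>2 * ((1 - \<gamma>)\<^sup>2 * bdist \<Omega> x powr (2 * \<gamma> - 2))
          * bdist \<Omega> x powr (- (?N * \<gamma>))) \<partial>lebesgue_on \<Omega>)"
        by (rule nn_integral_dvol, intro borel_measurable_times f2m borel_measurable_bdist_powr borel_measurable_const) simp
      also have "\<dots> = (\<integral>\<^sup>+x. ennreal (c\<^sup>2) * ennreal (s\<^sup>2 * (cmod (f x))\<^sup>2 * bdist \<Omega> x powr ((2 - ?N) * \<gamma> - 2)) \<partial>lebesgue_on \<Omega>)"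
      proof (rule nn_integral_cong)
        fix x
        \<comment> \<open>The volume density shifts the exponent 2\<gamma> - 2 coming from the
          distance to (2 - N)\<gamma> - 2, the Hardy exponent.\<close>
        have "bdist \<Omega> x powr (2 * \<gamma> - 2) * bdist \<Omega> x powr (- (?N * \<gamma>)) = bdist \<Omega> x powr ((2 - ?N) * \<gamma> - 2)"
          by (simp add: powr_add[symmetric] algebra_simps)
        moreover have "(1 - \<gamma>)\<^sup>2 = c\<^sup>2 * s\<^sup>2" using s by (simp add: c_def power_divide)
        ultimately have "(cmod (f x))\<^sup>2 * ((1 - \<gamma>)\<^sup>2 * bdist \<Omega> x powr (2 * \<gamma> - 2)) * bdist \<Omega> x powr (- (?N * \<gamma>))
          = c\<^sup>2 * (s\<^sup>2 * (cmod (f x))\<^sup>2 * bdist \<Omega> x powr ((2 - ?N) * \<gamma> - 2))"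
          by (simp only: mult_ac)
        then show "ennreal ((cmod (f x))\<^sup>2 * ((1 - \<gamma>)\<^sup>2 * bdist \<Omega> x powr (2 * \<gamma> - 2)) * bdist \<Omega> x powr (- (?N * \<gamma>)))
          = ennreal (c\<^sup>2) * ennreal (s\<^sup>2 * (cmod (f x))\<^sup>2 * bdist \<Omega> x powr ((2 - ?N) * \<gamma> - 2))"
          by (simp only:) (simp add: ennreal_mult)
      qed
      also have "\<dots> = ennreal (c\<^sup>2) * (\<integral>\<^sup>+x. ennreal (s\<^sup>2 * (cmod (f x))\<^sup>2 * bdist \<Omega> x powr ((2 - ?N) * \<gamma> - 2)) \<partial>lebesgue_on \<Omega>)"
        by (rule nn_integral_cmult, rule measurable_compose[OF _ measurable_ennreal],
            intro borel_measurable_times f2m borel_measurable_bdist_powr borel_measurable_const)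
      also have "\<dots> \<le> ennreal (c\<^sup>2) * (Qform \<Omega> \<gamma> f + ennreal a * L2_normsq \<Omega> \<gamma> f)"
        by (intro mult_left_mono Hardy_W12_0[OF assms(1) fr a H f]) auto
      finally show ?thesis .
    qed
    then show ?thesis using a by blast
  qed
  then have "weak_Hardy \<Omega> \<gamma> c" using c by (auto simp: weak_Hardy_def)
  moreover have "c = 2 * (1 - \<gamma>) / (1 + (?N - 2) * \<gamma>)" by (simp add: c_def s_def)
  ultimately show ?thesis by auto
qed

end
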